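(* Fix $n,m\in\mathbb{N}$ and put $d:=\min(n,m-1)$. Let $\operatorname{LinEq}_{n,m}$ be the multivalued mapping defined on $\operatorname{dom}(\operatorname{LinEq}_{n,m}):=\{A\in\mathbb{R}^{n\times m}:\operatorname{rank}(A)\leq d\}$ by $A\mapsto \operatorname{kernel}(A)\setminus\{0\}\subseteq\mathbb{R}^m$. Then $\operatorname{LinEq}_{n,m}(A)\neq\emptyset$ for every $A$ in this domain, and $$\mathfrak{C}_{\rm t}(\operatorname{LinEq}_{n,m})=\mathfrak{C}_{\rm c}(\operatorname{LinEq}_{n,m},\rho^{n\times m},\rho^m)=d+1.$$
   Context: A multivalued mapping $f:\subseteq X\rightrightarrows Y$ assigns to each $x$ a set $f(x)\subseteq Y$, and $\operatorname{dom}(f):=\{x: f(x)\neq\emptyset\}$; any element of $f(x)$ is an acceptable output. For topological spaces, $f$ is continuous at $x$ if there is $y\in f(x)$ such that for every open neighbourhood $V$ of $y$ there is a neighbourhood $U$ of $x$ with $f(z)\cap V\neq\emptyset$ for all $z\in U\cap\operatorname{dom}(f)$; $f$ is continuous if it is continuous at every point of its domain (for single-valued maps this is ordinary continuity). $\mathfrak{C}_{\rm t}(f)$ is the least cardinality of a partition $\Delta$ of $\operatorname{dom}(f)$ such that the restriction $f|_D$ is continuous for every $D\in\Delta$. $\rho$ denotes the Cauchy representation of $\mathbb{R}$ (a name of $x$ is an encoding, as an infinite binary string, of a sequence of rationals $q_k$ with $|x-q_k|\le 2^{-k}$); $\rho^k$ is its componentwise extension to $\mathbb{R}^k$ (matrices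 are represented entrywise). For represented spaces $(A,\alpha),(B,\beta)$, $f:\subseteq A\rightrightarrows B$ is $(\alpha,\beta)$-computable with $k$-wise advice if there is an (at most countable) partition $\Delta$ of $\operatorname{dom}(f)$ with $\operatorname{Card}(\Delta)=k$ and a notation $\delta$ of $\Delta$ such that some Type-2 Turing machine, given an $\alpha$-name of any $a$ and a $\delta$-name of the $D\in\Delta$ with $a\in D$, outputs a $\beta$-name of some element of $f(a)$. $\mathfrak{C}_{\rm c}(f,\alpha,\beta)$ is the least such $k$. *)

theory Defs
  imports
    "HOL-Analysis.Function_Topology"
    "HOL-Library.Disjoint_Sets"
    "HOL-Library.Extended_Nat"
    "HOL-Library.Countable_Set"
    "Jordan_Normal_Form.Matrix_Kernel"
    "Jordan_Normal_Form.DL_Rank"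
begin

section \<open>Multivalued mappings and the topological cardinal of discontinuity\<close>

text \<open>
  A partial multivalued mapping from \<open>'a\<close> to \<open>'b\<close> is a total set-valued function; a point belongs
  to its domain iff its value is nonempty.
\<close>

definition mv_dom :: "('a \<Rightarrow> 'b set) \<Rightarrow> 'a set" where
  "mv_dom f = {x. f x \<noteq> {}}"

definition mv_restrict :: "('a \<Rightarrow> 'b set) \<Rightarrow> 'a set \<Rightarrow> 'a \<Rightarrow> 'b set" where
  "mv_restrict f D = (\<lambda>x. if x \<in> D then f x else {})"

definition mv_continuous_at ::
  "'a topology \<Rightarrow> 'b topology \<Rightarrow> ('a \<Rightarrow> 'b set) \<Rightarrow> 'a \<Rightarrow> bool" where
  "mv_continuous_at X Y f x \<longleftrightarrow>
     (\<exists>y\<in>f x. \<forall>V. openin Y V \<and> y \<in> V \<longrightarrow>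
        (\<exists>U. openin X U \<and> x \<in> U \<and> (\<forall>z\<in>U \<inter> mv_dom f. f z \<inter> V \<noteq> {})))"

definition mv_continuous :: "'a topology \<Rightarrow> 'b topology \<Rightarrow> ('a \<Rightarrow> 'b set) \<Rightarrow> bool" where
  "mv_continuous X Y f \<longleftrightarrow> (\<forall>x\<in>mv_dom f. mv_continuous_at X Y f x)"

text \<open>
  Cardinalities are measured in \<^typ>\<open>enat\<close>, so all infinite cardinals are identified with \<open>\<infinity>\<close>.
  The infimum is then the least cardinality whenever that is finite, and the infimum of the empty
  set is \<open>\<infinity>\<close>.
\<close>

definition ecard :: "'a set \<Rightarrow> enat" where
  "ecard A = (if finite A then enat (card A) else \<infinity>)"

definition card_discontinuity ::
  "'a topology \<Rightarrow> 'b topology \<Rightarrow> ('a \<Rightarrow> 'b set) \<Rightarrow> enat" where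
  "card_discontinuity X Y f =
     Inf {ecard \<Delta> |\<Delta>. partition_on (mv_dom f) \<Delta> \<and>
                     (\<forall>D\<in>\<Delta>. mv_continuous X Y (mv_restrict f D))}"


section \<open>Type-2 Turing machines\<close>

text \<open>
  A machine has finitely many one-way read-only input tapes, finitely many work tapes that are
  infinite in both directions, and a one-way write-only output tape. States and work symbols are
  initial segments of the naturals; the work symbol 0 is the blank. Input cells carry a bit or are
  blank (\<open>None\<close>). There are no halting states, because a machine producing an infinite string
  has to run forever.

  In one step, depending on the state and on the scanned input and work symbols, the machine enters
  a new state, advances some of its input heads by one cell, writes a symbol on every work tape,
  moves every work head by at most one cell, and possibly appends a bit to its output.
\<close>

record action =
  next_state :: nat
  advance :: "nat \<Rightarrow> bool"
  write_sym :: "nat \<Rightarrow> nat"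
  shift :: "nat \<Rightarrow> int"
  emit :: "bool option"

record type2_machine =
  num_inputs :: nat
  num_works :: nat
  num_states :: nat
  num_symbols :: nat
  start_state :: nat
  delta :: "nat \<Rightarrow> bool option list \<Rightarrow> nat list \<Rightarrow> action"

definition type2_wf :: "type2_machine \<Rightarrow> bool" where
  "type2_wf M \<longleftrightarrow>
     start_state M < num_states M \<and> 0 < num_symbols M \<and>
     (\<forall>q us vs. q < num_states M \<and> length us = num_inputs M \<and>
        length vs = num_works M \<and> set vs \<subseteq> {..<num_symbols M} \<longrightarrow>
        next_state (delta M q us vs) < num_states M \<and>
        (\<forall>i<num_works M. write_sym (delta M q us vs) i < num_symbols M \<and>
                          shift (delta M q us vs) i \<in> {-1, 0, 1}))"

record config =
  state :: nat
  in_head :: "nat \<Rightarrow> nat"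
  tape :: "nat \<Rightarrow> int \<Rightarrow> nat"
  head :: "nat \<Rightarrow> int"
  outp :: "bool list"

definition type2_init :: "type2_machine \<Rightarrow> config" where
  "type2_init M = \<lparr>state = start_state M, in_head = (\<lambda>_. 0), tape = (\<lambda>_ _. 0),
                   head = (\<lambda>_. 0), outp = []\<rparr>"

definition type2_step ::
  "type2_machine \<Rightarrow> (nat \<Rightarrow> bool option) list \<Rightarrow> config \<Rightarrow> config" where
  "type2_step M xs c =
     (let us = map (\<lambda>i. (xs ! i) (in_head c i)) [0..<num_inputs M];
          vs = map (\<lambda>i. tape c i (head c i)) [0..<num_works M];
          a = delta M (state c) us vs
      in \<lparr>state = next_state a,
          in_head = (\<lambda>i. if advance a i then in_head c i + 1 else in_head c i),
          tape = (\<lambda>i. (tape c i)(head c i := write_sym a i)),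
          head = (\<lambda>i. head c i + shift a i),
          outp = outp c @ (case emit a of None \<Rightarrow> [] | Some b \<Rightarrow> [b])\<rparr>)"

definition type2_run ::
  "type2_machine \<Rightarrow> (nat \<Rightarrow> bool option) list \<Rightarrow> nat \<Rightarrow> config" where
  "type2_run M xs t = (type2_step M xs ^^ t) (type2_init M)"

definition type2_outputs ::
  "type2_machine \<Rightarrow> (nat \<Rightarrow> bool option) list \<Rightarrow> (nat \<Rightarrow> bool) \<Rightarrow> bool" where
  "type2_outputs M xs q \<longleftrightarrow>
     (\<forall>t. \<forall>i<length (outp (type2_run M xs t)). outp (type2_run M xs t) ! i = q i) \<and>
     (\<forall>l. \<exists>t. l \<le> length (outp (type2_run M xs t)))"

definition inf_tape :: "(nat \<Rightarrow> bool) \<Rightarrow> nat \<Rightarrow> bool option" where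
  "inf_tape p = (\<lambda>i. Some (p i))"

definition word_tape :: "bool list \<Rightarrow> nat \<Rightarrow> bool option" where
  "word_tape w = (\<lambda>i. if i < length w then Some (w ! i) else None)"


section \<open>Representations and computability with discrete advice\<close>

text \<open>A representation is given by its naming relation: \<open>\<alpha> p a\<close> says that \<open>p\<close> is an \<open>\<alpha>\<close>-name of \<open>a\<close>.\<close>

type_synonym 'a representation = "(nat \<Rightarrow> bool) \<Rightarrow> 'a \<Rightarrow> bool"

definition is_notation :: "(bool list \<rightharpoonup> 'a) \<Rightarrow> 'a set \<Rightarrow> bool" where
  "is_notation \<delta> \<Delta> \<longleftrightarrow> ran \<delta> = \<Delta>"

definition computable_with_partition ::
  "'a representation \<Rightarrow> 'b representation \<Rightarrow> ('a \<Rightarrow> 'b set) \<Rightarrow> 'a set set \<Rightarrow> bool" where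
  "computable_with_partition \<alpha> \<beta> f \<Delta> \<longleftrightarrow>
     partition_on (mv_dom f) \<Delta> \<and> countable \<Delta> \<and>
     (\<exists>\<delta> M. is_notation \<delta> \<Delta> \<and> type2_wf M \<and> num_inputs M = 2 \<and>
        (\<forall>D w a p. \<delta> w = Some D \<and> a \<in> D \<and> \<alpha> p a \<longrightarrow>
           (\<exists>q b. type2_outputs M [inf_tape p, word_tape w] q \<and> \<beta> q b \<and> b \<in> f a)))"

definition card_advice ::
  "'a representation \<Rightarrow> 'b representation \<Rightarrow> ('a \<Rightarrow> 'b set) \<Rightarrow> enat" where
  "card_advice \<alpha> \<beta> f = Inf {ecard \<Delta> |\<Delta>. computable_with_partition \<alpha> \<beta> f \<Delta>}"

text \<open>
  The infinite binary string consisting, for \<open>k = 0, 1, 2, \<dots>\<close>, of \<open>s k\<close> ones followed by a zero: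
  the zero that closes block \<open>k\<close> is at position \<open>s 0 + \<dots> + s k + k\<close>.
\<close>

definition block_code :: "(nat \<Rightarrow> nat) \<Rightarrow> nat \<Rightarrow> bool" where
  "block_code s = (\<lambda>t. \<forall>k. t \<noteq> (\<Sum>i\<le>k. s i) + k)"

text \<open>
  The Cauchy representation of the reals. Rationals are numbered by \<^const>\<open>nat_to_rat_surj\<close>, which
  decodes a natural number to a pair of integers (numerator, denominator).
\<close>

definition cauchy_rep :: "real representation" where
  "cauchy_rep p x \<longleftrightarrow>
     (\<exists>s. p = block_code s \<and> (\<forall>k. \<bar>x - real_of_rat (nat_to_rat_surj (s k))\<bar> \<le> (1/2) ^ k))"

text \<open>
  Finite products: a name of a vector of length \<open>k\<close> is the interleaving of names of its components.
  Matrices are read row by row.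
\<close>

definition cauchy_vec_rep :: "nat \<Rightarrow> real vec representation" where
  "cauchy_vec_rep k p v \<longleftrightarrow>
     v \<in> carrier_vec k \<and> (\<forall>j<k. cauchy_rep (\<lambda>t. p (k * t + j)) (v $ j))"

definition cauchy_mat_rep :: "nat \<Rightarrow> nat \<Rightarrow> real mat representation" where
  "cauchy_mat_rep n m p A \<longleftrightarrow>
     A \<in> carrier_mat n m \<and>
     cauchy_vec_rep (n * m) p (vec (n * m) (\<lambda>l. A $$ (l div m, l mod m)))"


section \<open>Homogeneous systems of linear equations\<close>

text \<open>
  The Euclidean topologies on vectors and matrices of fixed dimensions, transported from the product
  topology along the map to the family of entries.
\<close>

definition vec_topology :: "nat \<Rightarrow> real vec topology" where
  "vec_topology m =
     pullback_topology (carrier_vec m) (\<lambda>v. \<lambda>j\<in>{..<m}. v $ j)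
       (product_topology (\<lambda>_. euclideanreal) {..<m})"

definition mat_topology :: "nat \<Rightarrow> nat \<Rightarrow> real mat topology" where
  "mat_topology n m =
     pullback_topology (carrier_mat n m) (\<lambda>A. \<lambda>ij\<in>{..<n} \<times> {..<m}. A $$ ij)
       (product_topology (\<lambda>_. euclideanreal) ({..<n} \<times> {..<m}))"

text \<open>
  The bound \<open>d = min n (m - 1)\<close> is an integer: it is \<open>-1\<close> for \<open>m = 0\<close>, and then there is no
  admissible matrix.
\<close>

definition lineq_bound :: "nat \<Rightarrow> nat \<Rightarrow> int" where
  "lineq_bound n m = min (int n) (int m - 1)"

definition lineq_dom :: "nat \<Rightarrow> nat \<Rightarrow> real mat set" where
  "lineq_dom n m = {A \<in> carrier_mat n m. int (vec_space.rank n A) \<le> lineq_bound n m}"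

definition LinEq :: "nat \<Rightarrow> nat \<Rightarrow> real mat \<Rightarrow> real vec set" where
  "LinEq n m A = (if A \<in> lineq_dom n m then mat_kernel A - {0\<^sub>v m} else {})"

end

theory Submission
  imports Defs
begin

text \<open>
  Lower bound. Suppose that \<open>A\<close> has only \<open>i < d\<close> non-zero rows, lies in the class \<open>D\<close>, and
  that \<open>y\<close> witnesses the continuity of the restriction to \<open>D\<close> at \<open>A\<close>. Choose \<open>j\<close> with
  \<open>y\<^sub>j \<noteq> 0\<close> and put a small multiple of \<open>e\<^sub>j\<close> into row \<open>i\<close>. All matrices near \<open>A\<close> whose kernel is
  contained in that of the new matrix have only kernel vectors with vanishing component \<open>j\<close>, so
  they avoid \<open>D\<close>. Iterating from \<open>A = 0\<close> meets \<open>d + 1\<close> classes.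

  Since a machine has read only finitely much of its input when it fixes a prefix of its output,
  computability with a partition implies continuity on its classes.

  Upper bound. The advice is the rank \<open>r\<close>. The machine searches for \<open>m - r\<close> coordinates such that
  \<open>A\<close>, bordered by them, is injective, which a rational approximate left inverse certifies. The
  system \<open>A v = 0\<close> with the first selected coordinate equal to 1 and the others equal to 0 then
  has a unique solution, and approximations of it are found and verified by search. Primitive
  recursive tests are performed by counter programs, compiled to machines whose head positions are
  the counters.
\<close>

section \<open>Unary primitive recursive functions\<close>

text \<open>A certificate can establish that the bordered matrix is injective, since this is stable
  under small errors, but not that the bordered system is solvable. The advice closes this gap. With
  \<open>k = m - r\<close> borders, the kernel condition of rank \<open>r\<close> and the vanishing
  of \<open>k - 1\<close> coordinates leave a nonzero vector, and injectivity prevents its first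
  selected coordinate from being 0. With more borders the system may have no solution; with fewer
  the matrix is never injective.

  Uniqueness answers the multivaluedness: kernel vectors approximated independently need not
  converge to a common one, whereas all candidates that pass the test approximate the same vector.

  An unbounded search inside one simulated step might never end. Therefore each round reads one bit,
  tests one candidate against the bits known so far and emits at most one bit; rounds are primitive
  recursive, and only their number is unbounded.

  The lower bound knows nothing of the vector chosen by continuity but one coordinate in which it is
  not 0. That is why the perturbation is a single entry in a fresh row: it kills this coordinate
  throughout the kernel.\<close>

abbreviation pair :: "nat \<Rightarrow> nat \<Rightarrow> nat" ("\<langle>_,/ _\<rangle>") where
  "\<langle>a, b\<rangle> \<equiv> prod_encode (a, b)"

definition pfst :: "nat \<Rightarrow> nat" where "pfst x = fst (prod_decode x)"
definition psnd :: "nat \<Rightarrow> nat" where "psnd x = snd (prod_decode x)"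

lemma pfst_pair [simp]: "pfst \<langle>a, b\<rangle> = a" and psnd_pair [simp]: "psnd \<langle>a, b\<rangle> = b"
  by (simp_all add: pfst_def psnd_def)

lemma pair_pfst_psnd [simp]: "\<langle>pfst x, psnd x\<rangle> = x"
  by (simp add: pfst_def psnd_def)

text \<open>
  With Cantor pairing, the unary primitive recursive functions suffice: tuples of arguments and
  program states are coded as single numbers.
\<close>

inductive pr :: "(nat \<Rightarrow> nat) \<Rightarrow> bool" where
  zero: "pr (\<lambda>x. 0)"
| suc: "pr Suc"
| ident: "pr (\<lambda>x. x)"
| pfst: "pr pfst"
| psnd: "pr psnd"
| pair: "pr f \<Longrightarrow> pr g \<Longrightarrow> pr (\<lambda>x. \<langle>f x, g x\<rangle>)"
| comp: "pr f \<Longrightarrow> pr g \<Longrightarrow> pr (\<lambda>x. f (g x))"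
| iter: "pr f \<Longrightarrow> pr (\<lambda>x. (f ^^ pfst x) (psnd x))"

definition prp :: "(nat \<Rightarrow> bool) \<Rightarrow> bool" where
  "prp P \<longleftrightarrow> pr (\<lambda>x. of_bool (P x))"

lemma pr_Suc: "pr f \<Longrightarrow> pr (\<lambda>x. Suc (f x))"
  by (rule pr.comp[OF pr.suc])

lemma pr_pfst: "pr f \<Longrightarrow> pr (\<lambda>x. pfst (f x))"
  by (rule pr.comp[OF pr.pfst])

lemma pr_psnd: "pr f \<Longrightarrow> pr (\<lambda>x. psnd (f x))"
  by (rule pr.comp[OF pr.psnd])

lemma pr_const: "pr (\<lambda>x. c)"
  by (induction c) (auto intro: pr.zero pr_Suc)

lemma pr_funpow:
  assumes "pr f" "pr n" "pr a"
  shows "pr (\<lambda>x. (f ^^ n x) (a x))"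
  using pr.comp[OF pr.iter[OF assms(1)] pr.pair[OF assms(2,3)]] by simp

text \<open>\<open>iter\<close> iterates a unary function without parameters, so the parameter and
  the loop counter travel inside the iterated state.\<close>

lemma pr_rec:
  assumes "pr a" "pr (\<lambda>z. h (pfst z) (pfst (psnd z)) (psnd (psnd z)))" "pr n"
  shows "pr (\<lambda>x. rec_nat (a x) (h x) (n x))"
proof -
  define G where "G z = \<langle>pfst z, \<langle>Suc (pfst (psnd z)), h (pfst z) (pfst (psnd z)) (psnd (psnd z))\<rangle>\<rangle>" for z
  have G: "pr G"
    unfolding G_def by (intro pr.pair pr_Suc pr_pfst pr_psnd pr.ident assms(2))
  have "(G ^^ k) \<langle>x, \<langle>0, a x\<rangle>\<rangle> = \<langle>x, \<langle>k, rec_nat (a x) (h x) k\<rangle>\<rangle>" for k x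
    by (induction k) (simp_all add: G_def)
  hence *: "(\<lambda>x. rec_nat (a x) (h x) (n x)) = (\<lambda>x. psnd (psnd ((G ^^ n x) \<langle>x, \<langle>0, a x\<rangle>\<rangle>)))"
    by simp
  show ?thesis
    unfolding * by (intro pr_psnd pr_funpow[OF G] assms pr.pair pr.ident pr_const)
qed

lemma pr_add:
  assumes "pr f" "pr g" shows "pr (\<lambda>x. f x + g x)"
proof -
  have "rec_nat a (\<lambda>_. Suc) b = a + b" for a b
    by (induction b) auto
  thus ?thesis
    using pr_rec[of f "\<lambda>x i y. Suc y" g] assms by (simp add: pr_Suc pr_psnd pr.ident)
qed

lemma pr_sum:
  assumes "pr (\<lambda>z. f (pfst z) (psnd z))" "pr n"
  shows "pr (\<lambda>x. \<Sum>i<n x. f x i)"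
proof -
  have "rec_nat 0 (\<lambda>i y. y + f x i) k = (\<Sum>i<k. f x i)" for x k
    by (induction k) auto
  moreover have "pr (\<lambda>z. f (pfst z) (pfst (psnd z)))"
    using pr.comp[OF assms(1), of "\<lambda>z. \<langle>pfst z, pfst (psnd z)\<rangle>"]
    by (simp add: pr.pair pr_pfst pr_psnd pr.ident)
  ultimately show ?thesis
    using pr_rec[of "\<lambda>x. 0" "\<lambda>x i y. y + f x i" n] assms(2)
    by (simp add: pr_add pr_const pr_psnd pr.ident)
qed

lemma pr_mult:
  assumes "pr f" "pr g" shows "pr (\<lambda>x. f x * g x)"
  using pr_sum[of "\<lambda>x i. f x" g] assms pr.comp[OF assms(1) pr.pfst]
  by (simp add: mult.commute)

lemma pr_power:
  assumes "pr f" "pr g" shows "pr (\<lambda>x. f x ^ g x)"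
proof -
  have "rec_nat (Suc 0) (\<lambda>i y. a * y) b = a ^ b" for a b :: nat
    by (induction b) auto
  moreover have "pr (\<lambda>z. f (pfst z) * psnd (psnd z))"
    by (intro pr_mult pr.comp[OF assms(1)] pr.pfst pr_psnd pr.ident)
  ultimately show ?thesis
    using pr_rec[of "\<lambda>x. Suc 0" "\<lambda>x i y. f x * y" g] assms by (simp add: pr_const)
qed

lemma pr_minus:
  assumes "pr f" "pr g" shows "pr (\<lambda>x. f x - g x)"
proof -
  \<comment> \<open>The predecessor is the recursion that discards the previous value and returns
    the index; subtraction iterates it.\<close>
  have "rec_nat (0::nat) (\<lambda>i y. i) b = b - Suc 0" for b
    by (cases b) auto
  hence pred: "pr (\<lambda>x. x - Suc 0)"
    using pr_rec[of "\<lambda>x. 0" "\<lambda>x i y. i" "\<lambda>x. x"]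
    by (simp add: pr_const pr_pfst pr_psnd pr.ident)
  have "rec_nat a (\<lambda>_ y. y - Suc 0) b = a - b" for a b :: nat
    by (induction b) auto
  thus ?thesis
    using pr_rec[of f "\<lambda>x i y. y - Suc 0" g] assms
    by (simp add: pr.comp[OF pred] pr_psnd pr.ident)
qed

lemma prp_le:
  assumes "pr f" "pr g" shows "prp (\<lambda>x. f x \<le> g x)"
proof -
  have "of_bool (a \<le> b) = Suc 0 - (a - b)" for a b by auto
  thus ?thesis
    unfolding prp_def using pr_minus[OF pr_const[of 1] pr_minus[OF assms]] by simp
qed

lemma prp_not: "prp P \<Longrightarrow> prp (\<lambda>x. \<not> P x)"
proof -
  have *: "of_bool (\<not> b) = 1 - (of_bool b :: nat)" for b by auto
  show "prp P \<Longrightarrow> prp (\<lambda>x. \<not> P x)"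
    unfolding prp_def * by (intro pr_minus pr_const)
qed

lemma prp_conj: "prp P \<Longrightarrow> prp Q \<Longrightarrow> prp (\<lambda>x. P x \<and> Q x)"
  unfolding prp_def of_bool_conj by (rule pr_mult)

lemma prp_const: "prp (\<lambda>x. b)"
  unfolding prp_def by (rule pr_const)

lemma prp_less: "pr f \<Longrightarrow> pr g \<Longrightarrow> prp (\<lambda>x. f x < g x)"
  using prp_le[OF pr_Suc, of f g] by (simp add: Suc_le_eq)

lemma prp_eq: "pr f \<Longrightarrow> pr g \<Longrightarrow> prp (\<lambda>x. f x = g x)"
  using prp_conj[OF prp_le prp_le, of f g g f] by (simp add: order_eq_iff)

lemma pr_of_bool: "prp P \<Longrightarrow> pr (\<lambda>x. of_bool (P x))"
  by (simp add: prp_def)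

lemma pr_if:
  assumes "prp P" "pr f" "pr g"
  shows "pr (\<lambda>x. if P x then f x else g x)"
proof -
  have *: "(\<lambda>x. if P x then f x else g x) = (\<lambda>x. of_bool (P x) * f x + of_bool (\<not> P x) * g x)"
    by auto
  show ?thesis
    unfolding * by (intro pr_add pr_mult pr_of_bool prp_not assms)
qed

lemma prp_if: "prp P \<Longrightarrow> prp Q \<Longrightarrow> prp R \<Longrightarrow> prp (\<lambda>x. if P x then Q x else R x)"
  unfolding prp_def[of "\<lambda>x. if P x then Q x else R x"] if_distrib[of of_bool]
  by (intro pr_if pr_of_bool)

lemma prp_finite_all:
  assumes "finite I" "\<And>i. i \<in> I \<Longrightarrow> prp (P i)"
  shows "prp (\<lambda>x. \<forall>i\<in>I. P i x)"
  using assms by (induction I rule: finite_induct) (auto intro: prp_const prp_conj)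

lemma prp_all_less: "(\<And>i::nat. i < k \<Longrightarrow> prp (P i)) \<Longrightarrow> prp (\<lambda>x. \<forall>i<k. P i x)"
  using prp_finite_all[of "{..<k}" P] by (simp add: Ball_def)

lemma prp_ex_less:
  assumes "prp (\<lambda>z. P (pfst z) (psnd z))" "pr n"
  shows "prp (\<lambda>x. \<exists>i<n x. P x i)"
proof -
  have *: "(\<exists>i<n x. P x i) \<longleftrightarrow> 0 < (\<Sum>i<n x. of_bool (P x i) :: nat)" for x
    by (auto intro: ccontr simp del: sum_of_bool_eq) 
  show ?thesis
    unfolding * by (intro prp_less pr_sum pr_of_bool pr_const assms)
qed

lemma pr_div:
  assumes "pr f" "pr g"
  shows "pr (\<lambda>x. f x div g x)"
proof -
  \<comment> \<open>The quotient counts the positive multiples of \<open>b\<close> up to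
    \<open>a\<close>; there are at most \<open>a\<close> of them.\<close>
  have "a div b = (if b = 0 then 0 else \<Sum>i<a. of_bool (Suc i * b \<le> a))" for a b :: nat
  proof (cases "b = 0")
    case False
    have "{..<a} \<inter> {i. Suc i * b \<le> a} = {..<a div b}"
    proof (intro Set.set_eqI)
      fix i
      have "Suc i * b \<le> a \<longleftrightarrow> i < a div b"
        using False by (metis less_eq_div_iff_mult_less_eq Suc_le_eq zero_less_iff_neq_zero)
      moreover have "i < a div b \<Longrightarrow> i < a"
        by (meson div_le_dividend less_le_trans)
      ultimately show "i \<in> {..<a} \<inter> {i. Suc i * b \<le> a} \<longleftrightarrow> i \<in> {..<a div b}"
        by auto
    qed
    thus ?thesis using False by simp
  qed simp
  hence *: "(\<lambda>x. f x div g x) = (\<lambda>x. if g x = 0 then 0 else \<Sum>i<f x. of_bool (Suc i * g x \<le> f x))"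
    by blast
  show ?thesis
    unfolding *
    by (intro pr_if prp_eq pr_const assms pr_sum pr_of_bool prp_le pr_mult pr_Suc pr_psnd pr.ident
        pr.comp[OF assms(1)] pr.comp[OF assms(2)] pr.pfst)
qed

lemma pr_mod: "pr f \<Longrightarrow> pr g \<Longrightarrow> pr (\<lambda>x. f x mod g x)"
  unfolding minus_div_mult_eq_mod[symmetric] by (intro pr_minus pr_mult pr_div)

text \<open>Every number is read as an infinite sequence of right-nested first components, so
  neither a length nor an error value is stored.\<close>

definition item :: "nat \<Rightarrow> nat \<Rightarrow> nat" where
  "item x j = pfst ((psnd ^^ j) x)"

lemma item_0 [simp]: "item \<langle>a, b\<rangle> 0 = a"
  by (simp add: item_def)

lemma item_Suc [simp]: "item \<langle>a, b\<rangle> (Suc j) = item b j"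
  by (simp add: item_def funpow_swap1)

lemma pr_item: "pr f \<Longrightarrow> pr g \<Longrightarrow> pr (\<lambda>x. item (f x) (g x))"
  unfolding item_def by (intro pr_pfst pr_funpow pr.psnd)

lemma ex_item: "\<exists>x. \<forall>j<k. item x j = c j"
proof (induction k arbitrary: c)
  case (Suc k)
  from Suc[of "\<lambda>j. c (Suc j)"] obtain x where "\<forall>j<k. item x j = c (Suc j)" by blast
  hence "\<forall>j<Suc k. item \<langle>c 0, x\<rangle> j = c j"
    by (auto simp: less_Suc_eq_0_disj)
  thus ?case by blast
qed simp

section \<open>Primitive recursive functions with rational values\<close>

definition rat_val :: "nat \<Rightarrow> real" where
  "rat_val c = real_of_rat (nat_to_rat_surj c)"

text \<open>The sign is kept as a difference of naturals over a denominator positive at every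
  argument: ring operations need no case distinction, and a comparison becomes one between
  naturals.\<close>

definition prq :: "(nat \<Rightarrow> real) \<Rightarrow> bool" where
  "prq f \<longleftrightarrow> (\<exists>P N D. pr P \<and> pr N \<and> pr D \<and>
     (\<forall>x. 0 < D x \<and> f x = (real (P x) - real (N x)) / real (D x)))"

lemma prqI:
  assumes "pr P" "pr N" "pr D" "\<And>x. 0 < D x" "\<And>x. f x = (real (P x) - real (N x)) / real (D x)"
  shows "prq f"
  unfolding prq_def using assms by blast

lemma prq_of_nat: "pr f \<Longrightarrow> prq (\<lambda>x. real (f x))"
  by (rule prqI[of f "\<lambda>x. 0" "\<lambda>x. 1"]) (auto intro: pr_const)

lemma prq_of_bool: "prp P \<Longrightarrow> prq (\<lambda>x. of_bool (P x))"
  using prq_of_nat[OF pr_of_bool, of P] by simp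

lemma prq_0: "prq (\<lambda>x. 0)"
  using prq_of_nat[OF pr_const[of 0]] by simp

lemma prq_add:
  assumes "prq f" "prq g" shows "prq (\<lambda>x. f x + g x)"
proof -
  from assms obtain P N D P' N' D' where *: "pr P" "pr N" "pr D" "pr P'" "pr N'" "pr D'"
    "\<And>x. 0 < D x \<and> f x = (real (P x) - real (N x)) / real (D x)"
    "\<And>x. 0 < D' x \<and> g x = (real (P' x) - real (N' x)) / real (D' x)"
    unfolding prq_def by metis
  show ?thesis
  proof (rule prqI)
    show "pr (\<lambda>x. P x * D' x + P' x * D x)" "pr (\<lambda>x. N x * D' x + N' x * D x)" "pr (\<lambda>x. D x * D' x)"
      by (intro pr_add pr_mult *)+
    fix x show "0 < D x * D' x" using * by simp
    have fg: "f x = (real (P x) - real (N x)) / real (D x)" "g x = (real (P' x) - real (N' x)) / real (D' x)"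
      and pos: "D x \<noteq> 0" "D' x \<noteq> 0"
      using *(7,8)[of x] by auto
    show "f x + g x = (real (P x * D' x + P' x * D x) - real (N x * D' x + N' x * D x)) / real (D x * D' x)"
      unfolding fg using pos by (simp add: field_simps)
  qed
qed

lemma prq_mult:
  assumes "prq f" "prq g" shows "prq (\<lambda>x. f x * g x)"
proof -
  from assms obtain P N D P' N' D' where *: "pr P" "pr N" "pr D" "pr P'" "pr N'" "pr D'"
    "\<And>x. 0 < D x \<and> f x = (real (P x) - real (N x)) / real (D x)"
    "\<And>x. 0 < D' x \<and> g x = (real (P' x) - real (N' x)) / real (D' x)"
    unfolding prq_def by metis
  show ?thesis
  proof (rule prqI)
    show "pr (\<lambda>x. P x * P' x + N x * N' x)" "pr (\<lambda>x. P x * N' x + N x * P' x)" "pr (\<lambda>x. D x * D' x)"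
      by (intro pr_add pr_mult *)+
    fix x show "0 < D x * D' x" using * by simp
    have fg: "f x = (real (P x) - real (N x)) / real (D x)" "g x = (real (P' x) - real (N' x)) / real (D' x)"
      and pos: "D x \<noteq> 0" "D' x \<noteq> 0"
      using *(7,8)[of x] by auto
    show "f x * g x = (real (P x * P' x + N x * N' x) - real (P x * N' x + N x * P' x)) / real (D x * D' x)"
      unfolding fg using pos by (simp add: field_simps)
  qed
qed

lemma prq_uminus:
  assumes "prq f" shows "prq (\<lambda>x. - f x)"
proof -
  from assms obtain P N D where *: "pr P" "pr N" "pr D" 
    "\<And>x. 0 < D x \<and> f x = (real (P x) - real (N x)) / real (D x)"
    unfolding prq_def by metis
  show ?thesis
    by (rule prqI[of N P D]) (use * in \<open>auto simp: diff_divide_distrib\<close>)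
qed

lemma prq_diff: "prq f \<Longrightarrow> prq g \<Longrightarrow> prq (\<lambda>x. f x - g x)"
  using prq_add[OF _ prq_uminus, of f g] by simp

lemma prp_prq_le:
  assumes "prq f" "prq g" shows "prp (\<lambda>x. f x \<le> g x)"
proof -
  from prq_diff[OF assms] obtain P N D where *: "pr P" "pr N" "pr D" 
    "\<And>x. 0 < D x \<and> f x - g x = (real (P x) - real (N x)) / real (D x)"
    unfolding prq_def by metis
  have "f x \<le> g x \<longleftrightarrow> P x \<le> N x" for x
  proof -
    have "f x \<le> g x \<longleftrightarrow> f x - g x \<le> 0" by simp
    also have "\<dots> \<longleftrightarrow> P x \<le> N x"
      using *(4)[of x] by (simp add: divide_le_0_iff)
    finally show ?thesis .
  qed
  thus ?thesis using prp_le[OF *(1,2)] by simp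
qed

lemma prq_if:
  assumes "prp P" "prq f" "prq g"
  shows "prq (\<lambda>x. if P x then f x else g x)"
proof -
  have *: "(\<lambda>x. if P x then f x else g x) = (\<lambda>x. of_bool (P x) * f x + of_bool (\<not> P x) * g x)"
    by auto
  show ?thesis
    unfolding * by (intro prq_add prq_mult prq_of_bool prp_not assms)
qed

lemma prq_abs: "prq f \<Longrightarrow> prq (\<lambda>x. \<bar>f x\<bar>)"
proof -
  have *: "\<bar>a\<bar> = (if 0 \<le> a then a else - a)" for a :: real by simp
  show "prq f \<Longrightarrow> prq (\<lambda>x. \<bar>f x\<bar>)"
    unfolding * by (intro prq_if prp_prq_le prq_0 prq_uminus)
qed

lemma prq_sum: "(\<And>i. i \<in> I \<Longrightarrow> prq (f i)) \<Longrightarrow> prq (\<lambda>x. \<Sum>i\<in>I. f i x)"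
  by (induction I rule: infinite_finite_induct) (auto intro: prq_0 prq_add)

lemma prq_inverse_of_nat: "pr f \<Longrightarrow> (\<And>x. 0 < f x) \<Longrightarrow> prq (\<lambda>x. 1 / real (f x))"
  by (rule prqI[of "\<lambda>x. 1" "\<lambda>x. 0" f]) (auto intro: pr_const)

lemma prq_half_power: "pr f \<Longrightarrow> prq (\<lambda>x. (1/2) ^ f x)"
  using prq_inverse_of_nat[of "\<lambda>x. 2 ^ f x"] by (simp add: pr_power pr_const power_one_over)

lemma prq_int_decode:
  assumes "pr f" shows "prq (\<lambda>x. real_of_int (int_decode (f x)))"
proof -
  have *: "real_of_int (int_decode a) =
      (if a mod 2 = 0 then real (a div 2) else - (real (a div 2) + real 1))" for a
    by (auto simp: int_decode_def sum_decode_def even_iff_mod_2_eq_zero)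
  show ?thesis
    unfolding * by (intro prq_if prp_eq pr_mod pr_div pr_const assms prq_of_nat prq_uminus prq_add)
qed

lemma prq_inverse:
  assumes "prq f" shows "prq (\<lambda>x. 1 / f x)"
proof -
  from assms obtain P N D where *: "pr P" "pr N" "pr D" 
    "\<And>x. 0 < D x \<and> f x = (real (P x) - real (N x)) / real (D x)"
    unfolding prq_def by metis
  \<comment> \<open>The form \<open>Suc (_ - 1)\<close> keeps the denominators positive also at
    arguments where another branch is taken; the last branch is the convention
    \<open>1 / 0 = 0\<close>.\<close>
  have "1 / f x = (if N x < P x then real (D x) * (1 / real (Suc (P x - N x - 1)))
     else if P x < N x then - (real (D x) * (1 / real (Suc (N x - P x - 1)))) else 0)" for x
  proof -
    have "f x = (real (P x) - real (N x)) / real (D x)" and pos: "D x \<noteq> 0"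
      using *(4)[of x] by auto
    moreover have "real (Suc (a - b - 1)) = real a - real b" if "b < a" for a b
      using that by (simp add: of_nat_diff Suc_diff_Suc del: of_nat_Suc)
    ultimately show ?thesis
      by (auto simp: divide_simps mult.commute simp del: of_nat_Suc)
  qed
  hence **: "(\<lambda>x. 1 / f x) = (\<lambda>x. if N x < P x then real (D x) * (1 / real (Suc (P x - N x - 1)))
     else if P x < N x then - (real (D x) * (1 / real (Suc (N x - P x - 1)))) else 0)" by blast
  show ?thesis
    unfolding ** 
    by (intro prq_if prp_less prq_mult prq_uminus prq_of_nat prq_inverse_of_nat prq_0 pr_Suc
        pr_minus pr_const *) auto
qed

lemma prq_rat_val:
  assumes "pr f" shows "prq (\<lambda>x. rat_val (f x))"
proof -
  have *: "rat_val a = real_of_int (int_decode (pfst a)) * (1 / real_of_int (int_decode (psnd a)))" for a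
    by (simp add: rat_val_def nat_to_rat_surj_def pfst_def psnd_def case_prod_beta Fract_of_int_quotient
        of_rat_divide)
  show ?thesis
    unfolding * by (intro prq_mult prq_inverse prq_int_decode pr_pfst pr_psnd assms)
qed

section \<open>Counter programs\<close>

datatype com =
    Inc nat | Dec nat | Seq com com (infixr ";;" 60) | While nat com | Cond nat com com
  | Read nat | Emit bool

type_synonym cstate = "(nat \<Rightarrow> nat) \<times> nat \<times> bool list"

text \<open>A big-step semantics suffices because only a single round of the machine has to
  terminate. The state holds the counters, the number of input bits read and the output.\<close>

inductive exec :: "(nat \<Rightarrow> bool) \<Rightarrow> com \<Rightarrow> cstate \<Rightarrow> cstate \<Rightarrow> bool" for p where
  Inc: "exec p (Inc r) (s, io) (s(r := Suc (s r)), io)"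
| Dec: "exec p (Dec r) (s, io) (s(r := s r - 1), io)"
| Seq: "exec p c x y \<Longrightarrow> exec p d y z \<Longrightarrow> exec p (c ;; d) x z"
| WhileF: "s r = 0 \<Longrightarrow> exec p (While r c) (s, io) (s, io)"
| WhileT: "s r \<noteq> 0 \<Longrightarrow> exec p c (s, io) y \<Longrightarrow> exec p (While r c) y z \<Longrightarrow>
    exec p (While r c) (s, io) z"
| CondT: "s r \<noteq> 0 \<Longrightarrow> exec p c (s, io) y \<Longrightarrow> exec p (Cond r c d) (s, io) y"
| CondF: "s r = 0 \<Longrightarrow> exec p d (s, io) y \<Longrightarrow> exec p (Cond r c d) (s, io) y"
| Read: "exec p (Read r) (s, k, os) (s(r := s r + of_bool (p k)), Suc k, os)"
| Emit: "exec p (Emit b) (s, k, os) (s, k, os @ [b])"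

lemma exec_eq: "exec p c x y \<Longrightarrow> y = z \<Longrightarrow> exec p c x z"
  by simp

definition Clear :: "nat \<Rightarrow> com" where "Clear a = While a (Dec a)"
definition Move :: "nat \<Rightarrow> nat \<Rightarrow> com" where "Move a b = While a (Dec a ;; Inc b)"
definition Spread :: "nat \<Rightarrow> nat \<Rightarrow> nat \<Rightarrow> com" where
  "Spread a b c = While a (Dec a ;; Inc b ;; Inc c)"
definition Copy :: "nat \<Rightarrow> nat \<Rightarrow> nat \<Rightarrow> com" where "Copy a b t = Spread a b t ;; Move t a"
text \<open>Cantor's code of \<open>(x, y)\<close> is \<open>triangle (x + y) + x\<close>: the first
  \<open>Spread\<close> puts \<open>x\<close> into \<open>d\<close> and \<open>x + y\<close> into
  \<open>b\<close>, and the loop adds \<open>b\<close>, \<open>b - 1\<close>, ..., 1 to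
  \<open>d\<close>.\<close>

definition Enc :: "nat \<Rightarrow> nat \<Rightarrow> nat \<Rightarrow> com" where
  "Enc a b d = Spread a d b ;; While b (Spread b d a ;; Move a b ;; Dec b) ;; Move d a"
text \<open>
  The loop of \<open>Decode\<close> enumerates the pairs in the order of their codes.
\<close>

definition Decode :: "nat \<Rightarrow> nat \<Rightarrow> nat \<Rightarrow> com" where
  "Decode a b c = Move a c ;; While c (Dec c ;; Cond b (Dec b ;; Inc a) (Move a b ;; Inc b))"
definition Out :: "nat \<Rightarrow> bool \<Rightarrow> com" where "Out a v = While a (Dec a ;; Emit v)"

lemma exec_Clear: "exec p (Clear a) (s, io) (s(a := 0), io)"
proof (induction "s a" arbitrary: s)
  case 0
  thus ?case unfolding Clear_def by (auto intro!: exec_eq[OF exec.WhileF])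
next
  case (Suc n)
  let ?s = "s(a := s a - 1)"
  have "exec p (Clear a) (?s, io) (s(a := 0), io)"
    using Suc(1)[of ?s] Suc(2) by simp
  thus ?case
    using Suc(2) unfolding Clear_def by (auto intro: exec.WhileT exec.Dec)
qed

lemma exec_Move:
  assumes "a \<noteq> b"
  shows "exec p (Move a b) (s, io) (s(b := s b + s a, a := 0), io)"
proof (induction "s a" arbitrary: s)
  case 0
  thus ?case unfolding Move_def by (auto intro!: exec_eq[OF exec.WhileF])
next
  case (Suc n)
  let ?s = "s(a := s a - 1, b := Suc (s b))"
  have "exec p (Move a b) (?s, io) (s(b := s b + s a, a := 0), io)"
    by (rule exec_eq[OF Suc(1)]) (use Suc(2) assms in auto)
  moreover have "exec p (Dec a ;; Inc b) (s, io) (?s, io)"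
    by (rule exec_eq[OF exec.Seq[OF exec.Dec exec.Inc]]) (use assms in auto)
  ultimately show ?case
    using Suc(2) unfolding Move_def by (auto intro: exec.WhileT)
qed

lemma exec_Spread:
  assumes "a \<noteq> b" "a \<noteq> c" "b \<noteq> c"
  shows "exec p (Spread a b c) (s, io) (s(b := s b + s a, c := s c + s a, a := 0), io)"
proof (induction "s a" arbitrary: s)
  case 0
  thus ?case unfolding Spread_def by (auto intro!: exec_eq[OF exec.WhileF])
next
  case (Suc n)
  let ?s = "s(a := s a - 1, b := Suc (s b), c := Suc (s c))"
  have "exec p (Spread a b c) (?s, io) (s(b := s b + s a, c := s c + s a, a := 0), io)"
    by (rule exec_eq[OF Suc(1)]) (use Suc(2) assms in auto)
  moreover have "exec p (Dec a ;; Inc b ;; Inc c) (s, io) (?s, io)"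
    by (rule exec_eq[OF exec.Seq[OF exec.Dec exec.Seq[OF exec.Inc exec.Inc]]]) (use assms in auto)
  ultimately show ?case
    using Suc(2) unfolding Spread_def by (auto intro: exec.WhileT)
qed

lemma exec_Copy:
  assumes "a \<noteq> b" "a \<noteq> t" "b \<noteq> t" "s t = 0"
  shows "exec p (Copy a b t) (s, io) (s(b := s b + s a), io)"
  unfolding Copy_def
  by (rule exec_eq[OF exec.Seq[OF exec_Spread exec_Move]]) (use assms in auto)

lemma exec_Enc:
  assumes "a \<noteq> b" "a \<noteq> d" "b \<noteq> d" "s d = 0"
  shows "exec p (Enc a b d) (s, io) (s(a := \<langle>s a, s b\<rangle>, b := 0), io)"
proof -
  let ?loop = "While b (Spread b d a ;; Move a b ;; Dec b)"
  have loop: "exec p ?loop (s, io) (s(d := s d + triangle (s b), b := 0), io)" if "s a = 0" for s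
    using that
  proof (induction "s b" arbitrary: s)
    case 0
    thus ?case by (auto intro!: exec_eq[OF exec.WhileF])
  next
    case (Suc n)
    let ?s = "s(d := s d + s b, b := s b - 1)"
    have "exec p ?loop (?s, io) (s(d := s d + triangle (s b), b := 0), io)"
      by (rule exec_eq[OF Suc(1)]) (use Suc(2,3) assms in \<open>auto simp flip: Suc(2)\<close>)
    moreover have "exec p (Spread b d a ;; Move a b ;; Dec b) (s, io) (?s, io)"
      by (rule exec_eq[OF exec.Seq[OF exec_Spread exec.Seq[OF exec_Move exec.Dec]]])
        (use assms Suc(2,3) in auto)
    ultimately show ?case
      using Suc(2) by (auto intro: exec.WhileT)
  qed
  show ?thesis
    unfolding Enc_def
    by (rule exec_eq[OF exec.Seq[OF exec_Spread exec.Seq[OF loop exec_Move]]])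
      (use assms in \<open>auto simp: prod_encode_def add.commute\<close>)
qed

text \<open>The enumeration runs along each diagonal with growing first component and passes from
  its end to the start of the next diagonal.\<close>

lemma prod_decode_Suc:
  "prod_decode (Suc n) = (if psnd n = 0 then (0, Suc (pfst n)) else (Suc (pfst n), psnd n - 1))"
proof -
  have "Suc n = prod_encode (if psnd n = 0 then (0, Suc (pfst n)) else (Suc (pfst n), psnd n - 1))"
  proof (cases "psnd n")
    case 0
    have "n = \<langle>pfst n, psnd n\<rangle>" by simp
    thus ?thesis using 0 by (simp add: prod_encode_def)
  next
    case (Suc k)
    have "n = \<langle>pfst n, psnd n\<rangle>" by simp
    thus ?thesis using Suc by (simp add: prod_encode_def)
  qed
  thus ?thesis by (metis prod_encode_inverse)
qed

lemma pfst_0 [simp]: "pfst 0 = 0" and psnd_0 [simp]: "psnd 0 = 0"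
  by (simp_all add: pfst_def psnd_def prod_decode_def prod_decode_aux.simps)

lemma pfst_Suc: "pfst (Suc n) = (if psnd n = 0 then 0 else Suc (pfst n))"
  and psnd_Suc: "psnd (Suc n) = (if psnd n = 0 then Suc (pfst n) else psnd n - 1)"
  unfolding pfst_def[of "Suc n"] psnd_def[of "Suc n"] prod_decode_Suc by simp_all

lemma exec_Decode:
  assumes "a \<noteq> b" "a \<noteq> c" "b \<noteq> c" "s b = 0" "s c = 0"
  shows "exec p (Decode a b c) (s, io) (s(a := pfst (s a), b := psnd (s a)), io)"
proof -
  let ?step = "Dec c ;; Cond b (Dec b ;; Inc a) (Move a b ;; Inc b)"
  have step: "exec p ?step (s, io) (s(c := s c - 1, a := pfst (Suc k), b := psnd (Suc k)), io)"
    if k: "s a = pfst k" "s b = psnd k" for s k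
  proof (cases "psnd k = 0")
    case True
    show ?thesis
      by (rule exec_eq[OF exec.Seq[OF exec.Dec exec.CondF[OF _ exec.Seq[OF exec_Move exec.Inc]]]])
        (use assms(1-3) k True in \<open>simp_all add: fun_eq_iff pfst_Suc psnd_Suc\<close>)
  next
    case False
    show ?thesis
      by (rule exec_eq[OF exec.Seq[OF exec.Dec exec.CondT[OF _ exec.Seq[OF exec.Dec exec.Inc]]]])
        (use assms(1-3) k False in \<open>simp_all add: fun_eq_iff pfst_Suc psnd_Suc\<close>)
  qed
  \<comment> \<open>Invariant: \<open>a\<close> and \<open>b\<close> hold the pair with code
    \<open>k\<close>, and \<open>c\<close> counts the codes still to be passed.\<close>
  have loop: "exec p (While c ?step) (s, io) (s(a := pfst (k + n), b := psnd (k + n), c := 0), io)"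
    if "s a = pfst k" "s b = psnd k" "s c = n" for s k n
    using that
  proof (induction n arbitrary: s k)
    case 0
    thus ?case by (auto intro!: exec_eq[OF exec.WhileF])
  next
    case (Suc n)
    let ?s = "s(c := s c - 1, a := pfst (Suc k), b := psnd (Suc k))"
    have "exec p (While c ?step) (?s, io) (?s(a := pfst (Suc k + n), b := psnd (Suc k + n), c := 0), io)"
      by (rule Suc.IH) (use Suc.prems assms in simp_all)
    moreover have eq: "?s(a := pfst (Suc k + n), b := psnd (Suc k + n), c := 0) =
        s(a := pfst (k + Suc n), b := psnd (k + Suc n), c := 0)"
      by (simp add: fun_eq_iff)
    ultimately show ?case
      unfolding eq using Suc.prems(3) by (intro exec.WhileT[OF _ step[OF Suc.prems(1,2)]]) simp
  qed
  show ?thesis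
    unfolding Decode_def
    by (rule exec_eq[OF exec.Seq[OF exec_Move loop[of _ 0]]]) (use assms in auto)
qed

lemma exec_Out: "exec p (Out a v) (s, k, os) (s(a := 0), k, os @ replicate (s a) v)"
proof (induction "s a" arbitrary: s os)
  case 0
  thus ?case unfolding Out_def by (auto intro!: exec_eq[OF exec.WhileF])
next
  case (Suc n)
  let ?s = "s(a := s a - 1)"
  have "exec p (Out a v) (?s, k, os @ [v]) (s(a := 0), k, os @ replicate (s a) v)"
    by (rule exec_eq[OF Suc(1)]) (use Suc(2) in \<open>auto simp flip: Suc(2)\<close>)
  moreover have "exec p (Dec a ;; Emit v) (s, k, os) (?s, k, os @ [v])"
    by (rule exec.Seq[OF exec.Dec exec.Emit])
  ultimately show ?case
    using Suc(2) unfolding Out_def by (auto intro: exec.WhileT)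
qed

text \<open>Register \<open>b\<close> is input and output; the registers above it are scratch space,
  zero before and after, and those below it are preserved. Hence nested evaluations can use the
  registers as a stack.\<close>

definition computes :: "nat \<Rightarrow> com \<Rightarrow> (nat \<Rightarrow> nat) \<Rightarrow> bool" where
  "computes b c f \<longleftrightarrow>
     (\<forall>p s io. (\<forall>i>b. s i = 0) \<longrightarrow> exec p c (s, io) (s(b := f (s b)), io))"

lemma computesI:
  "(\<And>p s io. \<forall>i>b. s i = 0 \<Longrightarrow> exec p c (s, io) (s(b := f (s b)), io)) \<Longrightarrow> computes b c f"
  by (auto simp: computes_def)

lemma computesD:
  "computes b c f \<Longrightarrow> \<forall>i>b. s i = 0 \<Longrightarrow> exec p c (s, io) (s(b := f (s b)), io)"
  unfolding computes_def by blast

text \<open>The base register is arbitrary in the induction because subprograms run above saved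
  values: for a pair, the second component is evaluated at \<open>b+2\<close> while the argument and
  the first value wait in \<open>b\<close> and \<open>b+1\<close>.\<close>

lemma pr_computes: "pr f \<Longrightarrow> \<exists>c. computes b c f"
proof (induction arbitrary: b rule: pr.induct)
  case zero
  show ?case by (rule exI[of _ "Clear b"]) (auto intro!: computesI exec_Clear)
next
  case suc
  show ?case by (rule exI[of _ "Inc b"]) (auto intro!: computesI exec.Inc)
next
  case ident
  show ?case
    by (rule exI[of _ "Inc b ;; Dec b"])
      (auto intro!: computesI exec_eq[OF exec.Seq[OF exec.Inc exec.Dec]])
next
  case pfst
  show ?case
    by (rule exI[of _ "Decode b (b+1) (b+2) ;; Clear (b+1)"])
      (auto intro!: computesI exec_eq[OF exec.Seq[OF exec_Decode exec_Clear]])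
next
  case psnd
  show ?case
    by (rule exI[of _ "Decode b (b+1) (b+2) ;; Clear b ;; Move (b+1) b"])
      (auto intro!: computesI exec_eq[OF exec.Seq[OF exec_Decode exec.Seq[OF exec_Clear exec_Move]]])
next
  case (pair f g)
  from pair.IH obtain c d where c: "computes (b+1) c f" and d: "computes (b+2) d g" by blast
  show ?case
  proof (intro exI computesI)
    fix p s io assume s: "\<forall>i>b. s i = (0::nat)"
    let ?s1 = "s(b+1 := s b)" let ?s2 = "s(b+1 := f (s b))"
    let ?s3 = "?s2(b+2 := s b)" let ?s4 = "?s2(b+2 := g (s b))"
    have "exec p (Copy b (b+1) (b+2)) (s, io) (?s1, io)"
      by (rule exec_eq[OF exec_Copy]) (use s in auto)
    moreover have "exec p c (?s1, io) (?s2, io)"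
      by (rule exec_eq[OF computesD[OF c]]) (use s in auto)
    moreover have "exec p (Copy b (b+2) (b+3)) (?s2, io) (?s3, io)"
      by (rule exec_eq[OF exec_Copy]) (use s in auto)
    moreover have "exec p d (?s3, io) (?s4, io)"
      by (rule exec_eq[OF computesD[OF d]]) (use s in auto)
    moreover have "exec p (Clear b ;; Move (b+1) b ;; Move (b+2) (b+1) ;; Enc b (b+1) (b+2)) 
      (?s4, io) (s(b := \<langle>f (s b), g (s b)\<rangle>), io)"
      by (rule exec_eq[OF exec.Seq[OF exec_Clear exec.Seq[OF exec_Move exec.Seq[OF exec_Move exec_Enc]]]])
        (use s in auto)
    ultimately show "exec p (Copy b (b+1) (b+2) ;; c ;; Copy b (b+2) (b+3) ;; d ;; 
      Clear b ;; Move (b+1) b ;; Move (b+2) (b+1) ;; Enc b (b+1) (b+2)) 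
      (s, io) (s(b := \<langle>f (s b), g (s b)\<rangle>), io)"
      by (meson exec.Seq)
  qed
next
  case (comp f g)
  from comp.IH obtain c d where c: "computes b c f" and d: "computes b d g" by blast
  show ?case
    by (rule exI[of _ "d ;; c"])
      (auto intro!: computesI exec_eq[OF exec.Seq[OF computesD[OF d] computesD[OF c]]])
next
  case (iter f)
  from iter.IH obtain c where c: "computes (b+1) c f" by blast
  have loop: "exec p (While b (Dec b ;; c)) (s, io) (s(b := 0, b+1 := (f ^^ s b) (s (b+1))), io)"
    if "\<forall>i>b+1. s i = 0" for p s io
    using that
  proof (induction "s b" arbitrary: s)
    case 0
    thus ?case by (auto intro!: exec_eq[OF exec.WhileF])
  next
    case (Suc n)
    let ?s = "s(b := s b - 1, b+1 := f (s (b+1)))"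
    have "exec p (While b (Dec b ;; c)) (?s, io) (s(b := 0, b+1 := (f ^^ s b) (s (b+1))), io)"
      by (rule exec_eq[OF Suc(1)]) (use Suc(2,3) in \<open>auto simp: funpow_swap1 simp flip: Suc(2)\<close>)
    moreover have "exec p (Dec b ;; c) (s, io) (?s, io)"
      by (rule exec_eq[OF exec.Seq[OF exec.Dec computesD[OF c]]]) (use Suc(2,3) in auto)
    ultimately show ?case
      using Suc(2) by (auto intro: exec.WhileT)
  qed
  show ?case
    by (rule exI[of _ "Decode b (b+1) (b+2) ;; While b (Dec b ;; c) ;; Move (b+1) b"])
      (auto intro!: computesI exec_eq[OF exec.Seq[OF exec_Decode exec.Seq[OF loop exec_Move]]])
qed

section \<open>Compilation to Type-2 machines\<close>

datatype instr =
    IInc nat | IDec nat | IJz nat nat | IJmp nat | IRead nat | IWord nat nat | IEmit bool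

primrec csize :: "com \<Rightarrow> nat" where
  "csize (Inc r) = 1"
| "csize (Dec r) = 1"
| "csize (c ;; d) = csize c + csize d"
| "csize (While r c) = csize c + 2"
| "csize (Cond r c d) = csize c + csize d + 2"
| "csize (Read r) = 1"
| "csize (Emit b) = 1"

text \<open>Jump targets are absolute, so the translation needs the address \<open>k\<close> at
  which the fragment begins.\<close>

primrec code :: "com \<Rightarrow> nat \<Rightarrow> instr list" where
  "code (Inc r) k = [IInc r]"
| "code (Dec r) k = [IDec r]"
| "code (c ;; d) k = code c k @ code d (k + csize c)"
| "code (While r c) k = IJz r (k + csize c + 2) # code c (Suc k) @ [IJmp k]"
| "code (Cond r c d) k = IJz r (k + csize c + 2) # code c (Suc k) @
     IJmp (k + csize c + csize d + 2) # code d (k + csize c + 2)"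
| "code (Read r) k = [IRead r]"
| "code (Emit b) k = [IEmit b]"

lemma length_code [simp]: "length (code c k) = csize c"
  by (induction c arbitrary: k) auto

primrec regs :: "com \<Rightarrow> nat set" where
  "regs (Inc r) = {r}"
| "regs (Dec r) = {r}"
| "regs (c ;; d) = regs c \<union> regs d"
| "regs (While r c) = insert r (regs c)"
| "regs (Cond r c d) = insert r (regs c \<union> regs d)"
| "regs (Read r) = {r}"
| "regs (Emit b) = {}"

lemma finite_regs [simp]: "finite (regs c)"
  by (induction c) auto

primrec code_at :: "instr list \<Rightarrow> nat \<Rightarrow> instr list \<Rightarrow> bool" where
  "code_at P k [] = True"
| "code_at P k (i # is) = (k < length P \<and> P ! k = i \<and> code_at P (Suc k) is)"

lemma code_at_append: "code_at P k (xs @ ys) \<longleftrightarrow> code_at P k xs \<and> code_at P (k + length xs) ys"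
  by (induction xs arbitrary: k) auto

lemma code_at_prefix: "code_at (xs @ ys @ zs) (length xs) ys"
proof (induction ys arbitrary: xs)
  case (Cons y ys)
  from Cons[of "xs @ [y]"] show ?case by simp
qed simp

text \<open>
  Counter \<open>i\<close> is the head position on work tape \<open>i\<close>, whose only non-blank cell is cell 0; this
  marker is written in state 0. State \<open>Suc k\<close> executes instruction \<open>k\<close>.
\<close>

definition counter_machine :: "nat \<Rightarrow> instr list \<Rightarrow> type2_machine" where
  "counter_machine R P = \<lparr>num_inputs = 2, num_works = R, num_states = Suc (length P),
     num_symbols = 2, start_state = 0,
     delta = (\<lambda>q us vs.
       let act = (\<lambda>k adv sh out. \<lparr>next_state = (if k < length P then Suc k else 0), advance = adv,
                    write_sym = (\<lambda>i. if q = 0 then 1 else vs ! i), shift = sh, emit = out\<rparr>);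
           up = (\<lambda>r i. if i = r then 1 else 0)
       in if q = 0 then act 0 (\<lambda>_. False) (\<lambda>_. 0) None
          else case P ! (q - 1) of
            IInc r \<Rightarrow> act q (\<lambda>_. False) (up r) None
          | IDec r \<Rightarrow> act q (\<lambda>_. False) (\<lambda>i. if i = r \<and> vs ! r = 0 then -1 else 0) None
          | IJz r k \<Rightarrow> act (if vs ! r = 0 then q else k) (\<lambda>_. False) (\<lambda>_. 0) None
          | IJmp k \<Rightarrow> act k (\<lambda>_. False) (\<lambda>_. 0) None
          | IRead r \<Rightarrow> act q (\<lambda>i. i = 0) (if us ! 0 = Some True then up r else (\<lambda>_. 0)) None
          | IWord r k \<Rightarrow> if us ! 1 = None then act k (\<lambda>_. False) (\<lambda>_. 0) None
                          else act (q - 1) (\<lambda>i. i = 1) (up r) None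
          | IEmit b \<Rightarrow> act q (\<lambda>_. False) (\<lambda>_. 0) (Some b))\<rparr>"

lemma counter_machine_simps [simp]:
  "num_inputs (counter_machine R P) = 2" "num_works (counter_machine R P) = R"
  "num_states (counter_machine R P) = Suc (length P)" "num_symbols (counter_machine R P) = 2"
  "start_state (counter_machine R P) = 0"
  by (simp_all add: counter_machine_def)

lemma type2_wf_counter_machine: "type2_wf (counter_machine R P)"
proof -
  have "next_state (delta (counter_machine R P) q us vs) < Suc (length P) \<and>
      (\<forall>i<R. write_sym (delta (counter_machine R P) q us vs) i < 2 \<and>
             shift (delta (counter_machine R P) q us vs) i \<in> {-1, 0, 1})"
    if vs: "\<forall>i<R. vs ! i < 2" for q us vs
  proof (cases "q = 0")
    case True
    thus ?thesis by (simp add: counter_machine_def Let_def)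
  next
    case False
    thus ?thesis using vs by (cases "P ! (q - 1)") (auto simp: counter_machine_def Let_def)
  qed
  moreover have "\<forall>i<R. vs ! i < 2" if "set vs \<subseteq> {..<2}" "length vs = R" for vs
    using that nth_mem by blast
  ultimately show ?thesis
    unfolding type2_wf_def counter_machine_simps by (metis zero_less_Suc zero_less_numeral)
qed

type_synonym istate = "nat \<times> (nat \<Rightarrow> nat) \<times> nat \<times> nat \<times> bool list"

text \<open>\<open>IWord\<close> repeats itself until the blank behind the advice word and thereby
  turns the word into its length.\<close>

fun istep :: "(nat \<Rightarrow> bool) \<Rightarrow> bool list \<Rightarrow> instr \<Rightarrow> istate \<Rightarrow> istate" where
  "istep p w (IInc r) (pc, s, k, l, os) = (Suc pc, s(r := Suc (s r)), k, l, os)"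
| "istep p w (IDec r) (pc, s, k, l, os) = (Suc pc, s(r := s r - 1), k, l, os)"
| "istep p w (IJz r t) (pc, s, k, l, os) = (if s r = 0 then t else Suc pc, s, k, l, os)"
| "istep p w (IJmp t) (pc, s, k, l, os) = (t, s, k, l, os)"
| "istep p w (IRead r) (pc, s, k, l, os) = (Suc pc, s(r := s r + of_bool (p k)), Suc k, l, os)"
| "istep p w (IWord r t) (pc, s, k, l, os) =
     (if l < length w then (pc, s(r := Suc (s r)), k, Suc l, os) else (t, s, k, l, os))"
| "istep p w (IEmit b) (pc, s, k, l, os) = (Suc pc, s, k, l, os @ [b])"

primrec iregs :: "instr \<Rightarrow> nat set" where
  "iregs (IInc r) = {r}"
| "iregs (IDec r) = {r}"
| "iregs (IJz r k) = {r}"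
| "iregs (IJmp k) = {}"
| "iregs (IRead r) = {r}"
| "iregs (IWord r k) = {r}"
| "iregs (IEmit b) = {}"

definition mark :: "int \<Rightarrow> nat" where
  "mark z = (if z = 0 then 1 else 0)"

lemma mark_simps [simp]: "mark 0 = 1" "0 < k \<Longrightarrow> mark (int k) = 0" 
    "mark(0 := Suc 0) = mark" "0 < k \<Longrightarrow> mark(int k := 0) = mark"
  by (auto simp: mark_def fun_eq_iff)

fun rep :: "nat \<Rightarrow> config \<Rightarrow> istate \<Rightarrow> bool" where
  "rep R c (pc, s, k, l, os) \<longleftrightarrow> state c = Suc pc \<and> in_head c 0 = k \<and> in_head c 1 = l \<and>
     (\<forall>i<R. tape c i = mark \<and> head c i = int (s i)) \<and> outp c = os"

text \<open>Scanning the marker is the test for zero, and \<open>mark\<close> survives every step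
  because the scanned symbol is written back. The next program counter has to lie inside the
  program, since the machine redirects all other targets to state 0.\<close>

lemma rep_step:
  assumes rep: "rep R c x" and pc: "fst x < length P" "fst (istep p w (P ! fst x) x) < length P"
    and regs: "iregs (P ! fst x) \<subseteq> {..<R}"
  shows "rep R (type2_step (counter_machine R P) [inf_tape p, word_tape w] c)
           (istep p w (P ! fst x) x)"
proof -
  obtain pc s k l os where x: "x = (pc, s, k, l, os)" by (cases x)
  have us: "map (\<lambda>i. ([inf_tape p, word_tape w] ! i) (in_head c i)) [0..<2] =
    [Some (p k), if l < length w then Some (w ! l) else None]"
    using rep by (simp add: x inf_tape_def word_tape_def upt_rec numeral_2_eq_2)
  have tp: "tape c i (head c i) = (if s i = 0 then 1 else 0)" if "i < R" for i
    using rep that by (cases "s i = 0") (simp_all add: x)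
  hence vs: "map (\<lambda>i. tape c i (head c i)) [0..<R] = map (\<lambda>i. if s i = 0 then 1 else 0) [0..<R]"
    by auto
  have [simp]: "state c = Suc pc" "in_head c 0 = k" "in_head c (Suc 0) = l" "outp c = os"
    "\<And>i. i < R \<Longrightarrow> head c i = int (s i)"
    using rep by (simp_all add: x)
  have rep': "\<And>i. i < R \<Longrightarrow> tape c i = mark"
    using rep by (simp add: x)
  note simps = x type2_step_def counter_machine_def Let_def us vs rep'
  show ?thesis
  proof (cases "P ! pc")
    case (IWord r t)
    show ?thesis
      by (cases "l < length w") (use pc regs in \<open>simp_all add: IWord simps del: upt_Suc\<close>)
  qed (use pc regs in \<open>auto simp: simps simp del: upt_Suc split: if_splits\<close>)
qed

declare rep.simps [simp del]

text \<open>Induction on the execution unrolls the loops. The strict bound puts an instruction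
  directly behind the fragment, so the final program counter still belongs to a state of the
  machine.\<close>

lemma steps_code:
  assumes "exec p c x y" "code_at P off (code c off)" "off + csize c < length P" "regs c \<subseteq> {..<R}"
    "rep R cfg (off, fst x, fst (snd x), l, snd (snd x))"
  shows "\<exists>j. rep R ((type2_step (counter_machine R P) [inf_tape p, word_tape w] ^^ j) cfg)
           (off + csize c, fst y, fst (snd y), l, snd (snd y))"
  using assms
proof (induction arbitrary: off cfg rule: exec.induct)
  case (Inc r s io)
  show ?case
    using rep_step[OF Inc(4), of P p w] Inc by (intro exI[of _ 1]) (auto simp: fun_upd_def)
next
  case (Dec r s io)
  show ?case
    using rep_step[OF Dec(4), of P p w] Dec by (intro exI[of _ 1]) (auto simp: fun_upd_def)
next
  case (Read r s k os)
  show ?case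
    using rep_step[OF Read(4), of P p w] Read by (intro exI[of _ 1]) (auto simp: fun_upd_def)
next
  case (Emit b s k os)
  show ?case
    using rep_step[OF Emit(4), of P p w] Emit by (intro exI[of _ 1]) auto
next
  case (Seq c x y d z)
  from Seq.IH(1)[of off cfg] Seq.prems obtain j where
    j: "rep R ((type2_step (counter_machine R P) [inf_tape p, word_tape w] ^^ j) cfg)
           (off + csize c, fst y, fst (snd y), l, snd (snd y))"
    by (auto simp: code_at_append)
  from Seq.IH(2)[OF _ _ _ j] Seq.prems show ?case
    by (auto simp: code_at_append add.assoc funpow_add[symmetric, THEN fun_cong, simplified])
next
  case (WhileF s r c io)
  show ?case
    using rep_step[OF WhileF(5), of P p w] WhileF(1-4) by (intro exI[of _ 1]) auto
next
  case (WhileT s r c io y z)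
  let ?st = "type2_step (counter_machine R P) [inf_tape p, word_tape w]"
  have "rep R (?st cfg) (Suc off, s, fst io, l, snd io)"
    using rep_step[OF WhileT.prems(4), of P p w] WhileT.prems(1-3) WhileT.hyps(1) by auto
  with WhileT.IH(1)[of "Suc off" "?st cfg"] WhileT.prems obtain j where
    j: "rep R ((?st ^^ j) (?st cfg)) (Suc off + csize c, fst y, fst (snd y), l, snd (snd y))"
    by (auto simp: code_at_append)
  have "rep R (?st ((?st ^^ j) (?st cfg))) (off, fst y, fst (snd y), l, snd (snd y))"
    using rep_step[OF j, of P p w] WhileT.prems(1-3) by (auto simp: code_at_append)
  from WhileT.IH(2)[OF WhileT.prems(1-3) this] obtain j' where
    "rep R ((?st ^^ j') (?st ((?st ^^ j) (?st cfg)))) 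
      (off + csize (While r c), fst z, fst (snd z), l, snd (snd z))" by blast
  hence "rep R ((?st ^^ (j' + (1 + (j + 1)))) cfg) 
      (off + csize (While r c), fst z, fst (snd z), l, snd (snd z))"
    unfolding funpow_add by simp
  thus ?case by blast
next
  case (CondT s r c io y d)
  let ?st = "type2_step (counter_machine R P) [inf_tape p, word_tape w]"
  have "rep R (?st cfg) (Suc off, s, fst io, l, snd io)"
    using rep_step[OF CondT.prems(4), of P p w] CondT.prems(1-3) CondT.hyps(1) by auto
  with CondT.IH[of "Suc off" "?st cfg"] CondT.prems obtain j where
    j: "rep R ((?st ^^ j) (?st cfg)) (Suc off + csize c, fst y, fst (snd y), l, snd (snd y))"
    by (auto simp: code_at_append)
  have "rep R (?st ((?st ^^ j) (?st cfg))) (off + csize (Cond r c d), fst y, fst (snd y), l, snd (snd y))"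
    using rep_step[OF j, of P p w] CondT.prems(1-3) by (auto simp: code_at_append add.assoc)
  hence "rep R ((?st ^^ (1 + (j + 1))) cfg) 
      (off + csize (Cond r c d), fst y, fst (snd y), l, snd (snd y))"
    unfolding funpow_add by simp
  thus ?case by blast
next
  case (CondF s r d io y c)
  let ?st = "type2_step (counter_machine R P) [inf_tape p, word_tape w]"
  have "rep R (?st cfg) (off + csize c + 2, s, fst io, l, snd io)"
    using rep_step[OF CondF.prems(4), of P p w] CondF.prems(1-3) CondF.hyps(1) by auto
  with CondF.IH[of "off + csize c + 2" "?st cfg"] CondF.prems obtain j where
    j: "rep R ((?st ^^ j) (?st cfg)) (off + csize c + 2 + csize d, fst y, fst (snd y), l, snd (snd y))"
    by (auto simp: code_at_append)
  hence "rep R ((?st ^^ (j + 1)) cfg) 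
      (off + csize (Cond r c d), fst y, fst (snd y), l, snd (snd y))"
    unfolding funpow_add by (simp add: add_ac)
  thus ?case by blast
qed

lemma type2_run_0 [simp]: "type2_run M xs 0 = type2_init M"
  by (simp add: type2_run_def)

lemma type2_run_add: "type2_run M xs (j + t) = (type2_step M xs ^^ j) (type2_run M xs t)"
  by (simp add: type2_run_def funpow_add)

lemma outp_type2_run_mono: "t \<le> t' \<Longrightarrow> \<exists>zs. outp (type2_run M xs t') = outp (type2_run M xs t) @ zs"
proof (induction t' rule: dec_induct)
  case (step t')
  then obtain zs where "outp (type2_run M xs t') = outp (type2_run M xs t) @ zs" by blast
  thus ?case
    using type2_run_add[of M xs 1 t'] by (auto simp: type2_step_def Let_def)
qed simp

section \<open>Machines that work in rounds\<close>

definition reg0 :: "nat \<Rightarrow> nat \<Rightarrow> nat" where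
  "reg0 x = (\<lambda>_. 0)(0 := x)"

lemma reg0_simps [simp]: "reg0 x 0 = x" "(reg0 x)(0 := y) = reg0 y" "0 < i \<Longrightarrow> reg0 x i = 0"
  by (simp_all add: reg0_def)

text \<open>
  The transition function maps \<open>\<langle>S, bit\<rangle>\<close> to \<open>\<langle>u, \<langle>v, S'\<rangle>\<rangle>\<close>, and the round emits \<open>u\<close> zeros
  followed by \<open>v\<close> ones.
\<close>

primrec round_state :: "(nat \<Rightarrow> nat) \<Rightarrow> nat \<Rightarrow> (nat \<Rightarrow> bool) \<Rightarrow> nat \<Rightarrow> nat" where
  "round_state F S0 p 0 = S0"
| "round_state F S0 p (Suc t) = psnd (psnd (F \<langle>round_state F S0 p t, of_bool (p t)\<rangle>))"

primrec round_out :: "(nat \<Rightarrow> nat) \<Rightarrow> nat \<Rightarrow> (nat \<Rightarrow> bool) \<Rightarrow> nat \<Rightarrow> bool list" where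
  "round_out F S0 p 0 = []"
| "round_out F S0 p (Suc t) = round_out F S0 p t @
     replicate (pfst (F \<langle>round_state F S0 p t, of_bool (p t)\<rangle>)) False @
     replicate (pfst (psnd (F \<langle>round_state F S0 p t, of_bool (p t)\<rangle>))) True"

text \<open>Each round is a terminating counter program, and the infinite computation comes from one
  jump behind it. The advice word enters only through its length.\<close>

theorem pr_transducer:
  assumes "pr F" "pr I"
  shows "\<exists>M. type2_wf M \<and> num_inputs M = 2 \<and>
     (\<forall>p w q. (\<forall>t. \<forall>i<length (round_out F (I (length w)) p t). round_out F (I (length w)) p t ! i = q i) \<and>
        (\<forall>l. \<exists>t. l \<le> length (round_out F (I (length w)) p t)) \<longrightarrow>
        type2_outputs M [inf_tape p, word_tape w] q)"
proof -
  obtain cF cI where cF: "computes 0 cF F" and cI: "computes 0 cI I"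
    using pr_computes assms by blast
  define body where "body = Read 1 ;; Enc 0 1 2 ;; cF ;; Decode 0 1 2 ;; Out 0 False ;; 
    Move 1 0 ;; Decode 0 1 2 ;; Out 0 True ;; Move 1 0"
  have body: "exec p body (reg0 S, t, os) 
      (reg0 (psnd (psnd (F \<langle>S, of_bool (p t)\<rangle>))), Suc t,
        os @ replicate (pfst (F \<langle>S, of_bool (p t)\<rangle>)) False @
        replicate (pfst (psnd (F \<langle>S, of_bool (p t)\<rangle>))) True)" for p S t os
    unfolding body_def
    by (rule exec_eq[OF exec.Seq[OF exec.Read exec.Seq[OF exec_Enc exec.Seq[OF computesD[OF cF] 
         exec.Seq[OF exec_Decode exec.Seq[OF exec_Out exec.Seq[OF exec_Move exec.Seq[OF exec_Decode 
         exec.Seq[OF exec_Out exec_Move]]]]]]]]])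
      (auto simp: reg0_def fun_eq_iff)
  define o1 where "o1 = Suc (csize cI)"
  define P where "P = [IWord 0 1] @ code cI 1 @ code body o1 @ [IJmp o1]"
  obtain R where R: "regs cI \<union> regs body \<union> {0} \<subseteq> {..<R}"
    using finite_nat_iff_bounded[of "regs cI \<union> regs body \<union> {0}"] by auto
  have o1: "0 < o1" by (simp add: o1_def)
  have len: "length P = o1 + csize body + 1"
    by (simp add: P_def o1_def)
  have at: "code_at P 0 [IWord 0 1]" "code_at P 1 (code cI 1)" "code_at P o1 (code body o1)" 
    "code_at P (o1 + csize body) [IJmp o1]"
    using code_at_prefix[of "[]" P "[]"] by (simp_all add: P_def code_at_append o1_def)
  define M where "M = counter_machine R P"
  show ?thesis
  proof (intro exI[of _ M] conjI allI impI)
    show "type2_wf M" "num_inputs M = 2"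
      by (simp_all add: M_def type2_wf_counter_machine)
    fix p :: "nat \<Rightarrow> bool" and w :: "bool list" and q
    let ?xs = "[inf_tape p, word_tape w]"
    let ?run = "type2_run M ?xs"
    let ?S = "round_state F (I (length w)) p" and ?out = "round_out F (I (length w)) p"
    have "rep R (?run 1) (0, reg0 0, 0, 0, [])"
      using len by (simp add: type2_run_def type2_init_def type2_step_def M_def counter_machine_def Let_def
          fun_eq_iff rep.simps reg0_def mark_def)
    hence word: "l \<le> length w \<Longrightarrow> rep R (?run (l + 1)) (0, reg0 l, 0, l, [])" for l
    proof (induction l)
      case (Suc l)
      hence "rep R (?run (l + 1)) (0, reg0 l, 0, l, [])" by simp
      from rep_step[OF this, of P p w] show ?case
        using Suc.prems R at len type2_run_add[of M ?xs 1 "l + 1"] by (auto simp: M_def[symmetric])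
    qed simp
    from rep_step[OF word[of "length w"], of P p w]
    have "rep R (?run (1 + (length w + 1))) (1, reg0 (length w), 0, length w, [])"
      unfolding type2_run_add[of M ?xs 1 "length w + 1"]
      using R at len o1 by (auto simp: M_def[symmetric])
    hence "rep R (?run (1 + (length w + 1))) 
        (1, fst (reg0 (length w), 0, []), fst (snd (reg0 (length w), 0, [])), 
        length w, snd (snd (reg0 (length w), 0, [])))"
      by simp
    from steps_code[OF computesD[OF cI] _ _ _ this, of P p w] at len R obtain j where
      "rep R ((type2_step M ?xs ^^ j) (?run (1 + (length w + 1)))) 
         (1 + csize cI, reg0 (I (length w)), 0, length w, [])"
      by (auto simp: M_def o1_def)
    hence T0: "rep R (?run (j + (1 + (length w + 1)))) 
         (o1, reg0 (I (length w)), 0, length w, [])"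
      unfolding type2_run_add o1_def by simp
    \<comment> \<open>Since \<open>T \<ge> t\<close>, every configuration of the run precedes the
      end of some round, and its output is a prefix of a round output.\<close>
    have "\<exists>T\<ge>t. rep R (?run T) (o1, reg0 (?S t), t, length w, ?out t)" for t
    proof (induction t)
      case 0
      show ?case using T0 by (intro exI[of _ "j + (1 + (length w + 1))"]) simp
    next
      case (Suc t)
      then obtain T where T: "t \<le> T" "rep R (?run T) (o1, reg0 (?S t), t, length w, ?out t)" by blast
      from steps_code[OF body[of p "?S t" t "?out t"], of P o1 R "?run T" "length w" w] T(2) at R len
      obtain j where j: "rep R ((type2_step M ?xs ^^ j) (?run T)) 
          (o1 + csize body, reg0 (?S (Suc t)), Suc t, length w, ?out (Suc t))"
        unfolding M_def by auto
      from rep_step[OF j, of P p w] at len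
      have "rep R (?run (1 + (j + T))) (o1, reg0 (?S (Suc t)), Suc t, length w, ?out (Suc t))"
        unfolding type2_run_add by (simp add: M_def)
      thus ?case using T(1) by (intro exI[of _ "1 + (j + T)"]) auto
    qed
    hence out: "\<exists>T\<ge>t. outp (?run T) = ?out t" for t by (auto simp: rep.simps)
    assume q: "(\<forall>t. \<forall>i<length (?out t). ?out t ! i = q i) \<and> (\<forall>l. \<exists>t. l \<le> length (?out t))"
    show "type2_outputs M ?xs q"
      unfolding type2_outputs_def
    proof (intro conjI allI impI)
      fix t i assume i: "i < length (outp (?run t))"
      obtain T where T: "t \<le> T" "outp (?run T) = ?out t" using out by blast
      from outp_type2_run_mono[OF T(1), of M ?xs] T(2) obtain zs where 
        "?out t = outp (?run t) @ zs" by auto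
      with q i show "outp (?run t) ! i = q i"
        by (metis length_append nth_append trans_less_add1)
    next
      fix l
      from q obtain t where "l \<le> length (?out t)" by blast
      with out[of t] show "\<exists>t. l \<le> length (outp (?run t))" by metis
    qed
  qed
qed

section \<open>Names and computable mappings\<close>

lemma block_code_at:
  assumes "c \<le> s z"
  shows "block_code s ((\<Sum>i<z. s i) + z + c) \<longleftrightarrow> c < s z"
proof (cases "c = s z")
  case True
  hence "(\<Sum>i<z. s i) + z + c = (\<Sum>i\<le>z. s i) + z"
    by (simp add: lessThan_Suc_atMost[symmetric])
  with True show ?thesis unfolding block_code_def by (metis less_irrefl)
next
  case False
  with assms have c: "c < s z" by simp
  have "(\<Sum>i<z. s i) + z + c \<noteq> (\<Sum>i\<le>k. s i) + k" for k
  proof (cases "k < z")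
    case True
    hence "(\<Sum>i\<le>k. s i) \<le> (\<Sum>i<z. s i)" by (intro sum_mono2) auto
    with True show ?thesis by simp
  next
    case False
    hence "(\<Sum>i\<le>z. s i) \<le> (\<Sum>i\<le>k. s i)" by (intro sum_mono2) auto
    moreover have "(\<Sum>i\<le>z. s i) = (\<Sum>i<z. s i) + s z"
      by (simp add: lessThan_Suc_atMost[symmetric])
    ultimately show ?thesis using c False by simp
  qed
  with c show ?thesis unfolding block_code_def by blast
qed

text \<open>Block \<open>k\<close> closes no earlier than position \<open>k\<close>, so later blocks
  cannot influence the bits up to \<open>t\<close>.\<close>

lemma block_code_cong:
  assumes "\<And>i. i \<le> t \<Longrightarrow> s i = s' i"
  shows "block_code s t = block_code s' t"
proof -
  have "t = (\<Sum>i\<le>k. s i) + k \<longleftrightarrow> t = (\<Sum>i\<le>k. s' i) + k" for k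
  proof (cases "k \<le> t")
    case True
    hence "(\<Sum>i\<le>k. s i) = (\<Sum>i\<le>k. s' i)"
      using assms by (intro sum.cong) auto
    thus ?thesis by simp
  qed auto
  thus ?thesis by (simp add: block_code_def)
qed

text \<open>Once the earlier blocks agree, block \<open>k\<close> starts at the same position in
  both strings, and its closing zero lies in the common prefix.\<close>

lemma block_code_determines:
  assumes "\<And>t. t < L \<Longrightarrow> block_code s t = block_code s' t" "(\<Sum>i\<le>k. s i) + k < L"
  shows "s' k = s k"
  using assms(2)
proof (induction k rule: less_induct)
  case (less k)
  have eq: "s' i = s i" if "i < k" for i
  proof (rule less.IH[OF that])
    have "(\<Sum>i\<le>i. s i) \<le> (\<Sum>i\<le>k. s i)" using that by (intro sum_mono2) auto
    thus "(\<Sum>i\<le>i. s i) + i < L" using less.prems that by simp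
  qed
  hence sums: "(\<Sum>i<k. s' i) = (\<Sum>i<k. s i)" by simp
  have Z: "(\<Sum>i\<le>k. s i) = (\<Sum>i<k. s i) + s k"
    by (simp add: lessThan_Suc_atMost[symmetric])
  \<comment> \<open>The shorter block closes at this offset; if the bits agree there, neither block
    is shorter.\<close>
  define c where "c = min (s k) (s' k)"
  have "block_code s ((\<Sum>i<k. s i) + k + c) = block_code s' ((\<Sum>i<k. s i) + k + c)"
    using less.prems Z by (intro assms(1)) (auto simp: c_def)
  hence "c < s k \<longleftrightarrow> c < s' k"
    using block_code_at[of c s k] block_code_at[of c s' k] sums by (simp add: c_def)
  thus ?case by (auto simp: c_def min_def split: if_splits)
qed

lemma ex_rat_code:
  fixes x e :: real
  assumes "0 < e"
  shows "\<exists>c. \<bar>x - real_of_rat (nat_to_rat_surj c)\<bar> \<le> e"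
proof -
  from of_rat_dense[of "x - e" x] assms obtain r where "x - e < real_of_rat r" "real_of_rat r < x"
    by auto
  moreover obtain c where "r = nat_to_rat_surj c"
    using surj_nat_to_rat_surj by (metis surjD)
  ultimately show ?thesis by (intro exI[of _ c]) auto
qed

definition interleave :: "nat \<Rightarrow> (nat \<Rightarrow> nat \<Rightarrow> bool) \<Rightarrow> nat \<Rightarrow> bool" where
  "interleave N r t = r (t mod N) (t div N)"

lemma interleave_component: "j < N \<Longrightarrow> interleave N r (N * t + j) = r j t"
  by (simp add: interleave_def)

lemma cauchy_vec_rep_interleave:
  assumes "v \<in> carrier_vec N"
    and "\<And>j k. j < N \<Longrightarrow> \<bar>v $ j - real_of_rat (nat_to_rat_surj (s j k))\<bar> \<le> (1/2) ^ k"
  shows "cauchy_vec_rep N (interleave N (\<lambda>j. block_code (s j))) v"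
  unfolding cauchy_vec_rep_def cauchy_rep_def
  using assms by (auto simp: interleave_component)

section \<open>Neighbourhoods of vectors and matrices\<close>

lemma openin_product_euclideanreal_ball:
  assumes "finite I" "openin (product_topology (\<lambda>_. euclideanreal) I) U" "x \<in> U"
  shows "\<exists>e>0. \<forall>z\<in>extensional I. (\<forall>i\<in>I. \<bar>z i - x i\<bar> < e) \<longrightarrow> z \<in> U"
proof -
  from assms(2,3) obtain X where X: "\<And>i. i \<in> I \<Longrightarrow> open (X i)" "x \<in> PiE I X" "PiE I X \<subseteq> U"
    unfolding openin_product_topology_alt by (metis open_openin)
  have "\<forall>i\<in>I. \<exists>e>0. \<forall>y. \<bar>y - x i\<bar> < e \<longrightarrow> y \<in> X i"
    using X(1,2) by (auto simp: open_dist dist_real_def PiE_iff)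
  then obtain e where e: "\<And>i. i \<in> I \<Longrightarrow> 0 < e i" "\<And>i y. i \<in> I \<Longrightarrow> \<bar>y - x i\<bar> < e i \<Longrightarrow> y \<in> X i"
    by metis
  \<comment> \<open>The 1 makes the minimum meaningful for empty \<open>I\<close>, as with vectors
    of dimension 0.\<close>
  define d where "d = Min (insert 1 (e ` I))"
  have "0 < d" "\<And>i. i \<in> I \<Longrightarrow> d \<le> e i"
    unfolding d_def using assms(1) e(1) by auto
  moreover have "z \<in> U" if "z \<in> extensional I" "\<forall>i\<in>I. \<bar>z i - x i\<bar> < d" for z
  proof -
    have "z \<in> PiE I X"
      unfolding PiE_iff
    proof (intro conjI ballI that(1))
      fix i assume i: "i \<in> I"
      show "z i \<in> X i"
        using that(2) i \<open>\<And>i. i \<in> I \<Longrightarrow> d \<le> e i\<close>[OF i] by (intro e(2)) auto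
    qed
    with X(3) show ?thesis by blast
  qed
  ultimately show ?thesis by blast
qed

lemma openin_vec_topology_ball:
  assumes "openin (vec_topology m) V" "y \<in> V"
  shows "\<exists>e>0. \<forall>z\<in>carrier_vec m. (\<forall>j<m. \<bar>z $ j - y $ j\<bar> < e) \<longrightarrow> z \<in> V"
proof -
  let ?g = "\<lambda>v::real vec. \<lambda>j\<in>{..<m}. v $ j"
  from assms obtain U where U: "openin (product_topology (\<lambda>_. euclideanreal) {..<m}) U"
    "V = ?g -` U \<inter> carrier_vec m"
    unfolding vec_topology_def openin_pullback_topology by blast
  obtain e where e: "e > 0"
      "\<And>z. z \<in> extensional {..<m} \<Longrightarrow> \<forall>i\<in>{..<m}. \<bar>z i - ?g y i\<bar> < e \<Longrightarrow> z \<in> U"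
    using openin_product_euclideanreal_ball[OF _ U(1), of "?g y"] U(2) assms(2) by auto
  show ?thesis
    using e(1) e(2)[of "?g z" for z] U(2) by (intro exI[of _ e]) auto
qed

lemma openin_mat_topology_ball:
  assumes "openin (mat_topology n m) V" "A \<in> V"
  shows "\<exists>e>0. \<forall>B\<in>carrier_mat n m. (\<forall>i<n. \<forall>j<m. \<bar>B $$ (i, j) - A $$ (i, j)\<bar> < e) \<longrightarrow> B \<in> V"
proof -
  let ?g = "\<lambda>A::real mat. \<lambda>ij\<in>{..<n}\<times>{..<m}. A $$ ij"
  from assms obtain U where U: "openin (product_topology (\<lambda>_. euclideanreal) ({..<n}\<times>{..<m})) U"
    "V = ?g -` U \<inter> carrier_mat n m"
    unfolding mat_topology_def openin_pullback_topology by blast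
  obtain e where e: "e > 0"
      "\<And>z. z \<in> extensional ({..<n}\<times>{..<m}) \<Longrightarrow> \<forall>i\<in>{..<n}\<times>{..<m}. \<bar>z i - ?g A i\<bar> < e \<Longrightarrow> z \<in> U"
    using openin_product_euclideanreal_ball[OF _ U(1), of "?g A"] U(2) assms(2) by auto
  show ?thesis
    using e(1) e(2)[of "?g B" for B] U(2) by (intro exI[of _ e]) auto
qed

lemma openin_mat_topology_ballI:
  assumes "A \<in> carrier_mat n m"
  shows "openin (mat_topology n m)
    {B \<in> carrier_mat n m. \<forall>i<n. \<forall>j<m. \<bar>B $$ (i, j) - A $$ (i, j)\<bar> < e}"
proof -
  let ?X = "\<lambda>ij. {x. \<bar>x - A $$ ij\<bar> < e}"
  have "open (?X ij)" for ij
    by (intro open_Collect_less continuous_intros)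
  hence "openin (product_topology (\<lambda>_. euclideanreal) ({..<n}\<times>{..<m})) (PiE ({..<n}\<times>{..<m}) ?X)"
    by (subst openin_PiE) auto
  thus ?thesis
    unfolding mat_topology_def openin_pullback_topology
    by (intro exI conjI) (assumption, simp add: set_eq_iff restrict_PiE_iff Pi_iff Ball_def, blast)
qed

lemma openin_vec_topology_component_neq_0:
  assumes "j < m"
  shows "openin (vec_topology m) {v \<in> carrier_vec m. v $ j \<noteq> 0}"
proof -
  have "openin (product_topology (\<lambda>_. euclideanreal) {..<m}) 
      (PiE {..<m} (\<lambda>i. if i = j then - {0} else UNIV))"
    by (subst openin_PiE) auto
  moreover have "{v \<in> carrier_vec m. v $ j \<noteq> (0::real)} = (\<lambda>v. \<lambda>i\<in>{..<m}. v $ i) -` 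
      (PiE {..<m} (\<lambda>i. if i = j then - {0} else UNIV)) \<inter> carrier_vec m"
  proof (intro Set.set_eqI)
    fix v :: "real vec"
    have "(\<lambda>i\<in>{..<m}. v $ i) \<in> PiE {..<m} (\<lambda>i. if i = j then - {0} else UNIV) \<longleftrightarrow>
        (\<forall>i\<in>{..<m}. v $ i \<in> (if i = j then - {0} else UNIV))"
      by (simp add: PiE_iff)
    also have "\<dots> \<longleftrightarrow> (\<forall>i<m. i = j \<longrightarrow> v $ i \<noteq> 0)"
      by auto
    finally have "(\<lambda>i\<in>{..<m}. v $ i) \<in> PiE {..<m} (\<lambda>i. if i = j then - {0} else UNIV) \<longleftrightarrow>
        (\<forall>i<m. i = j \<longrightarrow> v $ i \<noteq> 0)" .
    thus "v \<in> {v \<in> carrier_vec m. v $ j \<noteq> 0} \<longleftrightarrow> v \<in> (\<lambda>v. \<lambda>i\<in>{..<m}. v $ i) -`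
        (PiE {..<m} (\<lambda>i. if i = j then - {0} else UNIV)) \<inter> carrier_vec m"
      using assms by auto
  qed
  ultimately show ?thesis
    unfolding vec_topology_def openin_pullback_topology by blast
qed

section \<open>Continuity of computable mappings\<close>

lemma type2_run_Suc: "type2_run M xs (Suc t) = type2_step M xs (type2_run M xs t)"
  by (simp add: type2_run_def)

lemma in_head_type2_run_le: "in_head (type2_run M xs t) i \<le> t"
proof (induction t)
  case 0
  show ?case by (simp add: type2_run_def type2_init_def)
next
  case (Suc t)
  thus ?case unfolding type2_run_Suc by (simp add: type2_step_def Let_def)
qed

lemma type2_step_cong:
  assumes "map (\<lambda>i. (xs ! i) (in_head c i)) [0..<num_inputs M] =
           map (\<lambda>i. (ys ! i) (in_head c i)) [0..<num_inputs M]"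
  shows "type2_step M xs c = type2_step M ys c"
  unfolding type2_step_def Let_def assms ..

text \<open>A head advances by at most one cell per step, so \<open>t\<close> steps consult only the
  first \<open>t\<close> bits of the input.\<close>

lemma type2_run_cong:
  assumes "num_inputs M = 2" "\<And>i. i < t \<Longrightarrow> p i = p' i"
  shows "type2_run M [inf_tape p, x] t = type2_run M [inf_tape p', x] t"
  using assms(2)
proof (induction t)
  case 0
  show ?case by (simp add: type2_run_def)
next
  case (Suc t)
  let ?c = "type2_run M [inf_tape p, x] t"
  have eq: "?c = type2_run M [inf_tape p', x] t"
    using Suc by simp
  have "p (in_head ?c 0) = p' (in_head ?c 0)"
    using Suc.prems in_head_type2_run_le[of M "[inf_tape p, x]" t 0] by simp
  hence "map (\<lambda>i. ([inf_tape p, x] ! i) (in_head ?c i)) [0..<num_inputs M] =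
         map (\<lambda>i. ([inf_tape p', x] ! i) (in_head ?c i)) [0..<num_inputs M]"
    by (simp add: inf_tape_def upt_rec assms(1) numeral_2_eq_2)
  thus ?case
    unfolding type2_run_Suc eq[symmetric] by (rule type2_step_cong)
qed

text \<open>The witness of continuity at \<open>A\<close> is the value named by the output on one
  fixed name of \<open>A\<close>. A nearby matrix of the same class has the same advice and a name
  sharing a long prefix with that of \<open>A\<close>, so one of its values has a name with the same
  initial blocks.\<close>

theorem computable_with_partition_continuous:
  assumes comp: "computable_with_partition (cauchy_mat_rep n m) (cauchy_vec_rep l) f \<Delta>"
    and dom: "mv_dom f \<subseteq> carrier_mat n m"
    and D: "D \<in> \<Delta>"
  shows "mv_continuous (mat_topology n m) (vec_topology l) (mv_restrict f D)"
  unfolding mv_continuous_def mv_continuous_at_def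
proof
  fix A assume "A \<in> mv_dom (mv_restrict f D)"
  hence A: "A \<in> D" "A \<in> mv_dom f"
    by (auto simp: mv_dom_def mv_restrict_def split: if_splits)
  with dom have AC: "A \<in> carrier_mat n m" by blast
  obtain \<delta> M where M: "is_notation \<delta> \<Delta>" "type2_wf M" "num_inputs M = 2"
    "\<And>D w a p. \<delta> w = Some D \<Longrightarrow> a \<in> D \<Longrightarrow> cauchy_mat_rep n m p a \<Longrightarrow>
       \<exists>q b. type2_outputs M [inf_tape p, word_tape w] q \<and> cauchy_vec_rep l q b \<and> b \<in> f a"
    using comp unfolding computable_with_partition_def by blast
  obtain w where w: "\<delta> w = Some D"
    using M(1) D by (auto simp: is_notation_def ran_def)
  let ?N = "n * m"
  define e where "e j = (j div m, j mod m)" for j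
  have ij: "fst (e j) < n" "snd (e j) < m" if "j < ?N" for j
    using that by (auto simp: e_def less_mult_imp_div_less intro!: mod_less_divisor) (cases m; simp)
  \<comment> \<open>The name approximates twice as fast as required, so that all nearby matrices have names
     sharing a long prefix with it.\<close>
  have "\<forall>j k. \<exists>c. \<bar>A $$ e j - real_of_rat (nat_to_rat_surj c)\<bar> \<le> (1/2) ^ Suc k"
    by (intro allI ex_rat_code) simp
  then obtain s where s: "\<And>j k. \<bar>A $$ e j - real_of_rat (nat_to_rat_surj (s j k))\<bar> \<le> (1/2) ^ Suc k"
    by metis
  define p where "p = interleave ?N (\<lambda>j. block_code (s j))"
  have half: "(1/2::real) ^ Suc k \<le> (1/2) ^ k" for k by simp
  have "cauchy_mat_rep n m p A"
    unfolding cauchy_mat_rep_def p_def using AC s order_trans[OF s half]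
    by (auto intro!: cauchy_vec_rep_interleave simp: e_def)
  from M(4)[OF w A(1) this] obtain q b where q: "type2_outputs M [inf_tape p, word_tape w] q"
    and b: "cauchy_vec_rep l q b" "b \<in> f A" by blast
  show "\<exists>y\<in>mv_restrict f D A. \<forall>V. openin (vec_topology l) V \<and> y \<in> V \<longrightarrow>
     (\<exists>U. openin (mat_topology n m) U \<and> A \<in> U \<and>
       (\<forall>z\<in>U \<inter> mv_dom (mv_restrict f D). mv_restrict f D z \<inter> V \<noteq> {}))"
  proof (intro bexI[of _ b] allI impI)
    show "b \<in> mv_restrict f D A" using A b by (simp add: mv_restrict_def)
    fix V assume V: "openin (vec_topology l) V \<and> b \<in> V"
    then obtain \<epsilon> where \<epsilon>: "\<epsilon> > 0" "\<forall>z\<in>carrier_vec l. (\<forall>j<l. \<bar>z $ j - b $ j\<bar> < \<epsilon>) \<longrightarrow> z \<in> V"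
      using openin_vec_topology_ball[OF V[THEN conjunct1] V[THEN conjunct2]] by blast
    \<comment> \<open>Both values will lie within \<open>2^-k\<close> of the same rational, hence
      the half.\<close>
    obtain k where k: "(1/2::real) ^ k < \<epsilon> / 2"
      using real_arch_pow_inv[of "\<epsilon>/2" "1/2"] \<epsilon>(1) by auto
    obtain u where u: "\<And>j. j < l \<Longrightarrow> (\<lambda>t. q (l * t + j)) = block_code (u j)"
      "\<And>j i. j < l \<Longrightarrow> \<bar>b $ j - real_of_rat (nat_to_rat_surj (u j i))\<bar> \<le> (1/2) ^ i"
      using b(1) unfolding cauchy_vec_rep_def cauchy_rep_def by metis
    \<comment> \<open>Every component closes its block \<open>k\<close> before position
      \<open>Suc B\<close>; the 0 covers \<open>l = 0\<close>.\<close>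
    define B where "B = Max (insert 0 ((\<lambda>j. (\<Sum>i\<le>k. u j i) + k) ` {..<l}))"
    have B: "(\<Sum>i\<le>k. u j i) + k < Suc B" if "j < l" for j
      unfolding B_def using that by (auto intro!: le_imp_less_Suc Max_ge)
    obtain \<tau> where \<tau>: "l * Suc B \<le> length (outp (type2_run M [inf_tape p, word_tape w] \<tau>))"
      using q unfolding type2_outputs_def by blast
    define U where "U = {A' \<in> carrier_mat n m. \<forall>i<n. \<forall>j<m. \<bar>A' $$ (i, j) - A $$ (i, j)\<bar> < (1/2) ^ Suc \<tau>}"
    show "\<exists>U. openin (mat_topology n m) U \<and> A \<in> U \<and>
       (\<forall>z\<in>U \<inter> mv_dom (mv_restrict f D). mv_restrict f D z \<inter> V \<noteq> {})"
    proof (intro exI[of _ U] conjI ballI)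
      show "openin (mat_topology n m) U" unfolding U_def by (rule openin_mat_topology_ballI[OF AC])
      show "A \<in> U" using AC by (simp add: U_def)
      fix A' assume "A' \<in> U \<inter> mv_dom (mv_restrict f D)"
      hence A': "A' \<in> D" "A' \<in> U"
        by (auto simp: mv_dom_def mv_restrict_def split: if_splits)
      hence A'C: "A' \<in> carrier_mat n m" by (simp add: U_def)
      have "\<forall>j i. \<exists>c. \<bar>A' $$ e j - real_of_rat (nat_to_rat_surj c)\<bar> \<le> (1/2) ^ i"
        by (intro allI ex_rat_code) simp
      then obtain s'' where s'': "\<And>j i. \<bar>A' $$ e j - real_of_rat (nat_to_rat_surj (s'' j i))\<bar> \<le> (1/2) ^ i"
        by metis
      \<comment> \<open>The name of \<open>A'\<close> copies the blocks of \<open>A\<close> up to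
        \<open>\<tau>\<close>: their error \<open>2^-(i+1)\<close> and the distance of the matrices,
        below \<open>2^-(\<tau>+1)\<close>, add up to at most \<open>2^-i\<close>. The later blocks
        are free.\<close>
      define s' where "s' j i = (if i \<le> \<tau> then s j i else s'' j i)" for j i
      have s': "\<bar>A' $$ e j - real_of_rat (nat_to_rat_surj (s' j i))\<bar> \<le> (1/2) ^ i" if j: "j < ?N" for j i
      proof (cases "i \<le> \<tau>")
        case True
        have "\<bar>A' $$ e j - A $$ e j\<bar> < (1/2) ^ Suc \<tau>"
          using A'(2) ij[OF j] by (simp add: U_def e_def)
        also have "\<dots> \<le> (1/2) ^ Suc i" using True by (intro power_decreasing) auto
        finally have "\<bar>A' $$ e j - A $$ e j\<bar> < (1/2) ^ Suc i" .
        moreover have "\<bar>A' $$ e j - r\<bar> \<le> \<bar>A' $$ e j - A $$ e j\<bar> + \<bar>A $$ e j - r\<bar>" for r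
          by simp
        ultimately have "\<bar>A' $$ e j - real_of_rat (nat_to_rat_surj (s j i))\<bar> \<le> (1/2) ^ Suc i + (1/2) ^ Suc i"
          using s[of j i] by (meson add_mono less_imp_le order_trans)
        thus ?thesis using True by (simp add: s'_def)
      qed (simp add: s'_def s'')
      define p' where "p' = interleave ?N (\<lambda>j. block_code (s' j))"
      have "cauchy_mat_rep n m p' A'"
        unfolding cauchy_mat_rep_def p'_def using A'C s'
        by (auto intro!: cauchy_vec_rep_interleave simp: e_def)
      from M(4)[OF w A'(1) this] obtain q' b' where 
        q': "type2_outputs M [inf_tape p', word_tape w] q'"
        and b': "cauchy_vec_rep l q' b'" "b' \<in> f A'" by blast
      have "p' i = p i" if "i < \<tau>" for i
      proof -
        have "i div ?N \<le> \<tau>" using that div_le_dividend[of i ?N] by linarith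
        thus ?thesis unfolding p'_def p_def interleave_def
          by (intro block_code_cong) (auto simp: s'_def)
      qed
      hence run: "type2_run M [inf_tape p', word_tape w] \<tau> = type2_run M [inf_tape p, word_tape w] \<tau>"
        by (intro type2_run_cong M)
      have qq': "q' i = q i" if "i < l * Suc B" for i
      proof -
        have "i < length (outp (type2_run M [inf_tape p, word_tape w] \<tau>))" using \<tau> that by simp
        thus ?thesis using q q' run unfolding type2_outputs_def by metis
      qed
      obtain u' where u': "\<And>j. j < l \<Longrightarrow> (\<lambda>t. q' (l * t + j)) = block_code (u' j)"
        "\<And>j i. j < l \<Longrightarrow> \<bar>b' $ j - real_of_rat (nat_to_rat_surj (u' j i))\<bar> \<le> (1/2) ^ i"
        using b'(1) unfolding cauchy_vec_rep_def cauchy_rep_def by metis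
      have uu': "u' j k = u j k" if j: "j < l" for j
      proof (rule block_code_determines[OF _ B[OF j]])
        fix t assume "t < Suc B"
        hence "l * t + j < l * Suc B"
          using j mult_le_mono2[of "Suc t" "Suc B" l] by (simp only: mult_Suc_right) linarith
        thus "block_code (u j) t = block_code (u' j) t"
          using qq' u(1)[OF j] u'(1)[OF j] by metis
      qed
      have "\<bar>b' $ j - b $ j\<bar> < \<epsilon>" if "j < l" for j
        using u(2)[OF that, of k] u'(2)[OF that, of k] uu'[OF that] k by simp
      moreover have "b' \<in> carrier_vec l" using b'(1) by (simp add: cauchy_vec_rep_def)
      ultimately have "b' \<in> V" using \<epsilon>(2) by blast
      with b'(2) A'(1) show "mv_restrict f D A' \<inter> V \<noteq> {}" by (auto simp: mv_restrict_def)
    qed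
  qed
qed

corollary card_discontinuity_le_card_advice:
  assumes "mv_dom f \<subseteq> carrier_mat n m"
  shows "card_discontinuity (mat_topology n m) (vec_topology l) f \<le>
         card_advice (cauchy_mat_rep n m) (cauchy_vec_rep l) f"
  unfolding card_discontinuity_def card_advice_def
proof (rule Inf_superset_mono, clarify)
  fix \<Delta> assume *: "computable_with_partition (cauchy_mat_rep n m) (cauchy_vec_rep l) f \<Delta>"
  hence "partition_on (mv_dom f) \<Delta>"
    unfolding computable_with_partition_def by blast
  thus "\<exists>\<Delta>'. ecard \<Delta> = ecard \<Delta>' \<and> partition_on (mv_dom f) \<Delta>' \<and>
      (\<forall>D\<in>\<Delta>'. mv_continuous (mat_topology n m) (vec_topology l) (mv_restrict f D))"
    using computable_with_partition_continuous[OF * assms] by blast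
qed

section \<open>Linear algebra\<close>

text \<open>Several columns may be equal as vectors, so a maximal independent set of column vectors
  is turned into a set \<open>J\<close> of indices. \<open>R\<close> holds the coordinates of all
  columns: \<open>A\<close> is the product of its \<open>J\<close>-columns with
  \<open>R\<close>.\<close>

lemma rank_column_basis:
  fixes A :: "real mat"
  assumes A: "A \<in> carrier_mat n m"
  obtains J R where "J \<subseteq> {..<m}" "card J = vec_space.rank n A"
    "\<And>v. \<forall>i<n. (\<Sum>j\<in>J. A $$ (i, j) * v j) = 0 \<Longrightarrow> \<forall>j\<in>J. v j = 0"
    "\<And>i j. i < n \<Longrightarrow> j < m \<Longrightarrow> A $$ (i, j) = (\<Sum>k\<in>J. A $$ (i, k) * R k j)"
proof -
  interpret vec_space "TYPE(real)" n .
  have cols: "set (cols A) \<subseteq> carrier_vec n" using cols_dim A by blast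
  have "\<exists>S. finite S \<and> maximal S (\<lambda>T. T \<subseteq> set (cols A) \<and> lin_indpt T) \<and> {} \<subseteq> S"
    by (rule maximal_exists_superset[of "set (cols A)"])
      (auto simp: fin_dim finite_basis_exists lin_dep_def)
  then obtain S where S: "finite S" "maximal S (\<lambda>T. T \<subseteq> set (cols A) \<and> lin_indpt T)" by blast
  hence Sc: "S \<subseteq> set (cols A)" "lin_indpt S" unfolding maximal_def by blast+
  with cols have SC: "S \<subseteq> carrier_vec n" by blast
  have rank: "rank A = card S" by (rule rank_card_indpt[OF A S(2)])
  have "\<forall>s\<in>S. \<exists>j<m. s = col A j"
    using Sc(1) A by (fastforce simp: cols_def)
  then obtain idx where idx: "\<And>s. s \<in> S \<Longrightarrow> idx s < m" "\<And>s. s \<in> S \<Longrightarrow> s = col A (idx s)" by metis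
  have inj: "inj_on idx S" using idx(2) by (metis inj_onI)
  have sum_idx: "(\<Sum>j\<in>idx ` S. A $$ (i, j) * v j) = lincomb (\<lambda>s. v (idx s)) S $ i" if "i < n" for i v
  proof -
    have "(\<Sum>j\<in>idx ` S. A $$ (i, j) * v j) = (\<Sum>s\<in>S. A $$ (i, idx s) * v (idx s))"
      using sum.reindex[OF inj] by simp
    also have "\<dots> = (\<Sum>s\<in>S. v (idx s) * s $ i)"
    proof (rule sum.cong[OF refl])
      fix s assume s: "s \<in> S"
      have "s $ i = col A (idx s) $ i" using idx(2)[OF s] by simp
      also have "\<dots> = A $$ (i, idx s)" using idx(1)[OF s] A that by simp
      finally show "A $$ (i, idx s) * v (idx s) = v (idx s) * s $ i" by simp
    qed
    also have "\<dots> = lincomb (\<lambda>s. v (idx s)) S $ i"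
      using lincomb_index[OF that SC] by simp
    finally show ?thesis .
  qed
  have indep: "\<forall>j\<in>idx ` S. v j = 0" if "\<forall>i<n. (\<Sum>j\<in>idx ` S. A $$ (i, j) * v j) = 0" for v
  proof (rule ccontr)
    assume "\<not> (\<forall>j\<in>idx ` S. v j = 0)"
    then obtain s where s: "s \<in> S" "v (idx s) \<noteq> 0" by blast
    have "lincomb (\<lambda>s. v (idx s)) S = 0\<^sub>v n"
      using that sum_idx lincomb_dim[OF S(1) SC] by (intro eq_vecI) auto
    hence "lin_dep S"
      unfolding lin_dep_def using S(1) s
      by (intro exI[of _ S] exI[of _ "\<lambda>s. v (idx s)"] exI[of _ s]) auto
    with Sc(2) show False by blast
  qed
  have "\<exists>r. \<forall>i<n. A $$ (i, j) = (\<Sum>k\<in>idx ` S. A $$ (i, k) * r k)" if j: "j < m" for j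
  proof -
    have cj: "col A j \<in> set (cols A)" using A j by (auto simp: cols_def)
    have "col A j \<in> span S"
    proof (cases "col A j \<in> S")
      case True
      thus ?thesis using in_own_span[OF SC] by blast
    next
      case False
      have "lin_dep (insert (col A j) S)"
      proof (rule ccontr)
        assume indpt: "lin_indpt (insert (col A j) S)"
        have "insert (col A j) S \<subseteq> set (cols A)" using cj Sc(1) by simp
        with indpt S(2) have "insert (col A j) S = S" 
          unfolding maximal_def by (elim conjE allE[of _ "insert (col A j) S"]) auto
        with False show False by blast
      qed
      thus ?thesis
        using lin_dep_iff_in_span[OF SC Sc(2) _ False] cj cols by auto
    qed
    from finite_in_span[OF S(1) _ this] SC obtain a where a: "lincomb a S = col A j"
      by auto
    define r where "r k = a (the_inv_into S idx k)" for k
    have "A $$ (i, j) = (\<Sum>k\<in>idx ` S. A $$ (i, k) * r k)" if i: "i < n" for i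
    proof -
      have "A $$ (i, j) = lincomb a S $ i"
        using a A i j by (metis carrier_matD index_col)
      also have "\<dots> = lincomb (\<lambda>s. r (idx s)) S $ i"
        unfolding lincomb_index[OF i SC]
        by (intro sum.cong) (auto simp: r_def the_inv_into_f_f[OF inj])
      finally show ?thesis using sum_idx[OF i] by simp
    qed
    thus ?thesis by blast
  qed
  then obtain R where R: "\<And>j i. j < m \<Longrightarrow> i < n \<Longrightarrow> A $$ (i, j) = (\<Sum>k\<in>idx ` S. A $$ (i, k) * R j k)" by metis
  show thesis
    by (rule that[of "idx ` S" "\<lambda>k j. R j k"])
      (use idx(1) rank card_image[OF inj] indep R in auto)
qed

text \<open>The equations are padded to a square system with a zero row, whose determinant
  vanishes.\<close>

lemma underdetermined_nontrivial_solution: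
  fixes g :: "'k \<Rightarrow> nat \<Rightarrow> real"
  assumes "finite K" "card K < m"
  obtains v where "\<exists>j<m. v j \<noteq> 0" "\<And>k. k \<in> K \<Longrightarrow> (\<Sum>j<m. g k j * v j) = 0"
proof -
  obtain h where h: "bij_betw h {0..<card K} K" using ex_bij_betw_nat_finite[OF assms(1)] by blast
  define c where "c i = vec m (\<lambda>j. if i < card K then g (h i) j else 0)" for i
  define G where "G = mat\<^sub>r m m (\<lambda>i. if i = card K then 0\<^sub>v m else c i)"
  have G: "G \<in> carrier_mat m m" by (simp add: G_def)
  have "det G = 0"
    unfolding G_def by (rule det_row_0[OF assms(2)]) (auto simp: c_def)
  then obtain v where v: "v \<in> carrier_vec m" "v \<noteq> 0\<^sub>v m" "G *\<^sub>v v = 0\<^sub>v m"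
    using det_0_iff_vec_prod_zero_field[OF G] by blast
  have "(\<Sum>j<m. g k j * v $ j) = 0" if "k \<in> K" for k
  proof -
    have "k \<in> h ` {0..<card K}" using bij_betw_imp_surj_on[OF h] that by simp
    then obtain i where i: "i < card K" "k = h i" by auto
    have "(G *\<^sub>v v) $ i = (\<Sum>j<m. g k j * v $ j)"
      using i assms(2) v(1) by (simp add: G_def c_def scalar_prod_def atLeast0LessThan)
    with v(3) i assms(2) show ?thesis by simp
  qed
  moreover have "\<exists>j<m. v $ j \<noteq> 0"
    using v(1,2) by (metis carrier_vecD eq_vecI index_zero_vec(1,2))
  ultimately show thesis by (rule that[of "\<lambda>j. v $ j", rotated])
qed

text \<open>Factoring \<open>A\<close> through a column basis replaces its \<open>n\<close>
  equations by the \<open>rank\<close> many equations \<open>R v = 0\<close>; together with those of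
  \<open>K\<close> they are fewer than the unknowns.\<close>

lemma kernel_meets_hyperplanes:
  fixes A :: "real mat" and g :: "'k \<Rightarrow> nat \<Rightarrow> real"
  assumes A: "A \<in> carrier_mat n m" and K: "finite K" "vec_space.rank n A + card K < m"
  obtains v where "\<exists>j<m. v j \<noteq> 0" "\<And>i. i < n \<Longrightarrow> (\<Sum>j<m. A $$ (i, j) * v j) = 0"
    "\<And>k. k \<in> K \<Longrightarrow> (\<Sum>j<m. g k j * v j) = 0"
proof -
  obtain J R where J: "J \<subseteq> {..<m}" "card J = vec_space.rank n A"
    "\<And>i j. i < n \<Longrightarrow> j < m \<Longrightarrow> A $$ (i, j) = (\<Sum>k\<in>J. A $$ (i, k) * R k j)"
    using rank_column_basis[OF A] by metis
  have fin: "finite J" using J(1) finite_subset by blast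
  have "card (J <+> K) < m" using K J(2) fin by (simp add: card_Plus)
  moreover have "finite (J <+> K)" using fin K by simp
  ultimately obtain v where v: "\<exists>j<m. v j \<noteq> 0"
    "\<And>k. k \<in> J <+> K \<Longrightarrow> (\<Sum>j<m. case_sum R g k j * v j) = 0"
    using underdetermined_nontrivial_solution[of "J <+> K" m "case_sum R g"] by metis
  have "(\<Sum>j<m. A $$ (i, j) * v j) = 0" if i: "i < n" for i
  proof -
    have "(\<Sum>j<m. A $$ (i, j) * v j) = (\<Sum>j<m. \<Sum>k\<in>J. A $$ (i, k) * (R k j * v j))"
      using J(3)[OF i] by (intro sum.cong) (simp_all add: sum_distrib_right mult.assoc)
    also have "\<dots> = (\<Sum>k\<in>J. \<Sum>j<m. A $$ (i, k) * (R k j * v j))" by (rule sum.swap)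
    also have "\<dots> = (\<Sum>k\<in>J. A $$ (i, k) * (\<Sum>j<m. R k j * v j))"
      by (simp add: sum_distrib_left)
    also have "\<dots> = 0" using v(2)[of "Inl k" for k] by (intro sum.neutral) auto
    finally show ?thesis .
  qed
  moreover have "(\<Sum>j<m. g k j * v j) = 0" if "k \<in> K" for k
    using v(2)[of "Inr k"] that by auto
  ultimately show thesis using that v(1) by blast
qed

lemma mat_kernel_iff_sums:
  fixes A :: "real mat"
  assumes "A \<in> carrier_mat n m"
  shows "v \<in> mat_kernel A \<longleftrightarrow> v \<in> carrier_vec m \<and> (\<forall>i<n. (\<Sum>j<m. A $$ (i, j) * v $ j) = 0)"
proof -
  have "(A *\<^sub>v v) $ i = (\<Sum>j<m. A $$ (i, j) * v $ j)" if "v \<in> carrier_vec m" "i < n" for i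
    using assms that by (simp add: scalar_prod_def atLeast0LessThan)
  moreover have "A *\<^sub>v v = 0\<^sub>v n \<longleftrightarrow> (\<forall>i<n. (A *\<^sub>v v) $ i = 0)"
    using assms by (auto simp: vec_eq_iff)
  ultimately show ?thesis
    unfolding mat_kernel[OF assms] by auto
qed

lemma LinEq_nonempty:
  assumes "A \<in> lineq_dom n m"
  shows "LinEq n m A \<noteq> {}"
proof -
  have A: "A \<in> carrier_mat n m" "vec_space.rank n A + card ({} :: nat set) < m"
    using assms by (auto simp: lineq_dom_def lineq_bound_def)
  obtain v where v: "\<exists>j<m. v j \<noteq> 0" "\<And>i. i < n \<Longrightarrow> (\<Sum>j<m. A $$ (i, j) * v j) = 0"
    using kernel_meets_hyperplanes[OF A(1) finite.emptyI A(2)] by metis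
  have "vec m v \<in> mat_kernel A"
    unfolding mat_kernel_iff_sums[OF A(1)] using v(2) by simp
  moreover have "vec m v \<noteq> 0\<^sub>v m"
    using v(1) by (metis index_vec index_zero_vec(1))
  ultimately show ?thesis using assms by (auto simp: LinEq_def)
qed

lemma mv_dom_LinEq: "mv_dom (LinEq n m) = lineq_dom n m"
  using LinEq_nonempty by (auto simp: mv_dom_def LinEq_def)

text \<open>The left inverse is that of least squares, \<open>(M^T M)^-1 M^T\<close>; the Gram
  matrix is nonsingular because \<open>v^T M^T M v\<close> is the squared length of
  \<open>M v\<close>.\<close>

lemma left_inverse_exists:
  fixes M :: "nat \<Rightarrow> nat \<Rightarrow> real"
  assumes inj: "\<And>v. \<forall>l<N. (\<Sum>j<m. M l j * v j) = 0 \<Longrightarrow> \<forall>j<m. v j = 0"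
  obtains B where "\<And>i j. i < m \<Longrightarrow> j < m \<Longrightarrow> (\<Sum>l<N. B i l * M l j) = of_bool (i = j)"
proof -
  define G where "G = mat m m (\<lambda>(i, j). \<Sum>l<N. M l i * M l j)"
  have G: "G \<in> carrier_mat m m" by (simp add: G_def)
  have "det G \<noteq> 0"
  proof
    assume "det G = 0"
    then obtain v where v: "v \<in> carrier_vec m" "v \<noteq> 0\<^sub>v m" "G *\<^sub>v v = 0\<^sub>v m"
      using det_0_iff_vec_prod_zero_field[OF G] by blast
    have Gv: "(\<Sum>j<m. (\<Sum>l<N. M l i * M l j) * v $ j) = 0" if "i < m" for i
    proof -
      have "(G *\<^sub>v v) $ i = (\<Sum>j<m. (\<Sum>l<N. M l i * M l j) * v $ j)"
        using that v(1) by (simp add: G_def scalar_prod_def atLeast0LessThan)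
      with v(3) that show ?thesis by simp
    qed
    have "(\<Sum>l<N. (\<Sum>j<m. M l j * v $ j)\<^sup>2) = (\<Sum>l<N. \<Sum>i<m. \<Sum>j<m. v $ i * (M l i * M l j * v $ j))"
      by (simp add: power2_eq_square sum_product mult_ac)
    also have "\<dots> = (\<Sum>i<m. \<Sum>l<N. \<Sum>j<m. v $ i * (M l i * M l j * v $ j))"
      by (rule sum.swap)
    also have "\<dots> = (\<Sum>i<m. \<Sum>j<m. \<Sum>l<N. v $ i * (M l i * M l j * v $ j))"
      by (intro sum.cong refl sum.swap)
    also have "\<dots> = (\<Sum>i<m. v $ i * (\<Sum>j<m. (\<Sum>l<N. M l i * M l j) * v $ j))"
      by (simp add: sum_distrib_left sum_distrib_right)
    also have "\<dots> = 0" using Gv by simp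
    finally have "\<forall>l<N. (\<Sum>j<m. M l j * v $ j) = 0"
      by (subst (asm) sum_nonneg_eq_0_iff) auto
    hence "\<forall>j<m. v $ j = 0" by (rule inj)
    with v(1,2) show False by (metis carrier_vecD eq_vecI index_zero_vec(1,2))
  qed
  from det_non_zero_imp_unit[OF G this, of "()"] obtain P where
    P: "P \<in> carrier_mat m m" "P * G = 1\<^sub>m m"
    unfolding Units_def ring_mat_def by auto
  define B where "B i l = (\<Sum>k<m. P $$ (i, k) * M l k)" for i l
  have "(\<Sum>l<N. B i l * M l j) = of_bool (i = j)" if ij: "i < m" "j < m" for i j
  proof -
    have "(\<Sum>l<N. B i l * M l j) = (\<Sum>l<N. \<Sum>k<m. P $$ (i, k) * (M l k * M l j))"
      by (simp add: B_def sum_distrib_right mult.assoc)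
    also have "\<dots> = (\<Sum>k<m. \<Sum>l<N. P $$ (i, k) * (M l k * M l j))" by (rule sum.swap)
    also have "\<dots> = (P * G) $$ (i, j)"
      using ij P(1) by (simp add: G_def scalar_prod_def atLeast0LessThan sum_distrib_left)
    finally show ?thesis using P(2) ij by simp
  qed
  thus thesis by (rule that)
qed

text \<open>
  The zero rows at the end make the number of rows independent of \<open>k\<close>, hence of the advice.
\<close>

definition bordered :: "nat \<Rightarrow> nat \<Rightarrow> (nat \<Rightarrow> nat \<Rightarrow> real) \<Rightarrow> (nat \<Rightarrow> nat) \<Rightarrow> nat \<Rightarrow> nat \<Rightarrow> real" where
  "bordered n k a \<pi> l j = (if l < n then a l j else of_bool (l - n < k \<and> \<pi> (l - n) = j))"

text \<open>The selected coordinates form the complement of a column basis \<open>J\<close>: when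
  they vanish, \<open>A v = 0\<close> is a relation between independent columns.\<close>

lemma bordered_left_inverse_exists:
  fixes A :: "real mat"
  assumes A: "A \<in> carrier_mat n m"
  obtains \<pi> B where "\<And>i j. i < m \<Longrightarrow> j < m \<Longrightarrow> 
    (\<Sum>l<n + m. B i l * bordered n (m - vec_space.rank n A) (\<lambda>i j. A $$ (i, j)) \<pi> l j) = of_bool (i = j)"
proof -
  define r where "r = vec_space.rank n A"
  obtain J R where J: "J \<subseteq> {..<m}" "card J = r"
    "\<And>v. \<forall>i<n. (\<Sum>j\<in>J. A $$ (i, j) * v j) = 0 \<Longrightarrow> \<forall>j\<in>J. v j = 0"
    unfolding r_def using rank_column_basis[OF A] by metis
  have "card ({..<m} - J) = m - r"
    using J(1,2) by (simp add: card_Diff_subset finite_subset)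
  moreover have "finite ({..<m} - J)" by simp
  ultimately obtain \<pi> where \<pi>: "bij_betw \<pi> {0..<m - r} ({..<m} - J)"
    using ex_bij_betw_nat_finite by metis
  let ?M = "bordered n (m - r) (\<lambda>i j. A $$ (i, j)) \<pi>"
  have "\<forall>j<m. v j = 0" if v: "\<forall>l<n + m. (\<Sum>j<m. ?M l j * v j) = 0" for v
  proof -
    have out: "v j = 0" if j: "j < m" "j \<notin> J" for j
    proof -
      have "j \<in> \<pi> ` {0..<m - r}" using bij_betw_imp_surj_on[OF \<pi>] j by simp
      then obtain k where k: "k < m - r" "\<pi> k = j" by auto
      have "0 = (\<Sum>i<m. ?M (n + k) i * v i)" using v k(1) by simp
      also have "\<dots> = (\<Sum>i<m. if i = j then v i else 0)"
      proof (intro sum.cong refl)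
        fix i assume "i \<in> {..<m}"
        show "?M (n + k) i * v i = (if i = j then v i else 0)"
          using k by (cases "i = j") (simp_all add: bordered_def)
      qed
      also have "\<dots> = v j" using j by simp
      finally show ?thesis by simp
    qed
    have "(\<Sum>j\<in>J. A $$ (i, j) * v j) = 0" if i: "i < n" for i
    proof -
      have "(\<Sum>j\<in>J. A $$ (i, j) * v j) = (\<Sum>j<m. A $$ (i, j) * v j)"
        using J(1) out by (intro sum.mono_neutral_left) auto
      also have "\<dots> = 0" using v[rule_format, of i] i by (simp add: bordered_def)
      finally show ?thesis .
    qed
    hence "\<forall>j\<in>J. v j = 0" by (intro J(3)) simp
    with out show ?thesis by blast
  qed
  note inj = this
  show thesis
  proof (rule left_inverse_exists)
    show "\<And>v. \<forall>l<n + m. (\<Sum>j<m. ?M l j * v j) = 0 \<Longrightarrow> \<forall>j<m. v j = 0" by (rule inj)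
  next
    fix B assume "\<And>i j. i < m \<Longrightarrow> j < m \<Longrightarrow> (\<Sum>l<n + m. B i l * ?M l j) = of_bool (i = j)" 
    thus thesis unfolding r_def by (rule that)
  qed
qed

section \<open>The lower bound\<close>

lemma card_discontinuity_LinEq_ge:
  "enat (nat (lineq_bound n m + 1)) \<le> card_discontinuity (mat_topology n m) (vec_topology m) (LinEq n m)"
  unfolding card_discontinuity_def
proof (rule Inf_greatest, clarify)
  fix \<Delta> assume part: "partition_on (mv_dom (LinEq n m)) \<Delta>"
    and cont: "\<forall>D\<in>\<Delta>. mv_continuous (mat_topology n m) (vec_topology m) (mv_restrict (LinEq n m) D)"
  show "enat (nat (lineq_bound n m + 1)) \<le> ecard \<Delta>"
  proof (cases "finite \<Delta> \<and> 0 < m")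
    case False
    \<comment> \<open>An infinite partition counts as \<infinity>, and for \<open>m = 0\<close> the
      bound \<open>nat (-1 + 1)\<close> is 0.\<close>
    thus ?thesis by (auto simp: ecard_def lineq_bound_def)
  next
    case True
    hence fin: "finite \<Delta>" and m: "0 < m" by auto
    define k where "k = min n (m - 1)"
    have k: "lineq_bound n m = int k"
      using m by (auto simp: lineq_bound_def k_def min_def of_nat_diff)
    have dom: "\<Union>\<Delta> = lineq_dom n m" using part mv_dom_LinEq by (simp add: partition_on_def)
    \<comment> \<open>The invariant speaks of all \<open>B\<close> near \<open>A\<close> with a
      kernel inside that of \<open>A\<close>: the next perturbation stays in the neighbourhood and
      shrinks the kernel, and the classes met so far must remain avoided.\<close>
    have "\<exists>A U \<D>. A \<in> carrier_mat n m \<and> (\<forall>r<n. \<forall>c<m. i \<le> r \<longrightarrow> A $$ (r, c) = 0) \<and>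
        vec_space.rank n A \<le> i \<and> openin (mat_topology n m) U \<and> A \<in> U \<and> \<D> \<subseteq> \<Delta> \<and> card \<D> = i \<and>
        (\<forall>B\<in>U. B \<in> lineq_dom n m \<and> mat_kernel B \<subseteq> mat_kernel A \<longrightarrow> B \<notin> \<Union>\<D>)"
      if "i \<le> k" for i
      using that
    proof (induction i)
      case 0
      show ?case
      proof (intro exI[of _ "0\<^sub>m n m"] exI[of _ "{B \<in> carrier_mat n m. 
            \<forall>i<n. \<forall>j<m. \<bar>B $$ (i, j) - 0\<^sub>m n m $$ (i, j)\<bar> < 1}"] exI[of _ "{}"] conjI)
        show "openin (mat_topology n m) {B \<in> carrier_mat n m. 
            \<forall>i<n. \<forall>j<m. \<bar>B $$ (i, j) - 0\<^sub>m n m $$ (i, j)\<bar> < 1}"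
          by (rule openin_mat_topology_ballI) simp
      qed (auto simp: vec_space.rank_0I)
    next
      case (Suc i)
      then obtain A U \<D> where A: "A \<in> carrier_mat n m" "\<And>r c. r < n \<Longrightarrow> c < m \<Longrightarrow> i \<le> r \<Longrightarrow> A $$ (r, c) = 0"
        "vec_space.rank n A \<le> i"
        and U: "openin (mat_topology n m) U" "A \<in> U" and \<D>: "\<D> \<subseteq> \<Delta>" "card \<D> = i"
        "\<And>B. B \<in> U \<Longrightarrow> B \<in> lineq_dom n m \<Longrightarrow> mat_kernel B \<subseteq> mat_kernel A \<Longrightarrow> B \<notin> \<Union>\<D>"
        by (auto simp del: Union_iff)
      have Adom: "A \<in> lineq_dom n m"
        using A Suc.prems k by (simp add: lineq_dom_def)
      then obtain D where D: "D \<in> \<Delta>" "A \<in> D" using dom by blast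
      have D\<D>: "D \<notin> \<D>" using \<D>(3)[OF U(2) Adom] D(2) by blast
      have "A \<in> mv_dom (mv_restrict (LinEq n m) D)"
        using D(2) LinEq_nonempty[OF Adom] by (simp add: mv_dom_def mv_restrict_def)
      with cont D(1) have "mv_continuous_at (mat_topology n m) (vec_topology m) (mv_restrict (LinEq n m) D) A"
        unfolding mv_continuous_def by blast
      then obtain y where y: "y \<in> mv_restrict (LinEq n m) D A"
        "\<And>V. openin (vec_topology m) V \<Longrightarrow> y \<in> V \<Longrightarrow> 
           \<exists>U. openin (mat_topology n m) U \<and> A \<in> U \<and> 
             (\<forall>z\<in>U \<inter> mv_dom (mv_restrict (LinEq n m) D). mv_restrict (LinEq n m) D z \<inter> V \<noteq> {})"
        unfolding mv_continuous_at_def by blast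
      have y': "y \<in> carrier_vec m" "y \<noteq> 0\<^sub>v m"
        using y(1) D(2) mat_kernel_iff_sums[OF A(1)] by (auto simp: mv_restrict_def LinEq_def split: if_splits)
      then obtain j where j: "j < m" "y $ j \<noteq> 0"
        by (metis carrier_vecD eq_vecI index_zero_vec(1,2))
      define V where "V = {v \<in> carrier_vec m. v $ j \<noteq> (0::real)}"
      have "openin (vec_topology m) V" "y \<in> V"
        unfolding V_def using openin_vec_topology_component_neq_0[OF j(1)] y'(1) j(2) by auto
      from y(2)[OF this] obtain U' where U': "openin (mat_topology n m) U'" "A \<in> U'"
        "\<And>z. z \<in> U' \<Longrightarrow> z \<in> mv_dom (mv_restrict (LinEq n m) D) \<Longrightarrow> mv_restrict (LinEq n m) D z \<inter> V \<noteq> {}"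
        by blast
      have UU: "openin (mat_topology n m) (U \<inter> U')" "A \<in> U \<inter> U'" using U U' by auto
      from openin_mat_topology_ball[OF this] obtain e where e: "e > 0"
        "\<forall>B\<in>carrier_mat n m. (\<forall>i<n. \<forall>j<m. \<bar>B $$ (i, j) - A $$ (i, j)\<bar> < e) \<longrightarrow> B \<in> U \<inter> U'"
        by blast
      have i: "i < n" using Suc.prems by (simp add: k_def)
      \<comment> \<open>Half of \<open>e\<close> keeps the new matrix inside the ball, and the
        product form of the entries shows that \<open>E\<close> has rank at most 1.\<close>
      define E where "E = mat n m (\<lambda>(r, c). (if r = i then e / 2 else 0) * (if c = j then 1 else 0 :: real))"
      have E: "E \<in> carrier_mat n m" by (simp add: E_def)
      define A' where "A' = A + E"
      have A': "A' \<in> carrier_mat n m" using A(1) E by (simp add: A'_def)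
      have entry: "A' $$ (r, c) = A $$ (r, c) + (if r = i \<and> c = j then e / 2 else 0)" if "r < n" "c < m" for r c
        using that A(1) by (simp add: A'_def E_def)
      have "A' \<in> U \<inter> U'"
        using e A' by (auto simp: entry)
      have "vec_space.rank n E \<le> 1"
        by (rule vec_space.rank_le_1_product_entries[OF E, 
              of "\<lambda>r. if r = i then e / 2 else 0" "\<lambda>c. if c = j then 1 else 0"]) (simp add: E_def)
      hence rank: "vec_space.rank n A' \<le> Suc i"
        using vec_space.rank_subadditive[OF A(1) E] A(3) by (simp add: A'_def)
      have ker: "v \<in> mat_kernel A \<and> v $ j = 0" if v: "v \<in> mat_kernel A'" for v
      proof -
        have vC: "v \<in> carrier_vec m" and s: "\<And>r. r < n \<Longrightarrow> (\<Sum>c<m. A' $$ (r, c) * v $ c) = 0"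
          using v by (auto simp: mat_kernel_iff_sums[OF A'])
        have "(\<Sum>c<m. A $$ (r, c) * v $ c) = 0" if r: "r < n" for r
        proof (cases "r = i")
          case True
          with A(2) r show ?thesis by simp
        next
          case False
          have "(\<Sum>c<m. A $$ (r, c) * v $ c) = (\<Sum>c<m. A' $$ (r, c) * v $ c)"
            using False r by (intro sum.cong) (simp_all add: entry)
          with s[OF r] show ?thesis by simp
        qed
        \<comment> \<open>Row \<open>i\<close> of \<open>A\<close> is zero, so this equation reads
          \<open>e / 2 * v $ j = 0\<close>.\<close>
        moreover have "(\<Sum>c<m. A' $$ (i, c) * v $ c) = (\<Sum>c<m. if c = j then e / 2 * v $ c else 0)"
          using i A(2) by (intro sum.cong) (simp_all add: entry)
        with s[OF i] j(1) e(1) have "v $ j = 0" by simp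
        ultimately show ?thesis using vC by (simp add: mat_kernel_iff_sums[OF A(1)])
      qed
      show ?case
      proof (intro exI[of _ A'] exI[of _ "U \<inter> U'"] exI[of _ "insert D \<D>"] conjI ballI impI)
        show "A' \<in> carrier_mat n m" "vec_space.rank n A' \<le> Suc i" "openin (mat_topology n m) (U \<inter> U')"
          "A' \<in> U \<inter> U'" by fact+
        show "\<forall>r<n. \<forall>c<m. Suc i \<le> r \<longrightarrow> A' $$ (r, c) = 0" using A(2) by (simp add: entry)
        show "insert D \<D> \<subseteq> \<Delta>" using D \<D> by simp
        show "card (insert D \<D>) = Suc i" using D\<D> \<D> finite_subset[OF \<D>(1) fin] by simp
        fix B assume B: "B \<in> U \<inter> U'" "B \<in> lineq_dom n m \<and> mat_kernel B \<subseteq> mat_kernel A'"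
        have "mat_kernel B \<subseteq> mat_kernel A" using B(2) ker by blast
        hence "B \<notin> \<Union>\<D>" using \<D>(3) B by blast
        \<comment> \<open>Continuity would give \<open>B\<close> a kernel vector with nonzero
          component \<open>j\<close>, but the kernel of \<open>B\<close> lies in that of
          \<open>A'\<close>.\<close>
        moreover have "B \<notin> D"
        proof
          assume BD: "B \<in> D"
          hence "B \<in> mv_dom (mv_restrict (LinEq n m) D)"
            using B(2) LinEq_nonempty by (simp add: mv_dom_def mv_restrict_def)
          with U'(3)[of B] B(1) BD obtain v where "v \<in> LinEq n m B" "v \<in> V"
            by (auto simp: mv_restrict_def)
          hence "v \<in> mat_kernel B" "v $ j \<noteq> 0"
            by (auto simp: LinEq_def V_def split: if_splits)
          with ker B(2) show False by blast
        qed
        ultimately show "B \<notin> \<Union>(insert D \<D>)" by simp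
      qed
    qed
    from this[of k] obtain A U \<D> where A: "A \<in> carrier_mat n m" "vec_space.rank n A \<le> k" "A \<in> U"
      and \<D>: "\<D> \<subseteq> \<Delta>" "card \<D> = k"
        "\<And>B. B \<in> U \<Longrightarrow> B \<in> lineq_dom n m \<Longrightarrow> mat_kernel B \<subseteq> mat_kernel A \<Longrightarrow> B \<notin> \<Union>\<D>"
      by (auto simp del: Union_iff)
    have Adom: "A \<in> lineq_dom n m" using A k by (simp add: lineq_dom_def)
    then obtain D where D: "D \<in> \<Delta>" "A \<in> D" using dom by blast
    \<comment> \<open>With \<open>k\<close> classes avoided, the final matrix itself lies in a
      further one; hence the count \<open>k + 1\<close>.\<close>
    have "D \<notin> \<D>" using \<D>(3)[OF A(3) Adom] D(2) by blast
    hence "card (insert D \<D>) = Suc k" using \<D> finite_subset[OF \<D>(1) fin] by simp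
    moreover have "card (insert D \<D>) \<le> card \<Delta>" using D \<D> fin by (intro card_mono) auto
    ultimately show ?thesis using fin k by (simp add: ecard_def)
  qed
qed

section \<open>Computation by search\<close>

primrec hist :: "(nat \<Rightarrow> bool) \<Rightarrow> nat \<Rightarrow> nat" where
  "hist p 0 = 0"
| "hist p (Suc t) = \<langle>of_bool (p t), hist p t\<rangle>"

lemma item_hist: "u < t \<Longrightarrow> item (hist p t) (t - Suc u) = of_bool (p u)"
proof (induction t)
  case (Suc t)
  show ?case
  proof (cases "u = t")
    case False
    hence "Suc t - Suc u = Suc (t - Suc u)" using Suc.prems by simp
    thus ?thesis using Suc False by simp
  qed simp
qed simp

text \<open>
  Every candidate is tested at infinitely many stages, since stage \<open>t\<close> tests \<open>pfst t\<close>. The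
  components are the number and the stack of accepted candidates and the number of emitted bits.
\<close>

primrec search :: "(nat \<Rightarrow> nat \<Rightarrow> nat \<Rightarrow> nat \<Rightarrow> nat \<Rightarrow> bool) \<Rightarrow> (nat \<Rightarrow> bool) \<Rightarrow> nat \<Rightarrow> nat \<times> nat \<times> nat" where
  "search T p 0 = (0, 0, 0)"
| "search T p (Suc t) = (let (l, L, i) = search T p t;
      acc = T (hist p (Suc t)) (Suc t) l L (pfst t)
    in (l + of_bool acc, if acc then \<langle>pfst t, L\<rangle> else L, i + of_bool (Suc i < l)))"

text \<open>Positions are counted from the bottom of the stack, so an index keeps its meaning when
  further candidates are pushed.\<close>

definition accepted :: "nat \<Rightarrow> nat \<Rightarrow> nat \<Rightarrow> nat" where
  "accepted l L e = item L (l - Suc e)"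

lemma accepted_push: "e < l \<Longrightarrow> accepted (Suc l) \<langle>x, L\<rangle> e = accepted l L e"
proof -
  assume "e < l"
  hence "Suc l - Suc e = Suc (l - Suc e)" by simp
  thus ?thesis by (simp add: accepted_def)
qed

context
  fixes T :: "nat \<Rightarrow> nat \<Rightarrow> nat \<Rightarrow> nat \<Rightarrow> nat \<Rightarrow> bool" and p :: "nat \<Rightarrow> bool"
begin

abbreviation (input) "num t \<equiv> fst (search T p t)"
abbreviation (input) "stack t \<equiv> fst (snd (search T p t))"
abbreviation (input) "emitted t \<equiv> snd (snd (search T p t))"
abbreviation (input) "acc t \<equiv> T (hist p (Suc t)) (Suc t) (num t) (stack t) (pfst t)"

lemma search_Suc:
  "num (Suc t) = num t + of_bool (acc t)"
  "stack (Suc t) = (if acc t then \<langle>pfst t, stack t\<rangle> else stack t)"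
  "emitted (Suc t) = emitted t + of_bool (Suc (emitted t) < num t)"
  by (simp_all add: Let_def case_prod_beta)

lemma search_stable:
  assumes "t \<le> t'"
  shows "num t \<le> num t' \<and> (\<forall>e<num t. accepted (num t') (stack t') e = accepted (num t) (stack t) e)"
  using assms
proof (induction t' rule: dec_induct)
  case (step t')
  thus ?case by (simp add: search_Suc accepted_push del: search.simps)
qed simp

text \<open>Progress can be expected only above a bottom entry that passed the test for the empty
  stack; this invariant supplies that condition at every stage.\<close>

lemma first_accepted:
  "num t = 0 \<and> stack t = 0 \<or>
   0 < num t \<and> (\<exists>t'. T (hist p t') t' 0 0 (accepted (num t) (stack t) 0))"
proof (induction t)
  case (Suc t)
  show ?case
  proof (cases "acc t")
    case False
    with Suc show ?thesis by (simp add: search_Suc del: search.simps)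
  next
    case True
    show ?thesis
    proof (cases "num t = 0")
      case True': True
      with Suc True have "T (hist p (Suc t)) (Suc t) 0 0 (pfst t)" by simp
      thus ?thesis using True True'
        by (simp add: search_Suc accepted_def del: search.simps hist.simps) blast
    next
      case False
      with Suc True show ?thesis by (simp add: search_Suc accepted_push del: search.simps hist.simps)
    qed
  qed
qed simp

text \<open>If the search stalled, its stack would stay constant, and a candidate eventually
  acceptable for this stack is tested again at arbitrarily late stages.\<close>

lemma search_progress:
  assumes "\<And>t. \<exists>x t0. \<forall>t'\<ge>t0. T (hist p t') t' (num t) (stack t) x"
  shows "\<exists>t. e \<le> num t"
proof (induction e)
  case (Suc e)
  then obtain t where t: "e \<le> num t" by blast
  show ?case
  proof (rule ccontr)
    assume "\<not> ?case"
    hence num: "num t' = num t" if "t \<le> t'" for t'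
      using that t search_stable[OF that] by (metis le_antisym not_less_eq_eq order_trans)
    have rej: "\<not> acc t'" if "t \<le> t'" for t'
      using num[OF that] num[of "Suc t'"] that search_Suc(1)[of t'] by (simp del: search.simps hist.simps)
    have const: "num t' = num t \<and> stack t' = stack t" if "t \<le> t'" for t'
      using that
    proof (induction t' rule: dec_induct)
      case (step t')
      thus ?case using rej[of t'] by (simp add: search_Suc del: search.simps hist.simps)
    qed simp
    obtain x t0 where x: "\<And>t'. t0 \<le> t' \<Longrightarrow> T (hist p t') t' (num t) (stack t) x"
      using assms by blast
    \<comment> \<open>This stage tests \<open>x\<close> and is late enough, since a code is at least
      as large as its second component.\<close>
    define t' where "t' = \<langle>x, max t t0\<rangle>"
    have "max t t0 \<le> t'" unfolding t'_def by (rule le_prod_encode_2)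
    hence "acc t'" using x[of "Suc t'"] const[of t'] by (simp add: t'_def del: hist.simps)
    with rej[of t'] \<open>max t t0 \<le> t'\<close> show False by simp
  qed
qed simp

lemma search_accepted:
  assumes "e < num t"
  shows "\<exists>t'<t. num t' = e \<and> T (hist p (Suc t')) (Suc t') e (stack t') (accepted (num t) (stack t) e)"
  using assms
proof (induction t)
  case (Suc t)
  show ?case
  proof (cases "e < num t")
    case True
    thus ?thesis using Suc.IH search_stable[of t "Suc t"] by (metis le_SucI le_refl less_SucI)
  next
    case False
    have "e < num t + of_bool (acc t)" using Suc.prems by (simp only: search_Suc)
    with False have "acc t" "num t = e"
      by (cases "acc t"; simp del: search.simps hist.simps)+
    thus ?thesis
      by (intro exI[of _ t]) (simp add: search_Suc accepted_def del: search.simps hist.simps)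
  qed
qed simp

lemma search_emits:
  assumes "\<And>e. \<exists>t. e \<le> num t"
  shows "\<exists>t. e \<le> emitted t"
proof (induction e)
  case (Suc e)
  then obtain t where t: "e \<le> emitted t" by blast
  obtain t' where t': "Suc (Suc (emitted t)) \<le> num t'" using assms by blast
  define u where "u = max t t'"
  have mono: "a \<le> b \<Longrightarrow> emitted a \<le> emitted b" for a b
    by (induction b rule: dec_induct) (simp_all add: search_Suc del: search.simps)
  have "num t' \<le> num u" using search_stable[of t' u] by (simp add: u_def)
  show ?case
  proof (cases "emitted u = emitted t")
    case True
    hence "emitted (Suc u) = Suc (emitted t)"
      using t' \<open>num t' \<le> num u\<close> by (simp add: search_Suc del: search.simps)
    thus ?thesis using t by (metis Suc_le_mono)
  next
    case False
    with mono[of t u] have "emitted t < emitted u" by (simp add: u_def)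
    thus ?thesis using t by (metis Suc_leI le_trans Suc_le_mono)
  qed
qed simp

end

text \<open>\<open>T\<close> and \<open>E\<close> have several arguments while \<open>pr\<close> is
  unary, so their primitive recursiveness is expressed by substituting \<open>pr\<close> functions.
  The sequence \<open>xs\<close> is the limit of the growing stack; liveness is demanded for the
  stacks described by \<open>first_accepted\<close>.\<close>

theorem search_transducer:
  fixes T :: "nat \<Rightarrow> nat \<Rightarrow> nat \<Rightarrow> nat \<Rightarrow> nat \<Rightarrow> nat \<Rightarrow> bool" and E :: "nat \<Rightarrow> nat \<Rightarrow> nat \<Rightarrow> bool"
  assumes prT: "\<And>r h t l L x. pr r \<Longrightarrow> pr h \<Longrightarrow> pr t \<Longrightarrow> pr l \<Longrightarrow> pr L \<Longrightarrow> pr x \<Longrightarrow>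
      prp (\<lambda>z. T (r z) (h z) (t z) (l z) (L z) (x z))"
    and prE: "\<And>l L i. pr l \<Longrightarrow> pr L \<Longrightarrow> pr i \<Longrightarrow> prp (\<lambda>z. E (l z) (L z) (i z))"
  shows "\<exists>M. type2_wf M \<and> num_inputs M = 2 \<and> (\<forall>p w.
    (\<forall>l L. l = 0 \<and> L = 0 \<or> 0 < l \<and> (\<exists>t. T (length w) (hist p t) t 0 0 (accepted l L 0)) \<longrightarrow>
       (\<exists>x t0. \<forall>t\<ge>t0. T (length w) (hist p t) t l L x)) \<longrightarrow>
    (\<exists>xs. (\<exists>t. T (length w) (hist p t) t 0 0 (xs 0)) \<and>
       (\<forall>k. \<exists>t L. accepted (Suc k) L 0 = xs 0 \<and> T (length w) (hist p t) t (Suc k) L (xs (Suc k))) \<and>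
       (\<forall>q. (\<forall>l L i. Suc i < l \<and> (\<forall>e<l. accepted l L e = xs e) \<longrightarrow> E l L i = q i) \<longrightarrow>
          type2_outputs M [inf_tape p, word_tape w] q)))"
proof -
  define fr where "fr z = pfst (pfst z)" for z
  define ft where "ft z = pfst (psnd (pfst z))" for z
  define fh where "fh z = pfst (psnd (psnd (pfst z)))" for z
  define fl where "fl z = pfst (psnd (psnd (psnd (pfst z))))" for z
  define fL where "fL z = pfst (psnd (psnd (psnd (psnd (pfst z)))))" for z
  define fi where "fi z = psnd (psnd (psnd (psnd (psnd (pfst z)))))" for z
  have prs: "pr fr" "pr ft" "pr fh" "pr fl" "pr fL" "pr fi"
    unfolding fr_def ft_def fh_def fl_def fL_def fi_def
    by (intro pr_pfst pr_psnd pr.ident)+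
  define h' where "h' z = \<langle>psnd z, fh z\<rangle>" for z
  define ac where "ac z = T (fr z) (h' z) (Suc (ft z)) (fl z) (fL z) (pfst (ft z))" for z
  define em where "em z \<longleftrightarrow> Suc (fi z) < fl z" for z
  \<comment> \<open>At most one of the two output numbers is 1: the round emits the bit
    \<open>E\<close> or nothing.\<close>
  define F where "F z = \<langle>of_bool (em z \<and> \<not> E (fl z) (fL z) (fi z)),
      \<langle>of_bool (em z \<and> E (fl z) (fL z) (fi z)),
      \<langle>fr z, \<langle>Suc (ft z), \<langle>h' z, \<langle>fl z + of_bool (ac z),
        \<langle>if ac z then \<langle>pfst (ft z), fL z\<rangle> else fL z, fi z + of_bool (em z)\<rangle>\<rangle>\<rangle>\<rangle>\<rangle>\<rangle>\<rangle>" for z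
  have ac: "prp ac" and h': "pr h'" and em: "prp em"
    unfolding ac_def h'_def em_def
    by (intro prT pr.pair pr_pfst pr_psnd pr_Suc prs pr.ident prp_less)+
  have "pr F"
    unfolding F_def
    by (intro pr.pair pr_of_bool prp_conj prp_not prE em ac h' prs pr_add pr_if pr_Suc pr_pfst)
  from pr_transducer[OF this pr.pair[OF pr.ident pr.zero]] obtain M where
    M: "type2_wf M \<and> num_inputs M = 2 \<and>
     (\<forall>p w q. (\<forall>t. \<forall>i<length (round_out F \<langle>length w, 0\<rangle> p t). round_out F \<langle>length w, 0\<rangle> p t ! i = q i) \<and>
        (\<forall>l. \<exists>t. l \<le> length (round_out F \<langle>length w, 0\<rangle> p t)) \<longrightarrow>
        type2_outputs M [inf_tape p, word_tape w] q)"
    by (elim exE)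
  note outputs = M[THEN conjunct2, THEN conjunct2, rule_format]
  show ?thesis
  proof (intro exI[of _ M] conjI allI impI)
    fix p :: "nat \<Rightarrow> bool" and w :: "bool list"
    let ?r = "length w"
    let ?num = "\<lambda>t. fst (search (T ?r) p t)" and ?stack = "\<lambda>t. fst (snd (search (T ?r) p t))"
      and ?emitted = "\<lambda>t. snd (snd (search (T ?r) p t))"
    assume live: "\<forall>l L. l = 0 \<and> L = 0 \<or> 0 < l \<and> (\<exists>t. T ?r (hist p t) t 0 0 (accepted l L 0)) \<longrightarrow>
       (\<exists>x t0. \<forall>t\<ge>t0. T ?r (hist p t) t l L x)"
    \<comment> \<open>Hence the initial state \<open>\<langle>?r, 0\<rangle>\<close> is also the
      tuple whose remaining components are all 0.\<close>
    have zero: "\<langle>0, 0\<rangle> = 0" by (simp add: prod_encode_def)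
    have F_eq: "psnd (psnd (F \<langle>\<langle>r, \<langle>t, \<langle>h, \<langle>l, \<langle>L, i\<rangle>\<rangle>\<rangle>\<rangle>\<rangle>, b\<rangle>)) = \<langle>r, \<langle>Suc t, \<langle>\<langle>b, h\<rangle>,
        \<langle>l + of_bool (T r \<langle>b, h\<rangle> (Suc t) l L (pfst t)),
        \<langle>if T r \<langle>b, h\<rangle> (Suc t) l L (pfst t) then \<langle>pfst t, L\<rangle> else L, i + of_bool (Suc i < l)\<rangle>\<rangle>\<rangle>\<rangle>\<rangle>"
      for r t h l L i b
      unfolding F_def ac_def em_def h'_def fr_def ft_def fh_def fl_def fL_def fi_def
      by (simp only: pfst_pair psnd_pair)
    have state: "round_state F \<langle>?r, 0\<rangle> p t = \<langle>?r, \<langle>t, \<langle>hist p t, \<langle>?num t, \<langle>?stack t, ?emitted t\<rangle>\<rangle>\<rangle>\<rangle>\<rangle>" for t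
    proof (induction t)
      case (Suc t)
      show ?case
        unfolding round_state.simps(2) Suc F_eq search_Suc[of "T ?r"] hist.simps ..
    qed (simp add: zero)
    have "\<exists>x t0. \<forall>t'\<ge>t0. T ?r (hist p t') t' (?num t) (?stack t) x" for t
      by (rule live[rule_format]) (rule first_accepted)
    hence progress: "\<exists>t. e \<le> ?num t" for e
      by (rule search_progress)
    have "\<forall>e. \<exists>t. Suc e \<le> ?num t" using progress by blast
    then obtain tf where "\<forall>e. Suc e \<le> ?num (tf e)" by (rule choice[THEN exE])
    hence tf: "Suc e \<le> ?num (tf e)" for e by blast
    \<comment> \<open>Entry \<open>e\<close> is read at some stage where it exists; by stability the
      choice of the stage does not matter.\<close>
    define xs where "xs e = accepted (?num (tf e)) (?stack (tf e)) e" for e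
    have xs: "accepted (?num t) (?stack t) e = xs e" if "e < ?num t" for t e
    proof (cases "t \<le> tf e")
      case True
      thus ?thesis using search_stable[OF True, of "T ?r" p] that by (simp add: xs_def)
    next
      case False
      thus ?thesis using search_stable[of "tf e" t "T ?r" p] tf[of e] by (simp add: xs_def Suc_le_eq)
    qed
    have acc_xs: "\<exists>t. ?num t = e \<and> T ?r (hist p (Suc t)) (Suc t) e (?stack t) (xs e)" for e
      using search_accepted[of e "T ?r" p "tf e"] tf[of e] unfolding xs_def by auto
    show "\<exists>xs. (\<exists>t. T ?r (hist p t) t 0 0 (xs 0)) \<and>
       (\<forall>k. \<exists>t L. accepted (Suc k) L 0 = xs 0 \<and> T ?r (hist p t) t (Suc k) L (xs (Suc k))) \<and>
       (\<forall>q. (\<forall>l L i. Suc i < l \<and> (\<forall>e<l. accepted l L e = xs e) \<longrightarrow> E l L i = q i) \<longrightarrow>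
          type2_outputs M [inf_tape p, word_tape w] q)"
    proof (intro exI[of _ xs] conjI allI impI)
      show "\<exists>t. T ?r (hist p t) t 0 0 (xs 0)"
      proof -
        obtain t where t: "?num t = 0" "T ?r (hist p (Suc t)) (Suc t) 0 (?stack t) (xs 0)"
          using acc_xs by blast
        hence "?stack t = 0" using first_accepted[of "T ?r" p t] by simp
        with t show ?thesis by (intro exI[of _ "Suc t"]) (simp del: hist.simps)
      qed
      fix k
      obtain t where "?num t = Suc k" "T ?r (hist p (Suc t)) (Suc t) (Suc k) (?stack t) (xs (Suc k))"
        using acc_xs by blast
      thus "\<exists>t L. accepted (Suc k) L 0 = xs 0 \<and> T ?r (hist p t) t (Suc k) L (xs (Suc k))"
        using xs[of 0 t] by (metis zero_less_Suc)
    next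
      fix q
      assume q: "\<forall>l L i. Suc i < l \<and> (\<forall>e<l. accepted l L e = xs e) \<longrightarrow> E l L i = q i"
      have out: "round_out F \<langle>?r, 0\<rangle> p t = map q [0..<?emitted t]" for t
      proof (induction t)
        case (Suc t)
        let ?z = "\<langle>round_state F \<langle>?r, 0\<rangle> p t, of_bool (p t)\<rangle>"
        have F: "pfst (F ?z) = of_bool (em ?z \<and> \<not> E (?num t) (?stack t) (?emitted t))"
          "pfst (psnd (F ?z)) = of_bool (em ?z \<and> E (?num t) (?stack t) (?emitted t))"
          "em ?z \<longleftrightarrow> Suc (?emitted t) < ?num t"
          unfolding F_def state fl_def fL_def fi_def em_def by (simp_all only: pfst_pair psnd_pair)
        have "E (?num t) (?stack t) (?emitted t) = q (?emitted t)" if "em ?z"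
          using q xs that F(3) by blast
        thus ?case
          unfolding round_out.simps F Suc search_Suc(3)[of "T ?r"]
          using F(3) by (cases "em ?z"; cases "q (?emitted t)") (auto simp del: search.simps)
      qed simp
      show "type2_outputs M [inf_tape p, word_tape w] q"
        by (rule outputs) (use search_emits[OF progress] in \<open>auto simp: out\<close>)
    qed
  qed (use M in auto)
qed

section \<open>Reading the input blocks\<close>

text \<open>Decoding by counting: the zeros before a bit give the number of its block, and the ones
  with block number \<open>k\<close> add up to the length of block \<open>k\<close>.\<close>

lemma block_code_counts:
  "\<exists>z c. b = (\<Sum>i<z. s i) + z + c \<and> c \<le> s z \<and>
     (\<Sum>u<b. of_bool (\<not> block_code s u)) = z \<and>
     (\<Sum>u<b. of_bool (block_code s u \<and> (\<Sum>u<u. of_bool (\<not> block_code s u)) = k)) =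
       (if z < k then 0 else if z = k then c else s k)"
proof (induction b)
  case 0
  show ?case by (intro exI[of _ 0]) simp
next
  case (Suc b)
  then obtain z c where b: "b = (\<Sum>i<z. s i) + z + c" "c \<le> s z"
    "(\<Sum>u<b. of_bool (\<not> block_code s u)) = z"
    "(\<Sum>u<b. of_bool (block_code s u \<and> (\<Sum>u<u. of_bool (\<not> block_code s u)) = k)) =
       (if z < k then 0 else if z = k then c else s k)" by blast
  note bc = block_code_at[of c s z, OF b(2), folded b(1)]
  show ?case
  proof (cases "c < s z")
    case True
    show ?thesis
      by (intro exI[of _ z] exI[of _ "Suc c"])
        (use True b bc in \<open>simp del: sum_of_bool_eq\<close>)
  next
    case False
    show ?thesis
      by (intro exI[of _ "Suc z"] exI[of _ 0])
        (use False b bc in \<open>simp del: sum_of_bool_eq\<close>)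
  qed
qed

text \<open>
  The number of complete blocks, and the length of block \<open>k\<close>, in the component \<open>l\<close> of an interleaving
  of \<open>N\<close> block codes of which the first \<open>t\<close> bits are known.
\<close>

definition hzeros :: "nat \<Rightarrow> nat \<Rightarrow> nat \<Rightarrow> nat \<Rightarrow> nat \<Rightarrow> nat" where
  "hzeros N l h t b = (\<Sum>u<b. of_bool (\<not> 0 < item h (t - Suc (N * u + l))))"

definition hval :: "nat \<Rightarrow> nat \<Rightarrow> nat \<Rightarrow> nat \<Rightarrow> nat \<Rightarrow> nat" where
  "hval N l h t k =
     (\<Sum>u<t div N. of_bool (0 < item h (t - Suc (N * u + l)) \<and> hzeros N l h t u = k))"

definition hready :: "nat \<Rightarrow> nat \<Rightarrow> nat \<Rightarrow> nat \<Rightarrow> bool" where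
  "hready N h t k \<longleftrightarrow> (\<forall>l<N. k < hzeros N l h t (t div N))"

lemma pr_hzeros:
  assumes "pr h" "pr t" "pr b"
  shows "pr (\<lambda>x. hzeros N l (h x) (t x) (b x))"
  unfolding hzeros_def
  by (intro pr_sum pr_of_bool prp_not prp_less pr_item pr_minus pr_Suc pr_add pr_mult pr_const
      pr_psnd pr.ident pr.pfst assms pr.comp[OF assms(1)] pr.comp[OF assms(2)])

lemma pr_hval:
  assumes "pr h" "pr t" "pr k"
  shows "pr (\<lambda>x. hval N l (h x) (t x) (k x))"
  unfolding hval_def
  by (intro pr_sum pr_of_bool prp_conj prp_less prp_eq pr_hzeros pr_div pr_item pr_minus pr_Suc pr_add
      pr_mult pr_const pr_psnd pr.ident pr.pfst assms
      pr.comp[OF assms(1)] pr.comp[OF assms(2)] pr.comp[OF assms(3)])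

lemma prp_hready:
  assumes "pr h" "pr t" "pr k"
  shows "prp (\<lambda>x. hready N (h x) (t x) (k x))"
  unfolding hready_def
  by (intro prp_all_less prp_less pr_hzeros pr_div pr_const assms)

context
  fixes N :: nat and p :: "nat \<Rightarrow> bool" and s :: "nat \<Rightarrow> nat \<Rightarrow> nat"
  assumes p: "\<And>l. l < N \<Longrightarrow> (\<lambda>t. p (N * t + l)) = block_code (s l)"
begin

lemma item_hist_block:
  assumes "l < N" "u < t div N"
  shows "item (hist p t) (t - Suc (N * u + l)) = of_bool (block_code (s l) u)"
proof -
  have "N * u + l < N * Suc u" using assms(1) by simp
  also have "\<dots> \<le> N * (t div N)" using assms(2) by (intro mult_le_mono2) simp
  also have "\<dots> \<le> t" by simp
  finally have "item (hist p t) (t - Suc (N * u + l)) = of_bool (p (N * u + l))"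
    by (rule item_hist)
  thus ?thesis using p[OF assms(1)] by metis
qed

lemma hzeros_hist:
  assumes "l < N" "b \<le> t div N"
  shows "hzeros N l (hist p t) t b = (\<Sum>u<b. of_bool (\<not> block_code (s l) u))"
  unfolding hzeros_def
  by (intro sum.cong) (use assms item_hist_block in auto)

lemma hval_hist:
  assumes "l < N" "k < hzeros N l (hist p t) t (t div N)"
  shows "hval N l (hist p t) t k = s l k"
proof -
  have "hval N l (hist p t) t k = (\<Sum>u<t div N. of_bool (block_code (s l) u \<and>
      (\<Sum>u<u. of_bool (\<not> block_code (s l) u)) = k))"
    unfolding hval_def
    by (intro sum.cong) (use assms(1) item_hist_block hzeros_hist in auto)
  also obtain z c where "hzeros N l (hist p t) t (t div N) = z" "\<dots> = (if z < k then 0 else if z = k then c else s l k)"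
    using block_code_counts[of "t div N" "s l" k] hzeros_hist[OF assms(1), of "t div N" t] by auto
  note this(2)
  also have "\<dots> = s l k" using assms(2) \<open>_ = z\<close> by simp
  finally show ?thesis .
qed

lemma hready_hist_eventually:
  shows "\<exists>t0. \<forall>t\<ge>t0. hready N (hist p t) t k"
proof -
  \<comment> \<open>The sum bounds the end of block \<open>k\<close> in all components at
    once.\<close>
  define b where "b = Suc (\<Sum>l<N. (\<Sum>i\<le>k. s l i) + k)"
  have "k < hzeros N l (hist p t) t (t div N)" if t: "N * b \<le> t" and l: "l < N" for t l
  proof -
    obtain z c where z: "t div N = (\<Sum>i<z. s l i) + z + c" "c \<le> s l z"
      "hzeros N l (hist p t) t (t div N) = z"
      using block_code_counts[of "t div N" "s l" k] hzeros_hist[OF l, of "t div N" t] by auto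
    have "(\<Sum>i\<le>k. s l i) + k \<le> (\<Sum>l<N. (\<Sum>i\<le>k. s l i) + k)"
      using l by (intro member_le_sum) auto
    hence "(\<Sum>i\<le>k. s l i) + k < b" by (simp add: b_def)
    also have "b \<le> t div N"
      using t l by (simp add: less_eq_div_iff_mult_less_eq mult.commute)
    finally have *: "(\<Sum>i\<le>k. s l i) + k < t div N" .
    show ?thesis
    proof (rule ccontr)
      assume "\<not> ?thesis"
      hence zk: "z \<le> k" using z(3) by simp
      have "(\<Sum>i<z. s l i) + c \<le> (\<Sum>i\<le>z. s l i)" using z(2) by (simp add: lessThan_Suc_atMost[symmetric])
      also have "\<dots> \<le> (\<Sum>i\<le>k. s l i)" using zk by (intro sum_mono2) auto
      finally show False using * z(1) zk by simp
    qed
  qed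
  thus ?thesis unfolding hready_def by blast
qed

end

section \<open>Certificates and approximate solutions\<close>

lemma ex_pos_mult_le:
  fixes a e :: real
  assumes "0 \<le> a" "0 < e"
  shows "\<exists>d>0. a * d \<le> e"
proof (intro exI[of _ "e / (a + 1)"] conjI)
  show "0 < e / (a + 1)" using assms by simp
  have "a * e \<le> (a + 1) * e" using assms by simp
  thus "a * (e / (a + 1)) \<le> e" using assms by (simp add: field_simps)
qed

lemma ex_half_power_mult_le:
  fixes a e :: real
  assumes "0 \<le> a" "0 < e"
  shows "\<exists>k. a * (1/2) ^ k \<le> e"
proof -
  obtain d where d: "d > 0" "a * d \<le> e" using ex_pos_mult_le[OF assms] by blast
  obtain k where "(1/2::real) ^ k < d" using real_arch_pow_inv[OF d(1), of "1/2"] by auto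
  hence "a * (1/2) ^ k \<le> a * d" using assms(1) by (intro mult_left_mono) auto
  with d(2) show ?thesis by (intro exI[of _ k]) simp
qed

lemma abs_sum_mult_le:
  fixes f g :: "nat \<Rightarrow> real"
  assumes "\<And>i. i \<in> I \<Longrightarrow> \<bar>g i\<bar> \<le> d"
  shows "\<bar>\<Sum>i\<in>I. f i * g i\<bar> \<le> d * (\<Sum>i\<in>I. \<bar>f i\<bar>)"
proof -
  have "\<bar>\<Sum>i\<in>I. f i * g i\<bar> \<le> (\<Sum>i\<in>I. \<bar>f i\<bar> * d)"
    by (intro order_trans[OF sum_abs] sum_mono) (auto simp: abs_mult intro!: mult_left_mono assms)
  thus ?thesis by (simp add: sum_distrib_left mult.commute)
qed

text \<open>An error of \<open>1 / (2 * real m)\<close> per entry makes the row sums of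
  \<open>B M - 1\<close> at most 1/2, so \<open>B M\<close> is invertible and its inverse at most
  doubles the maximum norm.\<close>

definition near_identity :: "nat \<Rightarrow> nat \<Rightarrow> (nat \<Rightarrow> nat \<Rightarrow> real) \<Rightarrow> (nat \<Rightarrow> nat \<Rightarrow> real) \<Rightarrow> bool" where
  "near_identity N m B M \<longleftrightarrow>
     (\<forall>i<m. \<forall>j<m. \<bar>(\<Sum>l<N. B i l * M l j) - of_bool (i = j)\<bar> \<le> 1 / (2 * real m))"

text \<open>At an index \<open>a\<close> where \<open>\<bar>w a\<bar>\<close> is maximal, this
  maximum is at most twice the entry \<open>a\<close> of \<open>B M w\<close>; the sum of all
  \<open>\<bar>B i l\<bar>\<close> bounds every row sum of \<open>B\<close>.\<close>

lemma near_identity_bound: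
  assumes near: "near_identity N m B M"
    and w: "\<And>l. l < N \<Longrightarrow> 2 * (\<Sum>i<m. \<Sum>l<N. \<bar>B i l\<bar>) * \<bar>\<Sum>j<m. M l j * w j\<bar> \<le> e"
    and e: "0 \<le> e" and i: "i < m"
  shows "\<bar>w i\<bar> \<le> e"
proof -
  define \<beta> where "\<beta> = (\<Sum>i<m. \<Sum>l<N. \<bar>B i l\<bar>)"
  define W where "W = Max ((\<lambda>i. \<bar>w i\<bar>) ` {..<m})"
  have "W \<in> (\<lambda>i. \<bar>w i\<bar>) ` {..<m}" unfolding W_def using i by (intro Max_in) auto
  then obtain a where a: "a < m" "W = \<bar>w a\<bar>" by auto
  have W: "\<bar>w j\<bar> \<le> W" if "j < m" for j
    unfolding W_def using that by (intro Max_ge) auto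
  define Mw where "Mw l = (\<Sum>j<m. M l j * w j)" for l
  have "(\<Sum>l<N. B a l * Mw l) = (\<Sum>l<N. \<Sum>j<m. B a l * M l j * w j)"
    by (simp add: Mw_def sum_distrib_left mult.assoc)
  also have "\<dots> = (\<Sum>j<m. (\<Sum>l<N. B a l * M l j) * w j)"
    by (subst sum.swap) (simp add: sum_distrib_right)
  finally have eq: "(\<Sum>l<N. B a l * Mw l) = (\<Sum>j<m. (\<Sum>l<N. B a l * M l j) * w j)" .
  have eq: "(\<Sum>l<N. B a l * Mw l) - w a =
      (\<Sum>j<m. w j * ((\<Sum>l<N. B a l * M l j) - of_bool (a = j)))"
  proof -
    have "(\<Sum>j<m. w j * of_bool (a = j)) = (\<Sum>j<m. if j = a then w j else 0)"
      by (intro sum.cong) auto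
    also have "\<dots> = w a" using a(1) by simp
    finally show ?thesis using eq
      by (simp only: right_diff_distrib sum_subtractf mult.commute)
  qed
  have "\<bar>(\<Sum>l<N. B a l * Mw l) - w a\<bar> \<le> 1 / (2 * real m) * (\<Sum>j<m. \<bar>w j\<bar>)"
    unfolding eq using near a(1) by (intro abs_sum_mult_le) (auto simp: near_identity_def)
  also have "\<dots> \<le> 1 / (2 * real m) * (real m * W)"
    using W sum_bounded_above[of "{..<m}" "\<lambda>j. \<bar>w j\<bar>" W] by (intro mult_left_mono) auto
  also have "\<dots> = W / 2" using a(1) by simp
  finally have W2: "W \<le> 2 * \<bar>\<Sum>l<N. B a l * Mw l\<bar>" using a(2) by linarith
  \<comment> \<open>The bound is the maximum of the \<open>\<bar>Mw l\<bar>\<close>, replaced by 0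
    if there are no rows.\<close>
  have "\<exists>x. (\<forall>l<N. \<bar>Mw l\<bar> \<le> x) \<and> 2 * \<beta> * x \<le> e"
  proof (cases "N = 0")
    case False
    define x where "x = Max ((\<lambda>l. \<bar>Mw l\<bar>) ` {..<N})"
    have "x \<in> (\<lambda>l. \<bar>Mw l\<bar>) ` {..<N}" unfolding x_def using False by (intro Max_in) auto
    then obtain l where "l < N" "x = \<bar>Mw l\<bar>" by auto
    hence "2 * \<beta> * x \<le> e" using w by (simp add: Mw_def \<beta>_def)
    moreover have "\<bar>Mw l\<bar> \<le> x" if "l < N" for l
      unfolding x_def using that by (intro Max_ge) auto
    ultimately show ?thesis by blast
  qed (use e in \<open>auto intro!: exI[of _ 0]\<close>)
  then obtain x where x: "\<And>l. l < N \<Longrightarrow> \<bar>Mw l\<bar> \<le> x" "2 * \<beta> * x \<le> e" by blast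
  have "\<bar>\<Sum>l<N. B a l * Mw l\<bar> \<le> x * (\<Sum>l<N. \<bar>B a l\<bar>)"
    using x(1) by (intro abs_sum_mult_le) auto
  also have "\<dots> \<le> x * \<beta>"
  proof (cases "N = 0")
    case False
    hence "0 \<le> x" using x(1)[of 0] by simp
    thus ?thesis unfolding \<beta>_def using a(1)
      by (intro mult_left_mono member_le_sum) (auto intro: sum_nonneg)
  qed (simp add: \<beta>_def)
  finally have "2 * \<bar>\<Sum>l<N. B a l * Mw l\<bar> \<le> 2 * \<beta> * x" by (simp add: mult_ac)
  hence "W \<le> e" using W2 x(2) by linarith
  with W[OF i] show ?thesis by simp
qed

lemma near_identity_inj:
  assumes "near_identity N m B M" "\<And>l. l < N \<Longrightarrow> (\<Sum>j<m. M l j * w j) = 0" "i < m"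
  shows "w i = 0"
  using near_identity_bound[OF assms(1), of w 0 i] assms(2,3) by simp

text \<open>The coordinates come from an accepted candidate, and nothing is known of them but the
  certificate. Without row \<open>n\<close> there remain \<open>rank + (k - 1) = m - 1\<close>
  conditions, satisfied by some nonzero \<open>v\<close>; injectivity makes its value in row
  \<open>n\<close> nonzero, and scaling finishes.\<close>

lemma bordered_unique_solution:
  fixes A :: "real mat"
  assumes A: "A \<in> carrier_mat n m" and r: "vec_space.rank n A < m"
    and near: "near_identity (n + m) m B (bordered n (m - vec_space.rank n A) (\<lambda>i j. A $$ (i, j)) \<pi>)"
  obtains v where "\<And>l. l < n + m \<Longrightarrow>
    (\<Sum>j<m. bordered n (m - vec_space.rank n A) (\<lambda>i j. A $$ (i, j)) \<pi> l j * v j) = of_bool (l = n)"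
proof -
  define k where "k = m - vec_space.rank n A"
  define M where "M = bordered n k (\<lambda>i j. A $$ (i, j)) \<pi>"
  have k: "0 < k" "vec_space.rank n A + card {1..<k} < m" using r by (auto simp: k_def)
  obtain v where v: "\<exists>j<m. v j \<noteq> 0" "\<And>i. i < n \<Longrightarrow> (\<Sum>j<m. A $$ (i, j) * v j) = 0"
    "\<And>i. i \<in> {1..<k} \<Longrightarrow> (\<Sum>j<m. of_bool (\<pi> i = j) * v j) = 0"
    using kernel_meets_hyperplanes[OF A _ k(2), of "\<lambda>i j. of_bool (\<pi> i = j)"] by auto
  have Mv: "(\<Sum>j<m. M l j * v j) = 0" if "l < n + m" "l \<noteq> n" for l
  proof (cases "l < n")
    case True
    thus ?thesis using v(2) by (simp add: M_def bordered_def)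
  next
    case False
    show ?thesis
    proof (cases "l - n < k")
      case True
      with False that have "l - n \<in> {1..<k}" by auto
      from v(3)[OF this] show ?thesis using True False by (simp add: M_def bordered_def)
    qed (use False in \<open>simp add: M_def bordered_def\<close>)
  qed
  define c where "c = (\<Sum>j<m. M n j * v j)"
  have "c \<noteq> 0"
  proof
    assume "c = 0"
    hence "\<And>l. l < n + m \<Longrightarrow> (\<Sum>j<m. M l j * v j) = 0" using Mv by (metis c_def)
    hence "\<forall>j<m. v j = 0"
      using near_identity_inj[OF near[folded k_def, folded M_def]] by blast
    with v(1) show False by blast
  qed
  moreover have "(\<Sum>j<m. M l j * (v j / c)) = (\<Sum>j<m. M l j * v j) / c" for l
    by (simp add: sum_divide_distrib)
  ultimately have "(\<Sum>j<m. M l j * (v j / c)) = of_bool (l = n)" if "l < n + m" for l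
    using Mv that by (auto simp: c_def)
  thus thesis by (rule that[folded k_def, folded M_def])
qed

text \<open>
  A candidate \<open>x\<close> stores in \<open>item x 0\<close> the precision at which the input is consulted. The first accepted
  candidate is a certificate: rational entries of an approximate left inverse of the bordered
  matrix, and the selected coordinates. It makes the solution \<open>v\<close> of the bordered system with right
  hand side \<open>e\<^sub>n\<close> unique and bounds the error of approximate solutions by their defect. The
  later candidates are rational vectors whose defect certifies the distance \<open>2\<^sup>-\<^sup>k\<close> to \<open>v\<close>.
\<close>

definition cert_inverse :: "nat \<Rightarrow> nat \<Rightarrow> nat \<Rightarrow> nat \<Rightarrow> nat \<Rightarrow> real" where
  "cert_inverse n m x i l = rat_val (item x (Suc (i * (n + m) + l)))"

definition cert_coord :: "nat \<Rightarrow> nat \<Rightarrow> nat \<Rightarrow> nat \<Rightarrow> nat" where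
  "cert_coord n m x k = item x (Suc (m * (n + m) + k))"

definition approx_bordered ::
  "nat \<Rightarrow> nat \<Rightarrow> nat \<Rightarrow> nat \<Rightarrow> nat \<Rightarrow> nat \<Rightarrow> nat \<Rightarrow> nat \<Rightarrow> nat \<Rightarrow> real" where
  "approx_bordered n m r h t k x =
     bordered n (m - r) (\<lambda>i j. rat_val (hval (n * m) (i * m + j) h t k)) (cert_coord n m x)"

definition cand_vec :: "nat \<Rightarrow> nat \<Rightarrow> real" where
  "cand_vec x j = rat_val (item x (Suc j))"

text \<open>The second summand bounds the error of knowing \<open>A\<close> only up to
  \<open>2^-item x 0\<close>, so that a test on rationals is sound for \<open>A\<close>
  itself.\<close>

definition cert_ok :: "nat \<Rightarrow> nat \<Rightarrow> nat \<Rightarrow> nat \<Rightarrow> nat \<Rightarrow> nat \<Rightarrow> bool" where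
  "cert_ok n m r h t x \<longleftrightarrow> hready (n * m) h t (item x 0) \<and>
     (\<forall>i<m. \<forall>j<m.
        \<bar>(\<Sum>l<n + m. cert_inverse n m x i l * approx_bordered n m r h t (item x 0) x l j) -
           of_bool (i = j)\<bar> +
        (1/2) ^ item x 0 * (\<Sum>l<n + m. \<bar>cert_inverse n m x i l\<bar>) \<le> 1 / real (2 * m))"

text \<open>The defect plus the input error is weighted with twice the size of the approximate
  inverse, the factor in \<open>near_identity_bound\<close>.\<close>

definition sol_ok :: "nat \<Rightarrow> nat \<Rightarrow> nat \<Rightarrow> nat \<Rightarrow> nat \<Rightarrow> nat \<Rightarrow> nat \<Rightarrow> nat \<Rightarrow> bool" where
  "sol_ok n m r h t x0 k x \<longleftrightarrow> hready (n * m) h t (item x 0) \<and>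
     (\<forall>l<n + m. real 2 * (\<Sum>i<m. \<Sum>l<n + m. \<bar>cert_inverse n m x0 i l\<bar>) *
        (\<bar>(\<Sum>j<m. approx_bordered n m r h t (item x 0) x0 l j * cand_vec x j) - of_bool (l = n)\<bar> +
         (1/2) ^ item x 0 * (\<Sum>j<m. \<bar>cand_vec x j\<bar>)) \<le> (1/2) ^ k)"

text \<open>Entry 0 is the certificate, so entry \<open>l\<close> is an approximation of precision
  \<open>l - 1\<close>.\<close>

definition kernel_test ::
  "nat \<Rightarrow> nat \<Rightarrow> nat \<Rightarrow> nat \<Rightarrow> nat \<Rightarrow> nat \<Rightarrow> nat \<Rightarrow> nat \<Rightarrow> bool" where
  "kernel_test n m r h t l L x \<longleftrightarrow>
     (if l = 0 then cert_ok n m r h t x else sol_ok n m r h t (accepted l L 0) (l - 1) x)"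

text \<open>This is a bit of the interleaved \<open>block_code\<close> with a bounded quantifier
  over the blocks: block \<open>k\<close> closes no earlier than position \<open>k\<close>.
  \<open>Suc e\<close> skips the certificate, \<open>Suc (i mod m)\<close> the stored
  precision.\<close>

definition kernel_bit :: "nat \<Rightarrow> nat \<Rightarrow> nat \<Rightarrow> nat \<Rightarrow> bool" where
  "kernel_bit m l L i \<longleftrightarrow> \<not> (\<exists>k<Suc (i div m).
     i div m = (\<Sum>e<Suc k. item (accepted l L (Suc e)) (Suc (i mod m))) + k)"

lemma prq_inverse_const: "prq (\<lambda>z. 1 / real c)"
proof (cases "c = 0")
  case True
  thus ?thesis by (simp add: prq_0)
next
  case False
  thus ?thesis by (intro prq_inverse_of_nat pr_const) simp
qed

lemma prq_cert_inverse: "pr x \<Longrightarrow> prq (\<lambda>z. cert_inverse n m (x z) i l)"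
  unfolding cert_inverse_def by (intro prq_rat_val pr_item pr_const)

lemma prq_cand_vec: "pr x \<Longrightarrow> prq (\<lambda>z. cand_vec (x z) j)"
  unfolding cand_vec_def by (intro prq_rat_val pr_item pr_const)

lemma prq_approx_bordered:
  assumes "pr r" "pr h" "pr t" "pr k" "pr x"
  shows "prq (\<lambda>z. approx_bordered n m (r z) (h z) (t z) (k z) (x z) l j)"
proof (cases "l < n")
  case True
  thus ?thesis unfolding approx_bordered_def bordered_def
    by (simp, intro prq_rat_val pr_hval assms)
next
  case False
  have "prq (\<lambda>z. of_bool (l - n < m - r z \<and> cert_coord n m (x z) (l - n) = j))"
    unfolding cert_coord_def
    by (intro prq_of_bool prp_conj prp_less prp_eq pr_item pr_minus pr_const assms)
  thus ?thesis unfolding approx_bordered_def bordered_def using False by simp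
qed

lemma pr_accepted: "pr l \<Longrightarrow> pr L \<Longrightarrow> pr e \<Longrightarrow> pr (\<lambda>z. accepted (l z) (L z) (e z))"
  unfolding accepted_def by (intro pr_item pr_minus pr_Suc)

lemma prp_kernel_test:
  assumes "pr r" "pr h" "pr t" "pr l" "pr L" "pr x"
  shows "prp (\<lambda>z. kernel_test n m (r z) (h z) (t z) (l z) (L z) (x z))"
  unfolding kernel_test_def cert_ok_def sol_ok_def
  by (intro prp_if prp_eq prp_conj prp_hready prp_all_less prp_prq_le prq_add prq_mult prq_abs prq_diff
      prq_sum prq_half_power prq_cert_inverse prq_approx_bordered prq_cand_vec prq_of_nat
      prq_inverse_const prq_of_bool prp_const pr_accepted pr_item pr_minus pr_const assms)

lemma prp_kernel_bit:
  assumes "pr l" "pr L" "pr i"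
  shows "prp (\<lambda>z. kernel_bit m (l z) (L z) (i z))"
  unfolding kernel_bit_def
  by (intro prp_not prp_ex_less prp_eq pr_add pr_sum pr_item pr_accepted pr_Suc pr_div pr_mod pr_const
      pr_psnd pr_pfst pr.ident pr.psnd pr.pfst pr.comp[OF assms(1)] pr.comp[OF assms(2)] pr.comp[OF assms(3)] assms)

section \<open>Soundness of the tests and success of the search\<close>

context
  fixes n m r :: nat and A :: "real mat" and p :: "nat \<Rightarrow> bool" and s :: "nat \<Rightarrow> nat \<Rightarrow> nat"
  assumes A: "A \<in> carrier_mat n m" and r: "r = vec_space.rank n A" "r < m"
    and p: "\<And>l. l < n * m \<Longrightarrow> (\<lambda>t. p (n * m * t + l)) = block_code (s l)"
    and s: "\<And>l k. l < n * m \<Longrightarrow> \<bar>A $$ (l div m, l mod m) - rat_val (s l k)\<bar> \<le> (1/2) ^ k"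
begin

abbreviation (input) "bord x \<equiv> bordered n (m - r) (\<lambda>i j. A $$ (i, j)) (cert_coord n m x)"

lemma approx_bordered_close:
  assumes "hready (n * m) (hist p t) t k" "l < n + m" "j < m"
  shows "\<bar>approx_bordered n m r (hist p t) t k x l j - bord x l j\<bar> \<le> (1/2) ^ k"
proof (cases "l < n")
  case True
  have "l * m + j < Suc l * m" using assms(3) by simp
  also have "\<dots> \<le> n * m" using True by (intro mult_le_mono1) simp
  finally have idx: "l * m + j < n * m" .
  have "hval (n * m) (l * m + j) (hist p t) t k = s (l * m + j) k"
    using assms(1) idx by (intro hval_hist[OF p]) (auto simp: hready_def)
  thus ?thesis
    using s[OF idx, of k] True assms(3)
    by (simp add: approx_bordered_def bordered_def abs_minus_commute)
qed (simp add: approx_bordered_def bordered_def)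

lemma cert_ok_near_identity:
  assumes "cert_ok n m r (hist p t) t x"
  shows "near_identity (n + m) m (cert_inverse n m x) (bord x)"
  unfolding near_identity_def
proof (intro allI impI)
  fix i j assume ij: "i < m" "j < m"
  let ?B = "cert_inverse n m x i" and ?a = "\<lambda>l. approx_bordered n m r (hist p t) t (item x 0) x l j"
  have ok: "hready (n * m) (hist p t) t (item x 0)"
    "\<bar>(\<Sum>l<n + m. ?B l * ?a l) - of_bool (i = j)\<bar> + (1/2) ^ item x 0 * (\<Sum>l<n + m. \<bar>?B l\<bar>) \<le> 1 / real (2 * m)"
    using assms ij unfolding cert_ok_def by blast+
  have "\<bar>\<Sum>l<n + m. ?B l * (?a l - bord x l j)\<bar> \<le> (1/2) ^ item x 0 * (\<Sum>l<n + m. \<bar>?B l\<bar>)"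
    using approx_bordered_close[OF ok(1)] ij by (intro abs_sum_mult_le) auto
  moreover have "(\<Sum>l<n + m. ?B l * (?a l - bord x l j)) =
      (\<Sum>l<n + m. ?B l * ?a l) - (\<Sum>l<n + m. ?B l * bord x l j)"
    by (simp add: right_diff_distrib sum_subtractf)
  ultimately show "\<bar>(\<Sum>l<n + m. ?B l * bord x l j) - of_bool (i = j)\<bar> \<le> 1 / (2 * real m)"
    using ok(2) by simp
qed

text \<open>The error estimate is applied to \<open>v - cand_vec x\<close>, whose image under the
  bordered matrix is the negative defect of the candidate.\<close>

lemma sol_ok_close:
  assumes near: "near_identity (n + m) m (cert_inverse n m x0) (bord x0)"
    and v: "\<And>l. l < n + m \<Longrightarrow> (\<Sum>j<m. bord x0 l j * v j) = of_bool (l = n)"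
    and ok: "sol_ok n m r (hist p t) t x0 k x" and j: "j < m"
  shows "\<bar>v j - cand_vec x j\<bar> \<le> (1/2) ^ k"
proof (rule near_identity_bound[OF near _ _ j])
  fix l assume l: "l < n + m"
  let ?a = "approx_bordered n m r (hist p t) t (item x 0) x0 l" and ?q = "cand_vec x"
  let ?\<beta> = "\<Sum>i<m. \<Sum>l<n + m. \<bar>cert_inverse n m x0 i l\<bar>"
  have ok': "hready (n * m) (hist p t) t (item x 0)"
    "2 * ?\<beta> * (\<bar>(\<Sum>j<m. ?a j * ?q j) - of_bool (l = n)\<bar> + (1/2) ^ item x 0 * (\<Sum>j<m. \<bar>?q j\<bar>)) \<le> (1/2) ^ k"
    using ok l unfolding sol_ok_def by auto
  have "\<bar>\<Sum>j<m. ?q j * (?a j - bord x0 l j)\<bar> \<le> (1/2) ^ item x 0 * (\<Sum>j<m. \<bar>?q j\<bar>)"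
    using approx_bordered_close[OF ok'(1) l] by (intro abs_sum_mult_le) auto
  moreover have "(\<Sum>j<m. ?q j * (?a j - bord x0 l j)) = (\<Sum>j<m. ?a j * ?q j) - (\<Sum>j<m. bord x0 l j * ?q j)"
    by (simp add: right_diff_distrib sum_subtractf mult.commute)
  moreover have "(\<Sum>j<m. bord x0 l j * (v j - ?q j)) = of_bool (l = n) - (\<Sum>j<m. bord x0 l j * ?q j)"
    using v[OF l] by (simp add: right_diff_distrib sum_subtractf)
  ultimately have "\<bar>\<Sum>j<m. bord x0 l j * (v j - ?q j)\<bar> \<le>
      \<bar>(\<Sum>j<m. ?a j * ?q j) - of_bool (l = n)\<bar> + (1/2) ^ item x 0 * (\<Sum>j<m. \<bar>?q j\<bar>)"
    by linarith
  moreover have "0 \<le> 2 * ?\<beta>" by (simp add: sum_nonneg)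
  ultimately show "2 * ?\<beta> * \<bar>\<Sum>j<m. bord x0 l j * (v j - ?q j)\<bar> \<le> (1/2) ^ k"
    using ok'(2) by (meson mult_left_mono order_trans)
qed simp

text \<open>An exact left inverse leaves the whole tolerance \<open>1 / (2 * m)\<close>. One half is
  spent on rounding it to rationals, the other on the input precision, which enters twice: as the
  error of the approximation and as a summand of the test.\<close>

lemma cert_ok_eventually: "\<exists>x t0. \<forall>t\<ge>t0. cert_ok n m r (hist p t) t x"
proof -
  obtain \<pi> B where B: "\<And>i j. i < m \<Longrightarrow> j < m \<Longrightarrow>
      (\<Sum>l<n + m. B i l * bordered n (m - r) (\<lambda>i j. A $$ (i, j)) \<pi> l j) = of_bool (i = j)"
  proof (rule bordered_left_inverse_exists[OF A, folded r(1)])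
    fix \<pi> B assume "\<And>i j. i < m \<Longrightarrow> j < m \<Longrightarrow>
      (\<Sum>l<n + m. B i l * bordered n (m - r) (\<lambda>i j. A $$ (i, j)) \<pi> l j) = of_bool (i = j)"
    thus thesis by (rule that)
  qed
  define M where "M = bordered n (m - r) (\<lambda>i j. A $$ (i, j)) \<pi>"
  define a where "a = (\<Sum>l<n + m. \<Sum>j<m. \<bar>M l j\<bar>)"
  have m: "0 < 1 / (4 * real m)" using r(2) by simp
  obtain d where d: "d > 0" "a * d \<le> 1 / (4 * real m)"
    using ex_pos_mult_le[OF _ m, of a] unfolding a_def by (auto simp: sum_nonneg)
  have "\<forall>i l. \<exists>c. \<bar>B i l - rat_val c\<bar> \<le> d"
    unfolding rat_val_def by (intro allI ex_rat_code d)
  then obtain c where c: "\<And>i l. \<bar>B i l - rat_val (c i l)\<bar> \<le> d" by metis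
  define b where "b = (\<Sum>i<m. \<Sum>l<n + m. \<bar>rat_val (c i l)\<bar>)"
  \<comment> \<open>The precision depends on the size of the rounded inverse and is therefore chosen
    after it.\<close>
  obtain k where k: "2 * b * (1/2) ^ k \<le> 1 / (4 * real m)"
    using ex_half_power_mult_le[OF _ m, of "2 * b"] unfolding b_def by (auto simp: sum_nonneg)
  define e where "e u = (if u = 0 then k else if u - 1 < m * (n + m)
      then c ((u - 1) div (n + m)) ((u - 1) mod (n + m)) else \<pi> (u - 1 - m * (n + m)))" for u
  obtain x where x: "\<And>u. u < Suc (m * (n + m) + m) \<Longrightarrow> item x u = e u"
    using ex_item[of "Suc (m * (n + m) + m)" e] by blast
  have x0: "item x 0 = k" using x by (simp add: e_def)
  have xB: "cert_inverse n m x i l = rat_val (c i l)" if "i < m" "l < n + m" for i l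
  proof -
    have "i * (n + m) + l < Suc i * (n + m)" using that by simp
    also have "\<dots> \<le> m * (n + m)" using that by (intro mult_le_mono1) simp
    finally show ?thesis using x[of "Suc (i * (n + m) + l)"] that by (simp add: cert_inverse_def e_def)
  qed
  have xM: "bord x l j = M l j" if "l < n + m" for l j
  proof (cases "l < n")
    case False
    hence "l - n < m" using that by simp
    hence "cert_coord n m x (l - n) = \<pi> (l - n)"
      unfolding cert_coord_def by (subst x) (simp_all add: e_def)
    with False show ?thesis by (simp add: bordered_def M_def)
  qed (simp add: bordered_def M_def)
  have "cert_ok n m r (hist p t) t x" if ready: "hready (n * m) (hist p t) t k" for t
    unfolding cert_ok_def x0
  proof (intro conjI allI impI ready)
    fix i j assume ij: "i < m" "j < m"
    let ?a = "\<lambda>l. approx_bordered n m r (hist p t) t k x l j"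
    define R where "R l = rat_val (c i l)" for l
    have "\<bar>\<Sum>l<n + m. R l * (?a l - M l j)\<bar> \<le> (1/2) ^ k * (\<Sum>l<n + m. \<bar>R l\<bar>)"
      using approx_bordered_close[OF ready _ ij(2), of _ x] xM by (intro abs_sum_mult_le) auto
    moreover have "\<bar>\<Sum>l<n + m. M l j * (R l - B i l)\<bar> \<le> d * (\<Sum>l<n + m. \<bar>M l j\<bar>)"
      using c by (intro abs_sum_mult_le) (simp add: R_def abs_minus_commute)
    moreover have "(\<Sum>l<n + m. R l * ?a l) - of_bool (i = j) =
        (\<Sum>l<n + m. R l * (?a l - M l j)) + (\<Sum>l<n + m. M l j * (R l - B i l))"
    proof -
      have "(\<Sum>l<n + m. R l * (?a l - M l j)) = (\<Sum>l<n + m. R l * ?a l) - (\<Sum>l<n + m. R l * M l j)"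
        unfolding sum_subtractf[symmetric] by (intro sum.cong) (simp_all add: algebra_simps)
      moreover have "(\<Sum>l<n + m. M l j * (R l - B i l)) = (\<Sum>l<n + m. R l * M l j) - of_bool (i = j)"
        unfolding B[OF ij, folded M_def, symmetric] sum_subtractf[symmetric]
        by (intro sum.cong) (simp_all add: algebra_simps)
      ultimately show ?thesis by simp
    qed
    moreover have "d * (\<Sum>l<n + m. \<bar>M l j\<bar>) \<le> 1 / (4 * real m)"
    proof -
      have "(\<Sum>l<n + m. \<bar>M l j\<bar>) \<le> a"
        unfolding a_def using ij by (intro sum_mono member_le_sum) auto
      hence "d * (\<Sum>l<n + m. \<bar>M l j\<bar>) \<le> d * a" using d(1) by (intro mult_left_mono) auto
      with d(2) show ?thesis by (simp add: mult.commute)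
    qed
    moreover have "2 * ((1/2) ^ k * (\<Sum>l<n + m. \<bar>R l\<bar>)) \<le> 1 / (4 * real m)"
    proof -
      have "(\<Sum>l<n + m. \<bar>R l\<bar>) \<le> b"
        unfolding b_def R_def using ij
        by (intro member_le_sum[of i "{..<m}" "\<lambda>i. \<Sum>l<n + m. \<bar>rat_val (c i l)\<bar>"]) (auto intro: sum_nonneg)
      hence "(1/2) ^ k * (\<Sum>l<n + m. \<bar>R l\<bar>) \<le> (1/2) ^ k * b" by (intro mult_left_mono) auto
      moreover have "2 * ((1/2) ^ k * b) \<le> 1 / (4 * real m)" using k by (simp only: mult_ac)
      ultimately show ?thesis by linarith
    qed
    moreover have "1 / (4 * real m) + 1 / (4 * real m) = 1 / real (2 * m)" by simp
    ultimately have "\<bar>(\<Sum>l<n + m. R l * ?a l) - of_bool (i = j)\<bar> + (1/2) ^ k * (\<Sum>l<n + m. \<bar>R l\<bar>) \<le> 1 / real (2 * m)"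
      by linarith
    thus "\<bar>(\<Sum>l<n + m. cert_inverse n m x i l * ?a l) - of_bool (i = j)\<bar> +
        (1/2) ^ k * (\<Sum>l<n + m. \<bar>cert_inverse n m x i l\<bar>) \<le> 1 / real (2 * m)"
      using xB[OF ij(1)] by (simp add: R_def)
  qed
  moreover obtain t0 where "\<forall>t\<ge>t0. hready (n * m) (hist p t) t k"
    using hready_hist_eventually[OF p] by blast
  ultimately show ?thesis by blast
qed

lemma sol_ok_eventually:
  assumes v: "\<And>l. l < n + m \<Longrightarrow> (\<Sum>j<m. bord x0 l j * v j) = of_bool (l = n)"
  shows "\<exists>x t0. \<forall>t\<ge>t0. sol_ok n m r (hist p t) t x0 k x"
proof -
  define \<beta> where "\<beta> = (\<Sum>i<m. \<Sum>l<n + m. \<bar>cert_inverse n m x0 i l\<bar>)"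
  define a where "a = (\<Sum>l<n + m. \<Sum>j<m. \<bar>bord x0 l j\<bar>)"
  have \<beta>: "0 \<le> \<beta>" and a: "0 \<le> a" by (auto simp: \<beta>_def a_def sum_nonneg)
  \<comment> \<open>Half of the tolerance is for rounding \<open>v\<close>, half for the input
    precision, which again enters twice.\<close>
  have half: "0 < (1/2::real) ^ k / 2" by simp
  obtain d where d: "d > 0" "2 * \<beta> * a * d \<le> (1/2) ^ k / 2"
    using ex_pos_mult_le[OF _ half, of "2 * \<beta> * a"] \<beta> a by auto
  have "\<forall>j. \<exists>c. \<bar>v j - rat_val c\<bar> \<le> d"
    unfolding rat_val_def by (intro allI ex_rat_code d)
  then obtain c where c: "\<And>j. \<bar>v j - rat_val (c j)\<bar> \<le> d" by metis
  define b where "b = (\<Sum>j<m. \<bar>rat_val (c j)\<bar>)"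
  have b: "0 \<le> b" by (simp add: b_def sum_nonneg)
  obtain K where K: "2 * \<beta> * (2 * b) * (1/2) ^ K \<le> (1/2) ^ k / 2"
    using ex_half_power_mult_le[OF _ half, of "2 * \<beta> * (2 * b)"] \<beta> b by auto
  obtain x where x: "\<And>u. u < Suc m \<Longrightarrow> item x u = (if u = 0 then K else c (u - 1))"
    using ex_item[of "Suc m" "\<lambda>u. if u = 0 then K else c (u - 1)"] by blast
  have x0: "item x 0 = K" using x by simp
  have xq: "cand_vec x j = rat_val (c j)" if "j < m" for j
    using x[of "Suc j"] that by (simp add: cand_vec_def)
  have "sol_ok n m r (hist p t) t x0 k x" if ready: "hready (n * m) (hist p t) t K" for t
    unfolding sol_ok_def x0 \<beta>_def[symmetric]
  proof (intro conjI allI impI ready)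
    fix l assume l: "l < n + m"
    let ?a = "approx_bordered n m r (hist p t) t K x0 l"
    define q where "q j = rat_val (c j)" for j
    have "\<bar>\<Sum>j<m. q j * (?a j - bord x0 l j)\<bar> \<le> (1/2) ^ K * b"
      unfolding b_def q_def using approx_bordered_close[OF ready l] by (intro abs_sum_mult_le) auto
    moreover have "\<bar>\<Sum>j<m. bord x0 l j * (q j - v j)\<bar> \<le> d * (\<Sum>j<m. \<bar>bord x0 l j\<bar>)"
      using c by (intro abs_sum_mult_le) (simp add: q_def abs_minus_commute)
    moreover have "d * (\<Sum>j<m. \<bar>bord x0 l j\<bar>) \<le> d * a"
      unfolding a_def using l d(1)
      by (intro mult_left_mono member_le_sum[of l "{..<n + m}" "\<lambda>l. \<Sum>j<m. \<bar>bord x0 l j\<bar>"]) (auto intro: sum_nonneg)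
    moreover have "(\<Sum>j<m. ?a j * q j) - of_bool (l = n) =
        (\<Sum>j<m. q j * (?a j - bord x0 l j)) + (\<Sum>j<m. bord x0 l j * (q j - v j))"
    proof -
      have "(\<Sum>j<m. q j * (?a j - bord x0 l j)) = (\<Sum>j<m. ?a j * q j) - (\<Sum>j<m. bord x0 l j * q j)"
        unfolding sum_subtractf[symmetric] by (intro sum.cong) (simp_all add: algebra_simps)
      moreover have "(\<Sum>j<m. bord x0 l j * (q j - v j)) = (\<Sum>j<m. bord x0 l j * q j) - of_bool (l = n)"
        unfolding v[OF l, symmetric] sum_subtractf[symmetric] by (intro sum.cong) (simp_all add: algebra_simps)
      ultimately show ?thesis by simp
    qed
    ultimately have "\<bar>(\<Sum>j<m. ?a j * q j) - of_bool (l = n)\<bar> + (1/2) ^ K * b \<le> 2 * ((1/2) ^ K * b) + d * a"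
      by linarith
    hence "2 * \<beta> * (\<bar>(\<Sum>j<m. ?a j * q j) - of_bool (l = n)\<bar> + (1/2) ^ K * b) \<le> 2 * \<beta> * (2 * ((1/2) ^ K * b) + d * a)"
      using \<beta> by (intro mult_left_mono) auto
    also have "\<dots> = 2 * \<beta> * (2 * b) * (1/2) ^ K + 2 * \<beta> * a * d" by (simp add: algebra_simps)
    also have "\<dots> \<le> (1/2) ^ k" using K d(2) by simp
    finally show "real 2 * \<beta> * (\<bar>(\<Sum>j<m. ?a j * cand_vec x j) - of_bool (l = n)\<bar> +
        (1/2) ^ K * (\<Sum>j<m. \<bar>cand_vec x j\<bar>)) \<le> (1/2) ^ k"
      using xq by (simp add: q_def b_def)
  qed
  moreover obtain t0 where "\<forall>t\<ge>t0. hready (n * m) (hist p t) t K"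
    using hready_hist_eventually[OF p] by blast
  ultimately show ?thesis by blast
qed

lemma kernel_test_live:
  assumes "l = 0 \<and> L = 0 \<or> 0 < l \<and> (\<exists>t. kernel_test n m r (hist p t) t 0 0 (accepted l L 0))"
  shows "\<exists>x t0. \<forall>t\<ge>t0. kernel_test n m r (hist p t) t l L x"
proof (cases "l = 0")
  case True
  thus ?thesis using cert_ok_eventually by (simp add: kernel_test_def)
next
  case False
  then obtain t where "cert_ok n m r (hist p t) t (accepted l L 0)"
    using assms by (auto simp: kernel_test_def)
  from cert_ok_near_identity[OF this]
  obtain v where "\<And>i. i < n + m \<Longrightarrow> (\<Sum>j<m. bord (accepted l L 0) i j * v j) = of_bool (i = n)"
    unfolding r(1) using bordered_unique_solution[OF A] r by blast
  from sol_ok_eventually[OF this] False show ?thesis by (simp add: kernel_test_def)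
qed

lemma kernel_output:
  assumes "\<exists>t. kernel_test n m r (hist p t) t 0 0 (xs 0)"
    and "\<And>k. \<exists>t L. accepted (Suc k) L 0 = xs 0 \<and> kernel_test n m r (hist p t) t (Suc k) L (xs (Suc k))"
  shows "\<exists>b \<in> mat_kernel A - {0\<^sub>v m}.
    cauchy_vec_rep m (interleave m (\<lambda>j. block_code (\<lambda>k. item (xs (Suc k)) (Suc j)))) b"
proof -
  from assms(1) obtain t where "cert_ok n m r (hist p t) t (xs 0)"
    by (auto simp: kernel_test_def)
  from cert_ok_near_identity[OF this]
  have near: "near_identity (n + m) m (cert_inverse n m (xs 0)) (bord (xs 0))" .
  then obtain v where v: "\<And>i. i < n + m \<Longrightarrow> (\<Sum>j<m. bord (xs 0) i j * v j) = of_bool (i = n)"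
    unfolding r(1) using bordered_unique_solution[OF A] r by blast
  have close: "\<bar>v j - cand_vec (xs (Suc k)) j\<bar> \<le> (1/2) ^ k" if "j < m" for j k
  proof -
    from assms(2)[of k] obtain t L where "accepted (Suc k) L 0 = xs 0"
      "kernel_test n m r (hist p t) t (Suc k) L (xs (Suc k))" by blast
    hence "sol_ok n m r (hist p t) t (xs 0) k (xs (Suc k))" by (simp add: kernel_test_def)
    from sol_ok_close[OF near v this that] show ?thesis .
  qed
  show ?thesis
  proof (intro bexI[of _ "vec m v"])
    show "cauchy_vec_rep m (interleave m (\<lambda>j. block_code (\<lambda>k. item (xs (Suc k)) (Suc j)))) (vec m v)"
      using close by (intro cauchy_vec_rep_interleave) (auto simp: cand_vec_def rat_val_def)
    have "(\<Sum>j<m. A $$ (i, j) * v j) = 0" if "i < n" for i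
      using v[of i] that by (simp add: bordered_def)
    hence "vec m v \<in> mat_kernel A" by (simp add: mat_kernel_iff_sums[OF A])
    moreover have "vec m v \<noteq> 0\<^sub>v m"
    proof
      assume "vec m v = 0\<^sub>v m"
      hence "v j = 0" if "j < m" for j using that by (metis index_vec index_zero_vec(1))
      \<comment> \<open>Row \<open>n\<close> has the right-hand side 1, so the zero vector does not
        solve the system.\<close>
      hence "(\<Sum>j<m. bord (xs 0) n j * v j) = 0" by simp
      with v[of n] r(2) show False by simp
    qed
    ultimately show "vec m v \<in> mat_kernel A - {0\<^sub>v m}" by simp
  qed
qed

end

text \<open>Bit \<open>i\<close> needs the blocks up to \<open>i div m \<le> i\<close>, hence no
  entry beyond \<open>Suc i\<close>; this explains the emission condition
  \<open>Suc i < l\<close>.\<close>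

lemma kernel_bit_interleave:
  assumes "Suc i < l" "\<forall>e<l. accepted l L e = xs e"
  shows "kernel_bit m l L i = interleave m (\<lambda>j. block_code (\<lambda>k. item (xs (Suc k)) (Suc j))) i"
proof -
  have sum: "(\<Sum>e<Suc k. item (accepted l L (Suc e)) (Suc (i mod m))) = (\<Sum>e\<le>k. item (xs (Suc e)) (Suc (i mod m)))"
    if "k < Suc (i div m)" for k
    unfolding lessThan_Suc_atMost
  proof (intro sum.cong refl)
    fix e assume "e \<in> {..k}"
    moreover have "i div m \<le> i" by simp
    ultimately have "Suc e < l" using that assms(1) by (simp only: atMost_iff)
    with assms(2) show "item (accepted l L (Suc e)) (Suc (i mod m)) = item (xs (Suc e)) (Suc (i mod m))" by simp
  qed
  show ?thesis
    unfolding kernel_bit_def interleave_def block_code_def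
  proof (intro iffI allI notI)
    fix k assume *: "\<not> (\<exists>k<Suc (i div m). i div m = (\<Sum>e<Suc k. item (accepted l L (Suc e)) (Suc (i mod m))) + k)"
      "i div m = (\<Sum>e\<le>k. item (xs (Suc e)) (Suc (i mod m))) + k"
    hence "k < Suc (i div m)" by simp
    with * sum show False by metis
  next
    assume *: "\<forall>k. i div m \<noteq> (\<Sum>e\<le>k. item (xs (Suc e)) (Suc (i mod m))) + k"
      "\<exists>k<Suc (i div m). i div m = (\<Sum>e<Suc k. item (accepted l L (Suc e)) (Suc (i mod m))) + k"
    with sum show False by metis
  qed
qed

section \<open>The partition by rank\<close>

definition rank_class :: "nat \<Rightarrow> nat \<Rightarrow> nat \<Rightarrow> real mat set" where
  "rank_class n m r = {A \<in> carrier_mat n m. vec_space.rank n A = r}"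

text \<open>Removing the empty set yields a partition without exhibiting a matrix of every rank. The
  classes are then counted only from above; the matching lower bound comes from continuity.\<close>

definition rank_partition :: "nat \<Rightarrow> nat \<Rightarrow> real mat set set" where
  "rank_partition n m = rank_class n m ` {r. int r \<le> lineq_bound n m} - {{}}"

lemma partition_on_rank_partition: "partition_on (lineq_dom n m) (rank_partition n m)"
  by (rule partition_onI) (auto simp: rank_partition_def rank_class_def lineq_dom_def disjnt_def)

lemma ecard_rank_partition: "ecard (rank_partition n m) \<le> enat (nat (lineq_bound n m + 1))"
proof -
  have eq: "{r. int r \<le> lineq_bound n m} = {..<nat (lineq_bound n m + 1)}" by auto
  have sub: "rank_partition n m \<subseteq> rank_class n m ` {..<nat (lineq_bound n m + 1)}"
    unfolding rank_partition_def eq by blast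
  have "card (rank_partition n m) \<le> card (rank_class n m ` {..<nat (lineq_bound n m + 1)})"
    by (rule card_mono[OF _ sub]) simp
  also have "\<dots> \<le> nat (lineq_bound n m + 1)"
    using card_image_le[of "{..<nat (lineq_bound n m + 1)}" "rank_class n m"] by simp
  finally show ?thesis
    using finite_subset[OF sub] by (simp add: ecard_def)
qed

lemma computable_with_rank_partition:
  "computable_with_partition (cauchy_mat_rep n m) (cauchy_vec_rep m) (LinEq n m) (rank_partition n m)"
proof -
  \<comment> \<open>Only the length of the advice word reaches the machine, so all words of length
    \<open>r\<close> name the class of rank \<open>r\<close>.\<close>
  define \<delta> where "\<delta> w = (if int (length w) \<le> lineq_bound n m \<and> rank_class n m (length w) \<noteq> {}
      then Some (rank_class n m (length w)) else None)" for w :: "bool list"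
  have notat: "is_notation \<delta> (rank_partition n m)"
    unfolding is_notation_def
  proof (intro equalityI subsetI)
    fix D assume "D \<in> rank_partition n m"
    then obtain r where "D = rank_class n m r" "int r \<le> lineq_bound n m" "D \<noteq> {}"
      by (auto simp: rank_partition_def)
    hence "\<delta> (replicate r True) = Some D" by (simp add: \<delta>_def)
    thus "D \<in> ran \<delta>" by (auto simp: ran_def)
  qed (auto simp: ran_def \<delta>_def rank_partition_def split: if_splits)
  have "\<exists>M. type2_wf M \<and> num_inputs M = 2 \<and> (\<forall>p w.
    (\<forall>l L. l = 0 \<and> L = 0 \<or> 0 < l \<and> (\<exists>t. kernel_test n m (length w) (hist p t) t 0 0 (accepted l L 0)) \<longrightarrow>
       (\<exists>x t0. \<forall>t\<ge>t0. kernel_test n m (length w) (hist p t) t l L x)) \<longrightarrow>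
    (\<exists>xs. (\<exists>t. kernel_test n m (length w) (hist p t) t 0 0 (xs 0)) \<and>
       (\<forall>k. \<exists>t L. accepted (Suc k) L 0 = xs 0 \<and> kernel_test n m (length w) (hist p t) t (Suc k) L (xs (Suc k))) \<and>
       (\<forall>q. (\<forall>l L i. Suc i < l \<and> (\<forall>e<l. accepted l L e = xs e) \<longrightarrow> kernel_bit m l L i = q i) \<longrightarrow>
          type2_outputs M [inf_tape p, word_tape w] q)))"
    by (rule search_transducer) (assumption | rule prp_kernel_test prp_kernel_bit)+
  then obtain M where M: "type2_wf M \<and> num_inputs M = 2 \<and> (\<forall>p w.
    (\<forall>l L. l = 0 \<and> L = 0 \<or> 0 < l \<and> (\<exists>t. kernel_test n m (length w) (hist p t) t 0 0 (accepted l L 0)) \<longrightarrow>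
       (\<exists>x t0. \<forall>t\<ge>t0. kernel_test n m (length w) (hist p t) t l L x)) \<longrightarrow>
    (\<exists>xs. (\<exists>t. kernel_test n m (length w) (hist p t) t 0 0 (xs 0)) \<and>
       (\<forall>k. \<exists>t L. accepted (Suc k) L 0 = xs 0 \<and> kernel_test n m (length w) (hist p t) t (Suc k) L (xs (Suc k))) \<and>
       (\<forall>q. (\<forall>l L i. Suc i < l \<and> (\<forall>e<l. accepted l L e = xs e) \<longrightarrow> kernel_bit m l L i = q i) \<longrightarrow>
          type2_outputs M [inf_tape p, word_tape w] q)))" ..
  have out: "\<exists>q b. type2_outputs M [inf_tape p, word_tape w] q \<and> cauchy_vec_rep m q b \<and> b \<in> LinEq n m A"
    if w: "\<delta> w = Some D" and AD: "A \<in> D" and pA: "cauchy_mat_rep n m p A" for D w A p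
  proof -
    let ?r = "length w"
    have A: "A \<in> carrier_mat n m" "?r = vec_space.rank n A" "int ?r \<le> lineq_bound n m"
      using w AD by (auto simp: \<delta>_def rank_class_def split: if_splits)
    have rm: "?r < m" using A(3) by (simp add: lineq_bound_def)
    have "\<forall>l<n * m. \<exists>s. (\<lambda>t. p (n * m * t + l)) = block_code s \<and>
        (\<forall>k. \<bar>A $$ (l div m, l mod m) - rat_val (s k)\<bar> \<le> (1/2) ^ k)"
      using pA by (auto simp: cauchy_mat_rep_def cauchy_vec_rep_def cauchy_rep_def rat_val_def)
    then obtain s where s: "\<And>l. l < n * m \<Longrightarrow> (\<lambda>t. p (n * m * t + l)) = block_code (s l)"
      "\<And>l k. l < n * m \<Longrightarrow> \<bar>A $$ (l div m, l mod m) - rat_val (s l k)\<bar> \<le> (1/2) ^ k"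
      by metis
    have live: "\<forall>l L. l = 0 \<and> L = 0 \<or> 0 < l \<and> (\<exists>t. kernel_test n m ?r (hist p t) t 0 0 (accepted l L 0)) \<longrightarrow>
       (\<exists>x t0. \<forall>t\<ge>t0. kernel_test n m ?r (hist p t) t l L x)"
      using kernel_test_live[OF A(1,2) rm s] by blast
    from M[THEN conjunct2, THEN conjunct2, THEN spec, THEN spec, THEN mp, OF live] obtain xs where
      "(\<exists>t. kernel_test n m ?r (hist p t) t 0 0 (xs 0)) \<and>
       (\<forall>k. \<exists>t L. accepted (Suc k) L 0 = xs 0 \<and> kernel_test n m ?r (hist p t) t (Suc k) L (xs (Suc k))) \<and>
       (\<forall>q. (\<forall>l L i. Suc i < l \<and> (\<forall>e<l. accepted l L e = xs e) \<longrightarrow> kernel_bit m l L i = q i) \<longrightarrow>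
          type2_outputs M [inf_tape p, word_tape w] q)" ..
    note xs = this[THEN conjunct1] this[THEN conjunct2, THEN conjunct1, THEN spec]
      this[THEN conjunct2, THEN conjunct2, THEN spec, THEN mp]
    define q where "q = interleave m (\<lambda>j. block_code (\<lambda>k. item (xs (Suc k)) (Suc j)))"
    have "type2_outputs M [inf_tape p, word_tape w] q"
      by (rule xs(3)) (use kernel_bit_interleave in \<open>auto simp: q_def\<close>)
    moreover obtain b where "b \<in> mat_kernel A - {0\<^sub>v m}" "cauchy_vec_rep m q b"
      using kernel_output[OF A(1,2) rm s xs(1,2)] unfolding q_def by blast
    moreover have "A \<in> lineq_dom n m" using A by (simp add: lineq_dom_def)
    ultimately show ?thesis by (auto simp: LinEq_def)
  qed
  show ?thesis
    unfolding computable_with_partition_def mv_dom_LinEq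
  proof (intro conjI exI[of _ \<delta>] exI[of _ M] allI impI)
    show "partition_on (lineq_dom n m) (rank_partition n m)" by (rule partition_on_rank_partition)
    show "countable (rank_partition n m)"
      unfolding rank_partition_def by (intro countable_Diff countable_image) simp
    show "is_notation \<delta> (rank_partition n m)" by (rule notat)
    show "type2_wf M" "num_inputs M = 2" using M by blast+
  qed (elim conjE, rule out)
qed

theorem theorem1:
  fixes n m :: nat and d :: int
  assumes "d = min (int n) (int m - 1)"
  shows "(\<forall>A. A \<in> carrier_mat n m \<and> int (vec_space.rank n A) \<le> d \<longrightarrow> LinEq n m A \<noteq> {}) \<and>
    card_discontinuity (mat_topology n m) (vec_topology m) (LinEq n m) = enat (nat (d + 1)) \<and>
    card_advice (cauchy_mat_rep n m) (cauchy_vec_rep m) (LinEq n m) = enat (nat (d + 1))"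
proof -
  have d: "d = lineq_bound n m" using assms by (simp add: lineq_bound_def)
  have "mv_dom (LinEq n m) \<subseteq> carrier_mat n m"
    unfolding mv_dom_LinEq lineq_dom_def by blast
  note t_le_c = card_discontinuity_le_card_advice[OF this, of m]
  have "card_advice (cauchy_mat_rep n m) (cauchy_vec_rep m) (LinEq n m) \<le> ecard (rank_partition n m)"
    unfolding card_advice_def using computable_with_rank_partition by (intro Inf_lower) blast
  also note ecard_rank_partition
  finally have c_le: "card_advice (cauchy_mat_rep n m) (cauchy_vec_rep m) (LinEq n m) \<le> enat (nat (d + 1))"
    by (simp only: d)
  have t_ge: "enat (nat (d + 1)) \<le> card_discontinuity (mat_topology n m) (vec_topology m) (LinEq n m)"
    unfolding d by (rule card_discontinuity_LinEq_ge)
  have "\<forall>A. A \<in> carrier_mat n m \<and> int (vec_space.rank n A) \<le> d \<longrightarrow> LinEq n m A \<noteq> {}"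
    using LinEq_nonempty unfolding d lineq_dom_def by blast
  \<comment> \<open>The topological cardinal is bounded from below and the larger computational one
    from above by the same number.\<close>
  thus ?thesis
    using t_le_c c_le t_ge by (auto intro: antisym order_trans)
qed

end
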